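(* The coalgebras for the comonad $(\mathbf{Fa\grave{a}},\epsilon,\delta)$ on $\mathbf{cartCat}$ are exactly the generalized Cartesian differential categories. That is, for every Cartesian category $\mathbb{X}$, sending a coalgebra structure $\mathcal{D}:\mathbb{X}\to\mathbf{Fa\grave{a}}(\mathbb{X})$, with $\mathcal{D}(X)=(\mathcal{D}_0(X),\mathcal{D}_1(X))$, to the data $$L(X):=\mathcal{D}_0(X),\qquad D[f]:=[\mathcal{D}(f)]_1$$ defines a bijection between $\mathbf{Fa\grave{a}}$-coalgebra structures on $\mathbb{X}$ and generalized Cartesian differential structures on $\mathbb{X}$.
   Context: Composition is diagrammatic: $fg$ means first $f$, then $g$. A Cartesian category is a category with chosen finite products (including a chosen terminal object $1$). $\mathbf{cartCat}$ is the category whose objects are Cartesian categories and whose arrows are functors preserving the chosen finite products exactly. For a commutative monoid $(A,+,0)$ in $\mathbb{X}$ and maps $f,g:X\to A$, $f+g := \langle f,g\rangle +$ and $0: X\to A$ denotes $!\,0$. In $A^n\times X$, $\pi_0,\ldots,\pi_{n-1}$ are the projections to the copies of $A$ and $\pi_n$ the projection to $X$. We write $h(z_1,\ldots,z_k)$ for $\langle z_1,\ldots,z_k\rangle h$. A generalized Cartesian differential structure on a Cartesian category $\mathbb{X}$ consists of: for each object $X$, a commutative monoid $L(X)=(L_0(X),+_X,0_X)$ in $\mathbb{X}$ with $L(L_0(X))=L(X)$, $L(X\times Y)=L(X)\times L(Y)$ (product monoid) and $L(1)=1$; and for each map $f:X\to Y$ a map $D[f]:L_0(X)\times X\to L_0(Y)$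 such that (for all well-typed maps): [CD.1] $D[+_X]=\pi_0+_X$, $D[0_X]=\pi_0 0_X$; [CD.2] $\langle a+b,c\rangle D[f]=\langle a,c\rangle D[f]+\langle b,c\rangle D[f]$ and $\langle 0,a\rangle D[f]=0$; [CD.3] $D[\pi_0]=\pi_0\pi_0$ and $D[\pi_1]=\pi_0\pi_1$; [CD.4] $D[\langle f,g\rangle]=\langle D[f],D[g]\rangle$; [CD.5] $D[fg]=\langle D[f],\pi_1f\rangle D[g]$; [CD.6] $\langle\langle a,0\rangle,\langle c,d\rangle\rangle D[D[f]]=\langle a,d\rangle D[f]$; [CD.7] $\langle\langle 0,b\rangle,\langle c,d\rangle\rangle D[D[f]]=\langle\langle 0,c\rangle,\langle b,d\rangle\rangle D[D[f]]$. A Cartesian category with such a structure is a generalized Cartesian differential category. The category $\mathbf{Fa\grave{a}}(\mathbb{X})$. Objects: pairs $((A,+,0),X)$, abbreviated $(A,X)$, with $(A,+,0)$ a commutative monoid in $\mathbb{X}$ and $X$ an object of $\mathbb{X}$. A morphism $(A,X)\to(B,Y)$ is a sequence $f=(f_*,f_1,f_2,\ldots)$ with $f_*: X\to Y$ a map of $\mathbb{X}$ and, for $n\ge 1$, $f_n: A^n\times X\to B$ a map that is symmetric in its first $n$ arguments and additive (preserves $+$ and $0$) in each of them. Identities: $(1_X,\pi_0,0,0,\ldots)$. Composition of $f:(A,X)\to(B,Y)$ and $g:(B,Y)\to(C,Z)$: $(fg)_*=f_*g_*$ and $$(fg)_n(a_1,\ldots,a_n,x)=\sum_{\{B_1,\ldots,B_k\}}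 g_k\big(f_{|B_1|}(a_{B_1},x),\ldots,f_{|B_k|}(a_{B_k},x),f_*(x)\big),$$ the sum being over all partitions of $\{1,\ldots,n\}$ into nonempty blocks, with $f_m(a_{B},x)=f_m(a_{i_1},\ldots,a_{i_m},x)$ for $B=\{i_1<\cdots<i_m\}$, and $a_1,\ldots,a_n,x$ the projections from $A^n\times X$. Chosen products: $(A,X)\times(B,Y)=(A\times B, X\times Y)$ with the product monoid structure on $A\times B$, and projections $(\pi_i,\pi_0\pi_i,0,0,\ldots)$, $i=0,1$; the terminal object is $(1,1)$. On a functor $F$ in $\mathbf{cartCat}$: $\mathbf{Fa\grave{a}}(F)((A,+,0),X)=((FA,F+,F0),FX)$ and $\mathbf{Fa\grave{a}}(F)(f_*,f_1,\ldots)=(F(f_* ),F(f_1),\ldots)$. The comonad structure. $\epsilon((A,+,0),X)=X$, $\epsilon(f)=f_*$. On objects $\delta((A,+,0),X)=\big((((A,+,0),A),(+,\pi_0+,0,\ldots),(0,\pi_00,0,\ldots)),((A,+,0),X)\big)$. For $f:(A,X)\to(B,Y)$: $\delta(f)_*=f$ and, for $n\geq 1$, $\delta(f)_n: (A,A)^n\times(A,X)=(A^n\times A,\,A^n\times X)\to(B,B)$ is the arrow of $\mathbf{Fa\grave{a}}(\mathbb{X})$ with $(\delta(f)_n)_*=f_n$ and, for $r\ge1$, writing the variables of $(A^n\times A)^r\times(A^n\times X)$ as $v^j=(v^j_1,\ldots,v^j_n,w^j)$ for $1\le j\le r$ and $(a_1,\ldots,a_n,x)$, $$(\delta(f)_n)_r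 = \sum_{(S,\varphi)} f_{n+r-|S|}\big(a^{\varphi}_1,\ldots,a^{\varphi}_n,(w^j)_{j\notin S},x\big),$$ the sum being over all subsets $S\subseteq\{1,\ldots,r\}$ and injections $\varphi:S\to\{1,\ldots,n\}$, where $a^\varphi_i=v^j_i$ if $i=\varphi(j)$ for some $j\in S$ and $a^\varphi_i=a_i$ otherwise. A coalgebra structure on $\mathbb{X}$ is a functor $\mathcal{D}:\mathbb{X}\to\mathbf{Fa\grave{a}}(\mathbb{X})$ in $\mathbf{cartCat}$ such that $\mathcal{D}$ followed by $\epsilon$ is the identity, and $\mathcal{D}$ followed by $\delta$ equals $\mathcal{D}$ followed by $\mathbf{Fa\grave{a}}(\mathcal{D})$ (so in particular $\mathcal{D}_1(X)=X$). *)

theory Defs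
  imports "HOL-Algebra.FiniteProduct" "HOL-Combinatorics.Permutations" "HOL-Library.Disjoint_Sets"
begin

section \<open>Cartesian categories\<close>

text \<open>
  A category is given by sets of objects and arrows; composition is diagrammatic. The chosen
  products are recorded by their objects and projections only: pairing and the maps into the
  terminal object are determined by the universal properties.
\<close>

record ('o, 'm) ccat =
  Ob :: "'o set"
  Ar :: "'m set"
  Dom :: "'m \<Rightarrow> 'o"
  Cod :: "'m \<Rightarrow> 'o"
  Id :: "'o \<Rightarrow> 'm"
  Comp :: "'m \<Rightarrow> 'm \<Rightarrow> 'm"  (infixl \<open>\<cdot>\<index>\<close> 75)
  Prd :: "'o \<Rightarrow> 'o \<Rightarrow> 'o"  (infixr \<open>\<boxtimes>\<index>\<close> 80)
  Pr0 :: "'o \<Rightarrow> 'o \<Rightarrow> 'm"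
  Pr1 :: "'o \<Rightarrow> 'o \<Rightarrow> 'm"
  Trm :: "'o"

definition Hom :: "('o, 'm) ccat \<Rightarrow> 'o \<Rightarrow> 'o \<Rightarrow> 'm set" where
  "Hom C X Y = {f \<in> Ar C. Dom C f = X \<and> Cod C f = Y}"

definition pairing :: "('o, 'm) ccat \<Rightarrow> 'm \<Rightarrow> 'm \<Rightarrow> 'm"  (\<open>\<langle>_,/ _\<rangle>\<index>\<close>) where
  "\<langle>f, g\<rangle>\<^bsub>C\<^esub> = (THE h. h \<in> Hom C (Dom C f) (Cod C f \<boxtimes>\<^bsub>C\<^esub> Cod C g)
      \<and> h \<cdot>\<^bsub>C\<^esub> Pr0 C (Cod C f) (Cod C g) = f \<and> h \<cdot>\<^bsub>C\<^esub> Pr1 C (Cod C f) (Cod C g) = g)"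

definition bang :: "('o, 'm) ccat \<Rightarrow> 'o \<Rightarrow> 'm" where
  "bang C X = (THE h. h \<in> Hom C X (Trm C))"

locale cartesian_category =
  fixes C :: "('o, 'm) ccat" (structure)
  assumes Dom_Ob: "f \<in> Ar C \<Longrightarrow> Dom C f \<in> Ob C"
    and Cod_Ob: "f \<in> Ar C \<Longrightarrow> Cod C f \<in> Ob C"
    and Id_Hom: "X \<in> Ob C \<Longrightarrow> Id C X \<in> Hom C X X"
    and Comp_Hom: "f \<in> Hom C X Y \<Longrightarrow> g \<in> Hom C Y Z \<Longrightarrow> f \<cdot> g \<in> Hom C X Z"
    and Id_left: "f \<in> Hom C X Y \<Longrightarrow> Id C X \<cdot> f = f"
    and Id_right: "f \<in> Hom C X Y \<Longrightarrow> f \<cdot> Id C Y = f"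
    and Comp_assoc: "f \<in> Hom C W X \<Longrightarrow> g \<in> Hom C X Y \<Longrightarrow> h \<in> Hom C Y Z
          \<Longrightarrow> (f \<cdot> g) \<cdot> h = f \<cdot> (g \<cdot> h)"
    and Trm_Ob: "Trm C \<in> Ob C"
    and Trm_universal: "X \<in> Ob C \<Longrightarrow> \<exists>!h. h \<in> Hom C X (Trm C)"
    and Prd_Ob: "X \<in> Ob C \<Longrightarrow> Y \<in> Ob C \<Longrightarrow> X \<boxtimes> Y \<in> Ob C"
    and Pr0_Hom: "X \<in> Ob C \<Longrightarrow> Y \<in> Ob C \<Longrightarrow> Pr0 C X Y \<in> Hom C (X \<boxtimes> Y) X"
    and Pr1_Hom: "X \<in> Ob C \<Longrightarrow> Y \<in> Ob C \<Longrightarrow> Pr1 C X Y \<in> Hom C (X \<boxtimes> Y) Y"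
    and Prd_universal: "f \<in> Hom C Z X \<Longrightarrow> g \<in> Hom C Z Y
          \<Longrightarrow> \<exists>!h. h \<in> Hom C Z (X \<boxtimes> Y) \<and> h \<cdot> Pr0 C X Y = f \<and> h \<cdot> Pr1 C X Y = g"

text \<open>
  The object \<open>A\<^sup>n \<times> X\<close> is bracketed to the right, \<open>A \<times> (A \<times> \<dots> (A \<times> X))\<close>, so that
  \<open>A\<^sup>0 \<times> X = X\<close> and \<open>A\<^sup>1 \<times> X = A \<times> X\<close>. \<open>vproj C A X n i\<close> is its projection \<open>\<pi>\<^sub>i\<close>, to the
  \<open>i\<close>-th copy of \<open>A\<close> if \<open>i < n\<close> and to \<open>X\<close> if \<open>i = n\<close>.
\<close>

fun npow :: "('o, 'm) ccat \<Rightarrow> 'o \<Rightarrow> nat \<Rightarrow> 'o \<Rightarrow> 'o" where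
  "npow C A 0 X = X"
| "npow C A (Suc n) X = A \<boxtimes>\<^bsub>C\<^esub> npow C A n X"

fun vproj :: "('o, 'm) ccat \<Rightarrow> 'o \<Rightarrow> 'o \<Rightarrow> nat \<Rightarrow> nat \<Rightarrow> 'm" where
  "vproj C A X 0 i = Id C X"
| "vproj C A X (Suc n) 0 = Pr0 C A (npow C A n X)"
| "vproj C A X (Suc n) (Suc i) = Pr1 C A (npow C A n X) \<cdot>\<^bsub>C\<^esub> vproj C A X n i"

definition appl :: "('o, 'm) ccat \<Rightarrow> 'm \<Rightarrow> 'm list \<Rightarrow> 'm \<Rightarrow> 'm" where
  \<comment> \<open>\<open>h(z\<^sub>1, \<dots>, z\<^sub>n, x)\<close> for \<open>h\<close> with domain \<open>A\<^sup>n \<times> X\<close>\<close>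
  "appl C h zs x = foldr (pairing C) zs x \<cdot>\<^bsub>C\<^esub> h"

section \<open>Functors preserving the chosen products exactly\<close>

datatype ('o, 'm, 'p, 'n) cfunctor = CFunctor (fob: "'o \<Rightarrow> 'p") (far: "'m \<Rightarrow> 'n")

text \<open>
  Functors are \<^const>\<open>undefined\<close> outside the objects and arrows of their domain, so that equality
  of functors is equality in HOL.
\<close>

definition id_functor :: "('o, 'm) ccat \<Rightarrow> ('o, 'm, 'o, 'm) cfunctor" where
  "id_functor C = CFunctor (\<lambda>X\<in>Ob C. X) (\<lambda>f\<in>Ar C. f)"

definition comp_functor ::
  "('o, 'm) ccat \<Rightarrow> ('o, 'm, 'p, 'n) cfunctor \<Rightarrow> ('p, 'n, 'q, 'k) cfunctor \<Rightarrow> ('o, 'm, 'q, 'k) cfunctor"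
  where \<comment> \<open>first \<open>F\<close>, then \<open>G\<close>; \<open>C\<close> is the domain of \<open>F\<close>\<close>
  "comp_functor C F G = CFunctor (\<lambda>X\<in>Ob C. fob G (fob F X)) (\<lambda>f\<in>Ar C. far G (far F f))"

definition cart_functor ::
  "('o, 'm) ccat \<Rightarrow> ('p, 'n) ccat \<Rightarrow> ('o, 'm, 'p, 'n) cfunctor \<Rightarrow> bool" where
  "cart_functor C E F \<longleftrightarrow>
     fob F \<in> extensional (Ob C) \<and> far F \<in> extensional (Ar C)
   \<and> (\<forall>X\<in>Ob C. fob F X \<in> Ob E)
   \<and> (\<forall>X Y. \<forall>f\<in>Hom C X Y. far F f \<in> Hom E (fob F X) (fob F Y))
   \<and> (\<forall>X\<in>Ob C. far F (Id C X) = Id E (fob F X))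
   \<and> (\<forall>X Y Z. \<forall>f\<in>Hom C X Y. \<forall>g\<in>Hom C Y Z. far F (f \<cdot>\<^bsub>C\<^esub> g) = far F f \<cdot>\<^bsub>E\<^esub> far F g)
   \<and> fob F (Trm C) = Trm E
   \<and> (\<forall>X\<in>Ob C. \<forall>Y\<in>Ob C.
         fob F (X \<boxtimes>\<^bsub>C\<^esub> Y) = fob F X \<boxtimes>\<^bsub>E\<^esub> fob F Y
       \<and> far F (Pr0 C X Y) = Pr0 E (fob F X) (fob F Y)
       \<and> far F (Pr1 C X Y) = Pr1 E (fob F X) (fob F Y))"

section \<open>Commutative monoids in a Cartesian category\<close>

datatype ('o, 'm) cmon = CMon (mcar: 'o) (mplus: 'm) (mzero: 'm)

definition madd :: "('o, 'm) ccat \<Rightarrow> ('o, 'm) cmon \<Rightarrow> 'm \<Rightarrow> 'm \<Rightarrow> 'm" where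
  "madd C M f g = \<langle>f, g\<rangle>\<^bsub>C\<^esub> \<cdot>\<^bsub>C\<^esub> mplus M"

definition mnull :: "('o, 'm) ccat \<Rightarrow> ('o, 'm) cmon \<Rightarrow> 'o \<Rightarrow> 'm" where
  "mnull C M X = bang C X \<cdot>\<^bsub>C\<^esub> mzero M"

definition commutative_monoid_in :: "('o, 'm) ccat \<Rightarrow> ('o, 'm) cmon \<Rightarrow> bool" where
  "commutative_monoid_in C M \<longleftrightarrow>
     mcar M \<in> Ob C
   \<and> mplus M \<in> Hom C (mcar M \<boxtimes>\<^bsub>C\<^esub> mcar M) (mcar M)
   \<and> mzero M \<in> Hom C (Trm C) (mcar M)
   \<and> (\<forall>Z\<in>Ob C. \<forall>a\<in>Hom C Z (mcar M). \<forall>b\<in>Hom C Z (mcar M). \<forall>c\<in>Hom C Z (mcar M).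
         madd C M (madd C M a b) c = madd C M a (madd C M b c))
   \<and> (\<forall>Z\<in>Ob C. \<forall>a\<in>Hom C Z (mcar M). madd C M a (mnull C M Z) = a)
   \<and> (\<forall>Z\<in>Ob C. \<forall>a\<in>Hom C Z (mcar M). \<forall>b\<in>Hom C Z (mcar M). madd C M a b = madd C M b a)"

definition prod_cmon :: "('o, 'm) ccat \<Rightarrow> ('o, 'm) cmon \<Rightarrow> ('o, 'm) cmon \<Rightarrow> ('o, 'm) cmon" where
  "prod_cmon C M N =
    (let P = mcar M \<boxtimes>\<^bsub>C\<^esub> mcar N; p0 = Pr0 C (mcar M) (mcar N); p1 = Pr1 C (mcar M) (mcar N) in
     CMon P
       \<langle>madd C M (Pr0 C P P \<cdot>\<^bsub>C\<^esub> p0) (Pr1 C P P \<cdot>\<^bsub>C\<^esub> p0),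
        madd C N (Pr0 C P P \<cdot>\<^bsub>C\<^esub> p1) (Pr1 C P P \<cdot>\<^bsub>C\<^esub> p1)\<rangle>\<^bsub>C\<^esub>
       \<langle>mzero M, mzero N\<rangle>\<^bsub>C\<^esub>)"

definition unit_cmon :: "('o, 'm) ccat \<Rightarrow> ('o, 'm) cmon" where
  "unit_cmon C = CMon (Trm C) (bang C (Trm C \<boxtimes>\<^bsub>C\<^esub> Trm C)) (Id C (Trm C))"

definition msum ::
  "('o, 'm) ccat \<Rightarrow> ('o, 'm) cmon \<Rightarrow> 'o \<Rightarrow> ('i \<Rightarrow> 'm) \<Rightarrow> 'i set \<Rightarrow> 'm" where
  \<comment> \<open>finite sums of maps from \<open>Z\<close> to the monoid \<open>M\<close>\<close>
  "msum C M Z = finprod \<lparr>carrier = Hom C Z (mcar M), monoid.mult = madd C M, one = mnull C M Z\<rparr>"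

section \<open>The Faa di Bruno construction\<close>

type_synonym ('o, 'm) fobj = "('o, 'm) cmon \<times> 'o"

text \<open>
  An arrow carries its domain and codomain. The sequence \<open>(f\<^sub>1, f\<^sub>2, \<dots>)\<close> is the function \<open>fseq f\<close>,
  which is \<^const>\<open>undefined\<close> at \<open>0\<close>.
\<close>

datatype ('o, 'm) farr =
  FArr (fdom: "('o, 'm) fobj") (fcod: "('o, 'm) fobj") (fstar: 'm) (fseq: "nat \<Rightarrow> 'm")

definition symmetric_map :: "('o, 'm) ccat \<Rightarrow> 'o \<Rightarrow> 'o \<Rightarrow> nat \<Rightarrow> 'm \<Rightarrow> bool" where
  "symmetric_map C A X n h \<longleftrightarrow>
     (\<forall>Z\<in>Ob C. \<forall>zs x \<sigma>. length zs = n \<longrightarrow> set zs \<subseteq> Hom C Z A \<longrightarrow> x \<in> Hom C Z X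
        \<longrightarrow> \<sigma> permutes {..<n} \<longrightarrow> appl C h (permute_list \<sigma> zs) x = appl C h zs x)"

definition multiadditive_map ::
  "('o, 'm) ccat \<Rightarrow> ('o, 'm) cmon \<Rightarrow> 'o \<Rightarrow> ('o, 'm) cmon \<Rightarrow> nat \<Rightarrow> 'm \<Rightarrow> bool" where
  "multiadditive_map C M X N n h \<longleftrightarrow>
     (\<forall>Z\<in>Ob C. \<forall>zs x. \<forall>i<n. length zs = n \<longrightarrow> set zs \<subseteq> Hom C Z (mcar M) \<longrightarrow> x \<in> Hom C Z X \<longrightarrow>
        (\<forall>a\<in>Hom C Z (mcar M). \<forall>b\<in>Hom C Z (mcar M).
           appl C h (zs[i := madd C M a b]) x
             = madd C N (appl C h (zs[i := a]) x) (appl C h (zs[i := b]) x))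
      \<and> appl C h (zs[i := mnull C M Z]) x = mnull C N Z)"

definition faa_obj :: "('o, 'm) ccat \<Rightarrow> ('o, 'm) fobj set" where
  "faa_obj C = {(M, X). commutative_monoid_in C M \<and> X \<in> Ob C}"

definition faa_arr :: "('o, 'm) ccat \<Rightarrow> ('o, 'm) farr set" where
  "faa_arr C = {FArr (M, X) (N, Y) fs fn | M X N Y fs fn.
      (M, X) \<in> faa_obj C \<and> (N, Y) \<in> faa_obj C \<and> fs \<in> Hom C X Y \<and> fn \<in> extensional {1..}
    \<and> (\<forall>n\<ge>1. fn n \<in> Hom C (npow C (mcar M) n X) (mcar N)
          \<and> symmetric_map C (mcar M) X n (fn n) \<and> multiadditive_map C M X N n (fn n))}"

definition faa_lin :: "('o, 'm) ccat \<Rightarrow> ('o, 'm) fobj \<Rightarrow> ('o, 'm) fobj \<Rightarrow> 'm \<Rightarrow> 'm \<Rightarrow> ('o, 'm) farr"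
  where \<comment> \<open>the sequence \<open>(h, h\<^sub>1, 0, 0, \<dots>)\<close>\<close>
  "faa_lin C P Q h h1 = FArr P Q h
     (\<lambda>n\<in>{1..}. if n = 1 then h1 else mnull C (fst Q) (npow C (mcar (fst P)) n (snd P)))"

definition faa_id :: "('o, 'm) ccat \<Rightarrow> ('o, 'm) fobj \<Rightarrow> ('o, 'm) farr" where
  "faa_id C P = faa_lin C P P (Id C (snd P)) (Pr0 C (mcar (fst P)) (snd P))"

text \<open>
  The \<open>n\<close> arguments are indexed by \<open>0, \<dots>, n - 1\<close>. The blocks of a partition are listed in the
  order of their least elements; as \<open>g\<^sub>k\<close> is symmetric, the order does not matter.
\<close>

definition blocks :: "nat set set \<Rightarrow> nat set list" where
  "blocks P = map (\<lambda>m. THE B. B \<in> P \<and> m \<in> B) (sorted_list_of_set (Min ` P))"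

definition faa_comp :: "('o, 'm) ccat \<Rightarrow> ('o, 'm) farr \<Rightarrow> ('o, 'm) farr \<Rightarrow> ('o, 'm) farr" where
  "faa_comp C f g =
    (let A = mcar (fst (fdom f)); X = snd (fdom f) in
     FArr (fdom f) (fcod g) (fstar f \<cdot>\<^bsub>C\<^esub> fstar g)
       (\<lambda>n\<in>{1..}. let a = vproj C A X n; x = vproj C A X n n in
          msum C (fst (fcod g)) (npow C A n X)
            (\<lambda>P. appl C (fseq g (card P))
                   (map (\<lambda>B. appl C (fseq f (card B)) (map a (sorted_list_of_set B)) x)
                        (blocks P))
                   (x \<cdot>\<^bsub>C\<^esub> fstar f))
            {P. partition_on {..<n} P}))"

definition faa_prod :: "('o, 'm) ccat \<Rightarrow> ('o, 'm) fobj \<Rightarrow> ('o, 'm) fobj \<Rightarrow> ('o, 'm) fobj" where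
  "faa_prod C P Q = (prod_cmon C (fst P) (fst Q), snd P \<boxtimes>\<^bsub>C\<^esub> snd Q)"

definition faa_pr0 :: "('o, 'm) ccat \<Rightarrow> ('o, 'm) fobj \<Rightarrow> ('o, 'm) fobj \<Rightarrow> ('o, 'm) farr" where
  "faa_pr0 C P Q =
    (let A = mcar (fst P); B = mcar (fst Q); X = snd P; Y = snd Q in
     faa_lin C (faa_prod C P Q) P (Pr0 C X Y) (Pr0 C (A \<boxtimes>\<^bsub>C\<^esub> B) (X \<boxtimes>\<^bsub>C\<^esub> Y) \<cdot>\<^bsub>C\<^esub> Pr0 C A B))"

definition faa_pr1 :: "('o, 'm) ccat \<Rightarrow> ('o, 'm) fobj \<Rightarrow> ('o, 'm) fobj \<Rightarrow> ('o, 'm) farr" where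
  "faa_pr1 C P Q =
    (let A = mcar (fst P); B = mcar (fst Q); X = snd P; Y = snd Q in
     faa_lin C (faa_prod C P Q) Q (Pr1 C X Y) (Pr0 C (A \<boxtimes>\<^bsub>C\<^esub> B) (X \<boxtimes>\<^bsub>C\<^esub> Y) \<cdot>\<^bsub>C\<^esub> Pr1 C A B))"

definition Faa :: "('o, 'm) ccat \<Rightarrow> (('o, 'm) fobj, ('o, 'm) farr) ccat" where
  "Faa C = \<lparr>Ob = faa_obj C, Ar = faa_arr C, Dom = fdom, Cod = fcod,
     Id = faa_id C, Comp = faa_comp C,
     Prd = faa_prod C, Pr0 = faa_pr0 C, Pr1 = faa_pr1 C, Trm = (unit_cmon C, Trm C)\<rparr>"

definition Faa_functor ::
  "('o, 'm) ccat \<Rightarrow> ('o, 'm, 'p, 'n) cfunctor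
    \<Rightarrow> (('o, 'm) fobj, ('o, 'm) farr, ('p, 'n) fobj, ('p, 'n) farr) cfunctor"
  where \<comment> \<open>\<open>C\<close> is the domain of \<open>F\<close>\<close>
  "Faa_functor C F =
    (let ob = (\<lambda>P. (CMon (fob F (mcar (fst P))) (far F (mplus (fst P))) (far F (mzero (fst P))),
                    fob F (snd P))) in
     CFunctor (\<lambda>P\<in>faa_obj C. ob P)
       (\<lambda>f\<in>faa_arr C. FArr (ob (fdom f)) (ob (fcod f)) (far F (fstar f))
                            (\<lambda>n\<in>{1..}. far F (fseq f n))))"

section \<open>The comonad structure and its coalgebras\<close>

definition Faa_counit :: "('o, 'm) ccat \<Rightarrow> (('o, 'm) fobj, ('o, 'm) farr, 'o, 'm) cfunctor" where
  "Faa_counit C = CFunctor (\<lambda>P\<in>faa_obj C. snd P) (\<lambda>f\<in>faa_arr C. fstar f)"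

definition delta_obj ::
  "('o, 'm) ccat \<Rightarrow> ('o, 'm) fobj \<Rightarrow> (('o, 'm) fobj, ('o, 'm) farr) fobj" where
  "delta_obj C P =
    (let M = fst P; A = mcar M; AA = (M, A) in
     (CMon AA
        (faa_lin C (faa_prod C AA AA) AA (mplus M) (Pr0 C (A \<boxtimes>\<^bsub>C\<^esub> A) (A \<boxtimes>\<^bsub>C\<^esub> A) \<cdot>\<^bsub>C\<^esub> mplus M))
        (faa_lin C (unit_cmon C, Trm C) AA (mzero M) (Pr0 C (Trm C) (Trm C) \<cdot>\<^bsub>C\<^esub> mzero M)),
      P))"

text \<open>
  \<open>delta_comp C f n r\<close> is the map \<open>(\<delta>(f)\<^sub>n)\<^sub>r\<close>, with domain \<open>(A\<^sup>n \<times> A)\<^sup>r \<times> (A\<^sup>n \<times> X)\<close>; both kinds of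
  indices start at \<open>0\<close>. A pair \<open>(S, \<phi>)\<close> has \<open>\<phi>\<close> undefined outside \<open>S\<close>, so that it is counted once.
\<close>

definition delta_comp :: "('o, 'm) ccat \<Rightarrow> ('o, 'm) farr \<Rightarrow> nat \<Rightarrow> nat \<Rightarrow> 'm" where
  "delta_comp C f n r =
    (let A = mcar (fst (fdom f)); X = snd (fdom f);
         V = npow C A n A; W = npow C A n X;
         v = (\<lambda>j i. vproj C V W r j \<cdot>\<^bsub>C\<^esub> vproj C A A n i);
         w = (\<lambda>j. vproj C V W r j \<cdot>\<^bsub>C\<^esub> vproj C A A n n);
         a = (\<lambda>i. vproj C V W r r \<cdot>\<^bsub>C\<^esub> vproj C A X n i);
         x = vproj C V W r r \<cdot>\<^bsub>C\<^esub> vproj C A X n n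
     in msum C (fst (fcod f)) (npow C V r W)
          (\<lambda>(S, \<phi>). appl C (fseq f (n + r - card S))
             (map (\<lambda>i. if i \<in> \<phi> ` S then v (the_inv_into S \<phi> i) i else a i) [0..<n]
                @ map w (sorted_list_of_set ({..<r} - S)))
             x)
          {(S, \<phi>). S \<subseteq> {..<r} \<and> \<phi> \<in> S \<rightarrow>\<^sub>E {..<n} \<and> inj_on \<phi> S})"

definition delta_arr ::
  "('o, 'm) ccat \<Rightarrow> ('o, 'm) farr \<Rightarrow> (('o, 'm) fobj, ('o, 'm) farr) farr" where
  "delta_arr C f =
    (let M = fst (fdom f); N = fst (fcod f) in
     FArr (delta_obj C (fdom f)) (delta_obj C (fcod f)) f
       (\<lambda>n\<in>{1..}. FArr (npow (Faa C) (M, mcar M) n (fdom f)) (N, mcar N) (fseq f n)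
                        (\<lambda>r\<in>{1..}. delta_comp C f n r)))"

definition Faa_comult ::
  "('o, 'm) ccat \<Rightarrow> (('o, 'm) fobj, ('o, 'm) farr,
                     (('o, 'm) fobj, ('o, 'm) farr) fobj, (('o, 'm) fobj, ('o, 'm) farr) farr) cfunctor"
  where
  "Faa_comult C = CFunctor (\<lambda>P\<in>faa_obj C. delta_obj C P) (\<lambda>f\<in>faa_arr C. delta_arr C f)"

definition Faa_coalgebra ::
  "('o, 'm) ccat \<Rightarrow> ('o, 'm, ('o, 'm) fobj, ('o, 'm) farr) cfunctor \<Rightarrow> bool" where
  "Faa_coalgebra C \<D> \<longleftrightarrow>
     cart_functor C (Faa C) \<D>
   \<and> comp_functor C \<D> (Faa_counit C) = id_functor C
   \<and> comp_functor C \<D> (Faa_comult C) = comp_functor C \<D> (Faa_functor C \<D>)"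

section \<open>Generalized Cartesian differential structures\<close>

text \<open>
  As for functors, \<open>L\<close> and \<open>D\<close> are \<^const>\<open>undefined\<close> outside the objects and arrows of the category.
\<close>

locale generalized_cartesian_differential_structure = cartesian_category C
  for C :: "('o, 'm) ccat" (structure) +
  fixes L :: "'o \<Rightarrow> ('o, 'm) cmon"
    and D :: "'m \<Rightarrow> 'm"
  fixes L0 :: "'o \<Rightarrow> 'o"
  defines "L0 X \<equiv> mcar (L X)"
  assumes L_extensional: "L \<in> extensional (Ob C)"
    and D_extensional: "D \<in> extensional (Ar C)"
    and L_cmon: "X \<in> Ob C \<Longrightarrow> commutative_monoid_in C (L X)"
    and L_L0: "X \<in> Ob C \<Longrightarrow> L (L0 X) = L X"
    and L_Prd: "X \<in> Ob C \<Longrightarrow> Y \<in> Ob C \<Longrightarrow> L (X \<boxtimes> Y) = prod_cmon C (L X) (L Y)"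
    and L_Trm: "L (Trm C) = unit_cmon C"
    and D_Hom: "f \<in> Hom C X Y \<Longrightarrow> D f \<in> Hom C (L0 X \<boxtimes> X) (L0 Y)"
    and CD1_plus: "X \<in> Ob C \<Longrightarrow>
          D (mplus (L X)) = Pr0 C (L0 X \<boxtimes> L0 X) (L0 X \<boxtimes> L0 X) \<cdot> mplus (L X)"
    and CD1_zero: "X \<in> Ob C \<Longrightarrow> D (mzero (L X)) = Pr0 C (Trm C) (Trm C) \<cdot> mzero (L X)"
    and CD2_plus: "f \<in> Hom C X Y \<Longrightarrow> a \<in> Hom C Z (L0 X) \<Longrightarrow> b \<in> Hom C Z (L0 X) \<Longrightarrow> c \<in> Hom C Z X \<Longrightarrow>
          \<langle>madd C (L X) a b, c\<rangle> \<cdot> D f = madd C (L Y) (\<langle>a, c\<rangle> \<cdot> D f) (\<langle>b, c\<rangle> \<cdot> D f)"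
    and CD2_zero: "f \<in> Hom C X Y \<Longrightarrow> a \<in> Hom C Z X \<Longrightarrow>
          \<langle>mnull C (L X) Z, a\<rangle> \<cdot> D f = mnull C (L Y) Z"
    and CD3_0: "X \<in> Ob C \<Longrightarrow> Y \<in> Ob C \<Longrightarrow>
          D (Pr0 C X Y) = Pr0 C (L0 X \<boxtimes> L0 Y) (X \<boxtimes> Y) \<cdot> Pr0 C (L0 X) (L0 Y)"
    and CD3_1: "X \<in> Ob C \<Longrightarrow> Y \<in> Ob C \<Longrightarrow>
          D (Pr1 C X Y) = Pr0 C (L0 X \<boxtimes> L0 Y) (X \<boxtimes> Y) \<cdot> Pr1 C (L0 X) (L0 Y)"
    and CD4: "f \<in> Hom C X Y \<Longrightarrow> g \<in> Hom C X Z \<Longrightarrow> D \<langle>f, g\<rangle> = \<langle>D f, D g\<rangle>"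
    and CD5: "f \<in> Hom C X Y \<Longrightarrow> g \<in> Hom C Y Z \<Longrightarrow>
          D (f \<cdot> g) = \<langle>D f, Pr1 C (L0 X) X \<cdot> f\<rangle> \<cdot> D g"
    and CD6: "f \<in> Hom C X Y \<Longrightarrow> a \<in> Hom C Z (L0 X) \<Longrightarrow> c \<in> Hom C Z (L0 X) \<Longrightarrow> d \<in> Hom C Z X \<Longrightarrow>
          \<langle>\<langle>a, mnull C (L X) Z\<rangle>, \<langle>c, d\<rangle>\<rangle> \<cdot> D (D f) = \<langle>a, d\<rangle> \<cdot> D f"
    and CD7: "f \<in> Hom C X Y \<Longrightarrow> b \<in> Hom C Z (L0 X) \<Longrightarrow> c \<in> Hom C Z (L0 X) \<Longrightarrow> d \<in> Hom C Z X \<Longrightarrow>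
          \<langle>\<langle>mnull C (L X) Z, b\<rangle>, \<langle>c, d\<rangle>\<rangle> \<cdot> D (D f)
            = \<langle>\<langle>mnull C (L X) Z, c\<rangle>, \<langle>b, d\<rangle>\<rangle> \<cdot> D (D f)"

definition differential_structure_of ::
  "('o, 'm) ccat \<Rightarrow> ('o, 'm, ('o, 'm) fobj, ('o, 'm) farr) cfunctor
    \<Rightarrow> ('o \<Rightarrow> ('o, 'm) cmon) \<times> ('m \<Rightarrow> 'm)" where
  "differential_structure_of C \<D> = (\<lambda>X\<in>Ob C. fst (fob \<D> X), \<lambda>f\<in>Ar C. fseq (far \<D> f) 1)"

end

(*
  Write D(f) = (f, f_1, f_2, ...). Evaluated at r = 1, the comultiplication law for a coalgebra says
    D[f_n]((v, w), (a, x)) = f_{n+1}(a, w, x) + sum_i f_n(a_1, ..., v_i, ..., a_n, x).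
  For n = 1 this is [CD.6] and [CD.7]; with v = 0 it shows that f_1 determines all the f_n.
  Conversely, given a differential structure, one defines f_{n+1} by the case v = 0. By [CD.7] the
  f_n are symmetric, hence additive in every argument, and together with [CD.6] the displayed
  formula holds: it is the chain rule for f_n. Differentiating once more then gives, by induction,
  both the Faa di Bruno formula for (fg)_n, where a new argument either joins a block of the
  partition or forms a block of its own, and the formula for (f_n)_r, where the new index either
  stays outside the domain of the partial injection or is sent to a value missed so far.
*)
theory Submission
  imports Defs
begin

text \<open>[CD.7] exchanges only the last two arguments of \<open>higher f n\<close>; permutations
  of the earlier ones are inherited from the previous derivative, because differentiation respects a
  simultaneous relabelling of base point and direction. These two kinds of permutation generate all
  others. Likewise [CD.2] gives additivity only in the last argument, and [CD.6] the derivative only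
  along the last argument; symmetry carries both to an arbitrary position. The derivative in a
  general direction is then obtained by splitting the direction into its n + 1 coordinates. Both
  inductions add a largest new index. Such an index is never the least element of an old block, so
  the order of blocks by least elements persists: joining a block is a list update, and opening one
  appends to the list. For partial injections, a new argument in the same way either replaces a
  missed entry or is appended. Hence the sums can be matched term by term, with no arguments left to
  permute.\<close>

section \<open>Cartesian categories and tuples of maps\<close>

context cartesian_category
begin

text \<open>Typing as equations for \<open>Dom\<close> and \<open>Cod\<close> lets the simplifier
  discharge the side conditions of the rules below. Proofs that pass membership in a hom-set along
  unchanged switch this off.\<close>

lemma Hom_iff [simp]: "f \<in> Hom C X Y \<longleftrightarrow> f \<in> Ar C \<and> Dom C f = X \<and> Cod C f = Y"
  by (simp add: Hom_def)

lemmas [simp] = Dom_Ob Cod_Ob Trm_Ob Prd_Ob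

lemma Hom_simps:
  assumes "f \<in> Hom C X Y"
  shows "X \<in> Ob C" "Y \<in> Ob C" "Dom C f = X" "Cod C f = Y" "f \<in> Ar C"
  using assms by auto

lemma Id_typ [simp]:
  assumes "X \<in> Ob C"
  shows "Id C X \<in> Ar C" "Dom C (Id C X) = X" "Cod C (Id C X) = X"
  using Id_Hom[OF assms] by simp_all

lemma Comp_typ [simp]:
  assumes "f \<in> Ar C" "g \<in> Ar C" "Cod C f = Dom C g"
  shows "f \<cdot> g \<in> Ar C" "Dom C (f \<cdot> g) = Dom C f" "Cod C (f \<cdot> g) = Cod C g"
  using Comp_Hom[of f "Dom C f" "Cod C f" g "Cod C g"] assms by simp_all

lemma Pr_typ [simp]:
  assumes "X \<in> Ob C" "Y \<in> Ob C"
  shows "Pr0 C X Y \<in> Ar C" "Dom C (Pr0 C X Y) = X \<boxtimes> Y" "Cod C (Pr0 C X Y) = X"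
    "Pr1 C X Y \<in> Ar C" "Dom C (Pr1 C X Y) = X \<boxtimes> Y" "Cod C (Pr1 C X Y) = Y"
  using Pr0_Hom[OF assms] Pr1_Hom[OF assms] by simp_all

lemma Id_comp [simp]:
  "f \<in> Ar C \<Longrightarrow> Dom C f = X \<Longrightarrow> Id C X \<cdot> f = f"
  "f \<in> Ar C \<Longrightarrow> Cod C f = X \<Longrightarrow> f \<cdot> Id C X = f"
  using Id_left[of f X "Cod C f"] Id_right[of f "Dom C f" X] by simp_all

lemma comp_assoc [simp]:
  "f \<in> Ar C \<Longrightarrow> g \<in> Ar C \<Longrightarrow> h \<in> Ar C \<Longrightarrow> Cod C f = Dom C g \<Longrightarrow> Cod C g = Dom C h
    \<Longrightarrow> (f \<cdot> g) \<cdot> h = f \<cdot> (g \<cdot> h)"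
  using Comp_assoc[of f "Dom C f" "Cod C f" g "Cod C g" h "Cod C h"] by simp

lemma pairing_props:
  assumes "f \<in> Ar C" "g \<in> Ar C" "Dom C f = Dom C g"
  shows "\<langle>f, g\<rangle> \<in> Hom C (Dom C f) (Cod C f \<boxtimes> Cod C g)
      \<and> \<langle>f, g\<rangle> \<cdot> Pr0 C (Cod C f) (Cod C g) = f \<and> \<langle>f, g\<rangle> \<cdot> Pr1 C (Cod C f) (Cod C g) = g"
  unfolding pairing_def
  by (rule theI', rule Prd_universal) (use assms in auto)

lemma pairing_typ [simp]:
  assumes "f \<in> Ar C" "g \<in> Ar C" "Dom C f = Dom C g"
  shows "\<langle>f, g\<rangle> \<in> Ar C" "Dom C \<langle>f, g\<rangle> = Dom C g" "Cod C \<langle>f, g\<rangle> = Cod C f \<boxtimes> Cod C g"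
  using pairing_props[OF assms] assms(3) by simp_all

lemma pairing_Hom: "f \<in> Hom C Z X \<Longrightarrow> g \<in> Hom C Z Y \<Longrightarrow> \<langle>f, g\<rangle> \<in> Hom C Z (X \<boxtimes> Y)"
  by auto

lemma pairing_Pr [simp]:
  assumes "f \<in> Ar C" "g \<in> Ar C" "Dom C f = Dom C g" "Cod C f = X" "Cod C g = Y"
  shows "\<langle>f, g\<rangle> \<cdot> Pr0 C X Y = f" "\<langle>f, g\<rangle> \<cdot> Pr1 C X Y = g"
  using pairing_props[OF assms(1-3)] assms(4,5) by simp_all

text \<open>Composites are kept bracketed to the right, where \<open>pairing_Pr\<close> no longer
  matches a pairing followed by a projection; these versions carry the remaining factor
  \<open>h\<close>.\<close>

lemma pairing_Pr_comp [simp]: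
  assumes "f \<in> Ar C" "g \<in> Ar C" "Dom C f = Dom C g" "Cod C f = X" "Cod C g = Y" "h \<in> Ar C"
  shows "Dom C h = X \<Longrightarrow> \<langle>f, g\<rangle> \<cdot> (Pr0 C X Y \<cdot> h) = f \<cdot> h"
    "Dom C h = Y \<Longrightarrow> \<langle>f, g\<rangle> \<cdot> (Pr1 C X Y \<cdot> h) = g \<cdot> h"
  using assms comp_assoc[of "\<langle>f, g\<rangle>" "Pr0 C X Y" h] comp_assoc[of "\<langle>f, g\<rangle>" "Pr1 C X Y" h]
  by (auto simp del: comp_assoc)

lemma prd_eqI:
  assumes "f \<in> Ar C" "g \<in> Ar C" "Dom C f = Dom C g" "Cod C f = X \<boxtimes> Y" "Cod C g = X \<boxtimes> Y"
    "X \<in> Ob C" "Y \<in> Ob C"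
    "f \<cdot> Pr0 C X Y = g \<cdot> Pr0 C X Y" "f \<cdot> Pr1 C X Y = g \<cdot> Pr1 C X Y"
  shows "f = g"
  using Prd_universal[of "g \<cdot> Pr0 C X Y" "Dom C g" X "g \<cdot> Pr1 C X Y" Y] assms by auto

lemma comp_pairing [simp]:
  assumes "h \<in> Ar C" "f \<in> Ar C" "g \<in> Ar C" "Dom C f = Dom C g" "Cod C h = Dom C g"
  shows "h \<cdot> \<langle>f, g\<rangle> = \<langle>h \<cdot> f, h \<cdot> g\<rangle>"
  by (rule prd_eqI[of _ _ "Cod C f" "Cod C g"]) (use assms in auto)

lemma comp_pairing_comp [simp]:
  assumes "h \<in> Ar C" "f \<in> Ar C" "g \<in> Ar C" "k \<in> Ar C" "Dom C f = Dom C g" "Cod C h = Dom C g"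
    "Dom C k = Cod C f \<boxtimes> Cod C g"
  shows "h \<cdot> (\<langle>f, g\<rangle> \<cdot> k) = \<langle>h \<cdot> f, h \<cdot> g\<rangle> \<cdot> k"
  using assms comp_assoc[of h "\<langle>f, g\<rangle>" k] by (simp del: comp_assoc)

lemma pairing_eta:
  assumes "h \<in> Ar C" "Cod C h = X \<boxtimes> Y" "X \<in> Ob C" "Y \<in> Ob C"
  shows "\<langle>h \<cdot> Pr0 C X Y, h \<cdot> Pr1 C X Y\<rangle> = h"
  by (rule prd_eqI[of _ _ X Y]) (use assms in auto)

lemma pairing_Pr_Id [simp]:
  "X \<in> Ob C \<Longrightarrow> Y \<in> Ob C \<Longrightarrow> \<langle>Pr0 C X Y, Pr1 C X Y\<rangle> = Id C (X \<boxtimes> Y)"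
  using pairing_eta[of "Id C (X \<boxtimes> Y)" X Y] by simp

lemma bang_typ [simp]:
  assumes "X \<in> Ob C"
  shows "bang C X \<in> Ar C" "Dom C (bang C X) = X" "Cod C (bang C X) = Trm C"
  using theI'[OF Trm_universal[OF assms]] by (simp_all add: bang_def)

lemma Trm_eqI: "f \<in> Ar C \<Longrightarrow> g \<in> Ar C \<Longrightarrow> Dom C f = Dom C g \<Longrightarrow> Cod C f = Trm C \<Longrightarrow> Cod C g = Trm C
    \<Longrightarrow> f = g"
  using Trm_universal[of "Dom C g"] by auto

lemma comp_bang [simp]: "h \<in> Ar C \<Longrightarrow> Cod C h = X \<Longrightarrow> h \<cdot> bang C X = bang C (Dom C h)"
  by (rule Trm_eqI) auto

lemma comp_bang_comp [simp]:
  "h \<in> Ar C \<Longrightarrow> Cod C h = X \<Longrightarrow> k \<in> Ar C \<Longrightarrow> Dom C k = Trm C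
    \<Longrightarrow> h \<cdot> (bang C X \<cdot> k) = bang C (Dom C h) \<cdot> k"
  using comp_assoc[of h "bang C X" k] by (auto simp del: comp_assoc)

section \<open>Tuples of maps into \<open>npow\<close> and the generic point\<close>

definition tuple :: "'m list \<Rightarrow> 'm \<Rightarrow> 'm" where
  "tuple zs x = foldr (pairing C) zs x"

lemma tuple_simps [simp]:
  "tuple [] x = x" "tuple (z # zs) x = \<langle>z, tuple zs x\<rangle>"
  by (simp_all add: tuple_def)

lemma appl_tuple: "appl C h zs x = tuple zs x \<cdot> h"
  by (simp add: appl_def tuple_def)

lemma npow_Ob [simp]: "A \<in> Ob C \<Longrightarrow> X \<in> Ob C \<Longrightarrow> npow C A n X \<in> Ob C"
  by (induction n) auto

lemma tuple_typ [simp]: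
  assumes "\<forall>z\<in>set zs. z \<in> Ar C \<and> Dom C z = Dom C x" "x \<in> Ar C"
  shows "tuple zs x \<in> Ar C" "Dom C (tuple zs x) = Dom C x"
  using assms by (induction zs) auto

lemma Cod_tuple [simp]:
  assumes "\<forall>z\<in>set zs. z \<in> Ar C \<and> Dom C z = Dom C x \<and> Cod C z = A" "x \<in> Ar C" "length zs = n"
    "Cod C x = X"
  shows "Cod C (tuple zs x) = npow C A n X"
  using assms by (induction zs arbitrary: n) auto

lemma replicate_Hom: "z \<in> Hom C Z A \<Longrightarrow> set (replicate n z) \<subseteq> Hom C Z A"
  by (auto simp: set_replicate_conv_if)

lemma nth_Hom: "set zs \<subseteq> Hom C Z A \<Longrightarrow> i < length zs \<Longrightarrow> zs ! i \<in> Hom C Z A"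
  using nth_mem[of i zs] by blast

lemma tuple_Hom:
  assumes "set zs \<subseteq> Hom C Z A" "x \<in> Hom C Z X" "length zs = n"
  shows "tuple zs x \<in> Hom C Z (npow C A n X)"
  using assms Cod_tuple[of zs x A n X] by (auto simp: subset_iff)

lemma comp_tuple:
  assumes "\<forall>z\<in>set zs. z \<in> Ar C \<and> Dom C z = Dom C x" "x \<in> Ar C" "h \<in> Ar C" "Cod C h = Dom C x"
  shows "h \<cdot> tuple zs x = tuple (map (\<lambda>z. h \<cdot> z) zs) (h \<cdot> x)"
  using assms by (induction zs) auto

lemma vproj_typ [simp]:
  assumes "A \<in> Ob C" "X \<in> Ob C" "i \<le> n"
  shows "vproj C A X n i \<in> Ar C" "Dom C (vproj C A X n i) = npow C A n X"
    "Cod C (vproj C A X n i) = (if i < n then A else X)"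
proof -
  have "vproj C A X n i \<in> Hom C (npow C A n X) (if i < n then A else X)"
    using assms(3)
  proof (induction n arbitrary: i)
    case (Suc n)
    then show ?case using assms(1,2) by (cases i) auto
  qed (use assms in simp)
  then show "vproj C A X n i \<in> Ar C" "Dom C (vproj C A X n i) = npow C A n X"
    "Cod C (vproj C A X n i) = (if i < n then A else X)" by simp_all
qed

lemma tuple_vproj:
  assumes "set zs \<subseteq> Hom C Z A" "x \<in> Hom C Z X" "A \<in> Ob C" "length zs = n"
  shows "i < n \<Longrightarrow> tuple zs x \<cdot> vproj C A X n i = zs ! i"
    "tuple zs x \<cdot> vproj C A X n n = x"
proof -
  \<comment> \<open>Appending \<open>x\<close> turns the last projection into an ordinary index, so
    that one induction covers both claims.\<close>
  have "i \<le> n \<Longrightarrow> tuple zs x \<cdot> vproj C A X n i = (zs @ [x]) ! i" for i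
    using assms
  proof (induction zs arbitrary: n i)
    case (Cons z zs)
    show ?case
    proof (cases i)
      case 0
      then show ?thesis using Cons.prems tuple_Hom[of zs Z A x X "length zs"] by auto
    next
      case (Suc j)
      then show ?thesis using Cons tuple_Hom[of zs Z A x X "length zs"] by auto
    qed
  qed auto
  from this[of i] this[of n] assms show "i < n \<Longrightarrow> tuple zs x \<cdot> vproj C A X n i = zs ! i"
    "tuple zs x \<cdot> vproj C A X n n = x" by (simp_all add: nth_append)
qed

abbreviation vprojs :: "'o \<Rightarrow> 'o \<Rightarrow> nat \<Rightarrow> 'm list" where
  "vprojs A X n \<equiv> map (vproj C A X n) [0..<n]"

lemma tuple_vprojs:
  assumes "A \<in> Ob C" "X \<in> Ob C"
  shows "tuple (vprojs A X n) (vproj C A X n n) = Id C (npow C A n X)"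
proof (induction n)
  case (Suc n)
  let ?p = "Pr1 C A (npow C A n X)"
  have "vprojs A X (Suc n) = Pr0 C A (npow C A n X) # map (\<lambda>z. ?p \<cdot> z) (vprojs A X n)"
    by (simp add: map_upt_Suc o_def del: upt_Suc)
  then have "tuple (vprojs A X (Suc n)) (vproj C A X (Suc n) (Suc n))
     = \<langle>Pr0 C A (npow C A n X), ?p \<cdot> tuple (vprojs A X n) (vproj C A X n n)\<rangle>"
    using assms by (subst comp_tuple) (auto simp del: upt_Suc)
  then show ?case using Suc assms by simp
qed (use assms in simp)

text \<open>The projections are the generic point of \<open>npow C A n X\<close>: a statement about
  \<open>appl C h zs x\<close> at all generalized elements specializes here to one about
  \<open>h\<close> itself.\<close>

lemma appl_vprojs:
  assumes "h \<in> Ar C" "Dom C h = npow C A n X" "A \<in> Ob C" "X \<in> Ob C"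
  shows "appl C h (vprojs A X n) (vproj C A X n n) = h"
  using assms by (simp add: appl_tuple tuple_vprojs)

lemma appl_Hom:
  assumes "h \<in> Hom C (npow C A n X) Y" "set zs \<subseteq> Hom C Z A" "x \<in> Hom C Z X" "length zs = n"
  shows "appl C h zs x \<in> Hom C Z Y"
  using tuple_Hom[OF assms(2-4)] assms(1) by (simp add: appl_tuple)

lemma comp_appl:
  assumes "h \<in> Hom C (npow C A n X) Y" "set zs \<subseteq> Hom C Z A" "x \<in> Hom C Z X" "length zs = n"
    "k \<in> Hom C W Z"
  shows "k \<cdot> appl C h zs x = appl C h (map (\<lambda>z. k \<cdot> z) zs) (k \<cdot> x)"
proof -
  have "k \<cdot> tuple zs x = tuple (map (\<lambda>z. k \<cdot> z) zs) (k \<cdot> x)"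
    using assms by (subst comp_tuple) auto
  then show ?thesis
    using assms(1,5) tuple_Hom[OF assms(2-4)] comp_assoc[of k "tuple zs x" h]
    by (simp add: appl_tuple del: comp_assoc)
qed

lemma map_comp_Hom: "set zs \<subseteq> Hom C Z A \<Longrightarrow> k \<in> Hom C W Z \<Longrightarrow> set (map (\<lambda>z. k \<cdot> z) zs) \<subseteq> Hom C W A"
  by auto

end

section \<open>Pointwise sums of maps into a commutative monoid\<close>

section \<open>Commutative monoids and finite sums of maps\<close>

context cartesian_category
begin

lemma cmon_typ [simp]:
  assumes "commutative_monoid_in C M"
  shows "mcar M \<in> Ob C" "mplus M \<in> Ar C" "Dom C (mplus M) = mcar M \<boxtimes> mcar M"
    "Cod C (mplus M) = mcar M" "mzero M \<in> Ar C" "Dom C (mzero M) = Trm C" "Cod C (mzero M) = mcar M"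
  using assms by (auto simp: commutative_monoid_in_def)

lemma madd_typ [simp]:
  assumes "commutative_monoid_in C M" "f \<in> Ar C" "g \<in> Ar C" "Dom C f = Dom C g"
    "Cod C f = mcar M" "Cod C g = mcar M"
  shows "madd C M f g \<in> Ar C" "Dom C (madd C M f g) = Dom C g" "Cod C (madd C M f g) = mcar M"
  using assms by (simp_all add: madd_def)

lemma mnull_typ [simp]:
  assumes "commutative_monoid_in C M" "Z \<in> Ob C"
  shows "mnull C M Z \<in> Ar C" "Dom C (mnull C M Z) = Z" "Cod C (mnull C M Z) = mcar M"
  using assms by (simp_all add: mnull_def)

lemma comp_madd [simp]:
  assumes "commutative_monoid_in C M" "f \<in> Ar C" "g \<in> Ar C" "Dom C f = Dom C g"
    "Cod C f = mcar M" "Cod C g = mcar M" "h \<in> Ar C" "Cod C h = Dom C g"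
  shows "h \<cdot> madd C M f g = madd C M (h \<cdot> f) (h \<cdot> g)"
  using assms by (simp add: madd_def)

lemma comp_mnull [simp]:
  "commutative_monoid_in C M \<Longrightarrow> h \<in> Ar C \<Longrightarrow> Cod C h = Z \<Longrightarrow> h \<cdot> mnull C M Z = mnull C M (Dom C h)"
  by (auto simp add: mnull_def)

lemma madd_laws:
  assumes "commutative_monoid_in C M" "a \<in> Hom C Z (mcar M)"
  shows "b \<in> Hom C Z (mcar M) \<Longrightarrow> c \<in> Hom C Z (mcar M) \<Longrightarrow> madd C M (madd C M a b) c = madd C M a (madd C M b c)"
    "madd C M a (mnull C M Z) = a" "madd C M (mnull C M Z) a = a"
    "b \<in> Hom C Z (mcar M) \<Longrightarrow> madd C M a b = madd C M b a"
proof -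
  have "Z \<in> Ob C" using assms(2) by auto
  moreover from this have "mnull C M Z \<in> Hom C Z (mcar M)" using assms(1) by simp
  ultimately show "b \<in> Hom C Z (mcar M) \<Longrightarrow> c \<in> Hom C Z (mcar M) \<Longrightarrow> madd C M (madd C M a b) c = madd C M a (madd C M b c)"
    "madd C M a (mnull C M Z) = a" "madd C M (mnull C M Z) a = a"
    "b \<in> Hom C Z (mcar M) \<Longrightarrow> madd C M a b = madd C M b a"
    using assms unfolding commutative_monoid_in_def by metis+
qed

lemma madd_null [simp]:
  assumes "commutative_monoid_in C M" "a \<in> Ar C" "Dom C a = Z" "Cod C a = mcar M"
  shows "madd C M a (mnull C M Z) = a" "madd C M (mnull C M Z) a = a"
  using madd_laws(2,3)[of M a Z] assms by simp_all

abbreviation hom_monoid :: "('o, 'm) cmon \<Rightarrow> 'o \<Rightarrow> 'm monoid" where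
  "hom_monoid M Z \<equiv> \<lparr>carrier = Hom C Z (mcar M), monoid.mult = madd C M, one = mnull C M Z\<rparr>"

lemma comm_monoid_hom_monoid:
  assumes "commutative_monoid_in C M" "Z \<in> Ob C"
  shows "comm_monoid (hom_monoid M Z)"
proof (rule comm_monoidI, goal_cases)
  case (3 x y z)
  then show ?case using madd_laws(1)[OF assms(1), of x Z y z] by simp
next
  case (5 x y)
  then show ?case using madd_laws(4)[OF assms(1), of x Z y] by simp
qed (use assms in auto)

context
  fixes M :: "('o, 'm) cmon" and Z :: 'o
  assumes M: "commutative_monoid_in C M" and Z: "Z \<in> Ob C"
begin

interpretation H: comm_monoid "hom_monoid M Z"
  by (rule comm_monoid_hom_monoid[OF M Z])

lemma msum_Hom:
  assumes "\<And>i. i \<in> I \<Longrightarrow> f i \<in> Hom C Z (mcar M)"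
  shows "msum C M Z f I \<in> Hom C Z (mcar M)"
  using H.finprod_closed[of f I] assms by (auto simp: msum_def Pi_def)

lemma msum_empty [simp]: "msum C M Z f {} = mnull C M Z"
  by (simp add: msum_def)

lemma msum_insert:
  assumes "finite I" "i \<notin> I" "\<And>j. j \<in> insert i I \<Longrightarrow> f j \<in> Hom C Z (mcar M)"
  shows "msum C M Z f (insert i I) = madd C M (f i) (msum C M Z f I)"
  using H.finprod_insert[of I i f] assms by (auto simp: msum_def Pi_def)

lemma msum_singleton:
  assumes "f i \<in> Hom C Z (mcar M)"
  shows "msum C M Z f {i} = f i"
  using msum_insert[of "{}" i f] assms M by simp

lemma msum_cong:
  assumes "I = J" "\<And>i. i \<in> J \<Longrightarrow> f i = g i" "\<And>i. i \<in> J \<Longrightarrow> g i \<in> Hom C Z (mcar M)"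
  shows "msum C M Z f I = msum C M Z g J"
  using H.finprod_cong'[of I J g f] assms by (auto simp: msum_def Pi_def)

lemma msum_Un_disjoint:
  assumes "finite I" "finite J" "I \<inter> J = {}" "\<And>i. i \<in> I \<union> J \<Longrightarrow> f i \<in> Hom C Z (mcar M)"
  shows "msum C M Z f (I \<union> J) = madd C M (msum C M Z f I) (msum C M Z f J)"
  using H.finprod_Un_disjoint[of I J f] assms by (auto simp: msum_def Pi_def)

lemma msum_madd:
  assumes "\<And>i. i \<in> I \<Longrightarrow> f i \<in> Hom C Z (mcar M)" "\<And>i. i \<in> I \<Longrightarrow> g i \<in> Hom C Z (mcar M)"
  shows "msum C M Z (\<lambda>i. madd C M (f i) (g i)) I = madd C M (msum C M Z f I) (msum C M Z g I)"
  using H.finprod_multf[of f I g] assms by (auto simp: msum_def Pi_def)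

lemma msum_null: "(\<And>i. i \<in> I \<Longrightarrow> f i = mnull C M Z) \<Longrightarrow> msum C M Z f I = mnull C M Z"
  using H.finprod_one_eqI[of I f] by (simp add: msum_def)

lemma msum_reindex:
  assumes "inj_on h I" "\<And>i. i \<in> I \<Longrightarrow> f (h i) \<in> Hom C Z (mcar M)"
  shows "msum C M Z f (h ` I) = msum C M Z (\<lambda>i. f (h i)) I"
  using H.finprod_reindex[of f h I] assms by (auto simp: msum_def Pi_def)

lemma msum_mono_neutral:
  assumes "finite J" "I \<subseteq> J" "\<And>i. i \<in> J - I \<Longrightarrow> f i = mnull C M Z"
    "\<And>i. i \<in> I \<Longrightarrow> f i \<in> Hom C Z (mcar M)"
  shows "msum C M Z f J = msum C M Z f I"
proof -
  have ty: "f i \<in> Hom C Z (mcar M)" if "i \<in> J" for i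
    using assms(3,4)[of i] that M Z by (cases "i \<in> I") auto
  have "msum C M Z f (I \<union> (J - I)) = madd C M (msum C M Z f I) (msum C M Z f (J - I))"
    using assms ty by (intro msum_Un_disjoint) (auto intro: finite_subset)
  moreover have "msum C M Z f (J - I) = mnull C M Z"
    using assms(3) by (rule msum_null)
  moreover have "I \<union> (J - I) = J" using assms(2) by auto
  ultimately show ?thesis
    using msum_Hom[of I f] assms(4) M by simp
qed

text \<open>Differentiating a sum termwise yields a sum of sums over dependent index sets; this
  merges them into one sum, which can then be reindexed.\<close>

lemma msum_Sigma:
  assumes "finite I" "\<And>i. i \<in> I \<Longrightarrow> finite (J i)"
    "\<And>i j. i \<in> I \<Longrightarrow> j \<in> J i \<Longrightarrow> f (i, j) \<in> Hom C Z (mcar M)"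
  shows "msum C M Z f (Sigma I J) = msum C M Z (\<lambda>i. msum C M Z (\<lambda>j. f (i, j)) (J i)) I"
  using assms
proof (induction I rule: finite_induct)
  case (insert i I)
  have "Sigma (insert i I) J = Pair i ` J i \<union> Sigma I J" by auto
  then have "msum C M Z f (Sigma (insert i I) J)
    = madd C M (msum C M Z f (Pair i ` J i)) (msum C M Z f (Sigma I J))"
    using insert by (simp only:) (rule msum_Un_disjoint, auto)
  also have "msum C M Z f (Pair i ` J i) = msum C M Z (\<lambda>j. f (i, j)) (J i)"
    using insert.prems by (intro msum_reindex) (auto simp: inj_on_def)
  also have "msum C M Z f (Sigma I J) = msum C M Z (\<lambda>i. msum C M Z (\<lambda>j. f (i, j)) (J i)) I"
    using insert by auto
  finally show ?case
    using insert by (subst msum_insert) (auto intro!: msum_Hom simp del: Hom_iff)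
qed simp

end

lemma comp_msum:
  assumes M: "commutative_monoid_in C M" and h: "h \<in> Hom C W Z"
    and f: "\<And>i. i \<in> I \<Longrightarrow> f i \<in> Hom C Z (mcar M)"
  shows "h \<cdot> msum C M Z f I = msum C M W (\<lambda>i. h \<cdot> f i) I"
proof -
  have WZ: "W \<in> Ob C" "Z \<in> Ob C" using h by auto
  show ?thesis
  proof (cases "finite I")
    case True
    then show ?thesis using f
    proof (induction I rule: finite_induct)
      case (insert i I)
      have "msum C M Z f I \<in> Hom C Z (mcar M)"
        using M WZ insert by (intro msum_Hom) auto
      moreover have "f i \<in> Hom C Z (mcar M)" using insert by simp
      moreover have "msum C M Z f (insert i I) = madd C M (f i) (msum C M Z f I)"
        using M WZ insert by (intro msum_insert) auto
      moreover have "msum C M W (\<lambda>i. h \<cdot> f i) (insert i I) = madd C M (h \<cdot> f i) (msum C M W (\<lambda>i. h \<cdot> f i) I)"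
        using M WZ insert h by (intro msum_insert) auto
      ultimately show ?case
        using insert M h by simp
    qed (use M h WZ in simp)
  next
    \<comment> \<open>The sum over an infinite set is zero by convention, and precomposition
      preserves zero.\<close>
    case False
    have "msum C M Z f I = mnull C M Z" "msum C M W (\<lambda>i. h \<cdot> f i) I = mnull C M W"
      using comm_monoid.finprod_infinite[OF comm_monoid_hom_monoid[OF M WZ(1)] False]
        comm_monoid.finprod_infinite[OF comm_monoid_hom_monoid[OF M WZ(2)] False]
      by (simp_all add: msum_def)
    then show ?thesis using M h by simp
  qed
qed

lemma mcar_prod_cmon [simp]: "mcar (prod_cmon C M N) = mcar M \<boxtimes> mcar N"
  by (simp add: prod_cmon_def Let_def)

lemma madd_prod_cmon [simp]:
  assumes "commutative_monoid_in C M" "commutative_monoid_in C N"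
    "a \<in> Hom C Z (mcar M)" "a' \<in> Hom C Z (mcar M)" "b \<in> Hom C Z (mcar N)" "b' \<in> Hom C Z (mcar N)"
  shows "madd C (prod_cmon C M N) \<langle>a, b\<rangle> \<langle>a', b'\<rangle> = \<langle>madd C M a a', madd C N b b'\<rangle>"
proof -
  let ?P = "mcar M \<boxtimes> mcar N"
  have "\<langle>\<langle>a, b\<rangle>, \<langle>a', b'\<rangle>\<rangle> \<cdot> mplus (prod_cmon C M N)
    = \<langle>\<langle>\<langle>a, b\<rangle>, \<langle>a', b'\<rangle>\<rangle> \<cdot> madd C M (Pr0 C ?P ?P \<cdot> Pr0 C (mcar M) (mcar N)) (Pr1 C ?P ?P \<cdot> Pr0 C (mcar M) (mcar N)),
       \<langle>\<langle>a, b\<rangle>, \<langle>a', b'\<rangle>\<rangle> \<cdot> madd C N (Pr0 C ?P ?P \<cdot> Pr1 C (mcar M) (mcar N)) (Pr1 C ?P ?P \<cdot> Pr1 C (mcar M) (mcar N))\<rangle>"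
    using assms by (simp add: prod_cmon_def Let_def)
  also have "\<dots> = \<langle>madd C M a a', madd C N b b'\<rangle>"
    using assms by simp
  finally show ?thesis by (simp add: madd_def)
qed

lemma mnull_prod_cmon:
  assumes "commutative_monoid_in C M" "commutative_monoid_in C N" "Z \<in> Ob C"
  shows "mnull C (prod_cmon C M N) Z = \<langle>mnull C M Z, mnull C N Z\<rangle>"
  using assms by (simp add: mnull_def prod_cmon_def Let_def)

end

section \<open>Rules of calculus at generalized points\<close>

section \<open>Directional derivatives\<close>

context generalized_cartesian_differential_structure
begin

lemma mcar_L [simp]: "mcar (L X) = L0 X"
  by (simp add: L0_def)

lemmas [simp] = L_cmon L_Trm L_Prd L_L0

lemma L0_Ob [simp]: "X \<in> Ob C \<Longrightarrow> L0 X \<in> Ob C"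
  using cmon_typ(1)[OF L_cmon] by simp

lemma L0_L0 [simp]: "X \<in> Ob C \<Longrightarrow> L0 (L0 X) = L0 X"
  by (metis L_L0 mcar_L)

text \<open>The codomain of \<open>higher f n\<close> is \<open>Y\<close> for \<open>n = 0\<close>
  and \<open>L0 Y\<close> afterwards. Its derivative takes values in the same monoid either way, so
  that one statement can cover every \<open>n\<close>.\<close>

lemma L_Cod_higher [simp]: "Y \<in> Ob C \<Longrightarrow> L (if n = 0 then Y else L0 Y) = L Y"
  by simp

lemma L0_Prd [simp]: "X \<in> Ob C \<Longrightarrow> Y \<in> Ob C \<Longrightarrow> L0 (X \<boxtimes> Y) = L0 X \<boxtimes> L0 Y"
  by (metis L_Prd mcar_L mcar_prod_cmon)

lemma L0_Trm [simp]: "L0 (Trm C) = Trm C"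
  by (metis L_Trm mcar_L unit_cmon_def cmon.sel(1))

lemma L0_npow [simp]: "A \<in> Ob C \<Longrightarrow> X \<in> Ob C \<Longrightarrow> L0 (npow C A n X) = npow C (L0 A) n (L0 X)"
  by (induction n) auto

lemma D_typ [simp]:
  assumes "f \<in> Ar C"
  shows "D f \<in> Ar C" "Dom C (D f) = L0 (Dom C f) \<boxtimes> Dom C f" "Cod C (D f) = L0 (Cod C f)"
  using D_Hom[of f "Dom C f" "Cod C f"] assms by simp_all

text \<open>The derivative of \<open>h\<close> at the point \<open>p\<close> in the direction
  \<open>t\<close>, both being maps from a common object of parameters. At such generalized points
  [CD.1] to [CD.5] become rules of calculus without explicit projections.\<close>

definition dirder :: "'m \<Rightarrow> 'm \<Rightarrow> 'm \<Rightarrow> 'm" where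
  "dirder t p h = \<langle>t, p\<rangle> \<cdot> D h"

text \<open>A generalized tangent vector: a direction together with its base point. The two may live
  in different objects, since \<open>L0 X\<close> need not be \<open>X\<close>.\<close>

definition tangent :: "'o \<Rightarrow> 'o \<Rightarrow> 'm \<Rightarrow> 'm \<Rightarrow> bool" where
  "tangent Z X t p \<longleftrightarrow> t \<in> Hom C Z (L0 X) \<and> p \<in> Hom C Z X"

lemma dirder_typ [simp]:
  assumes "t \<in> Ar C" "p \<in> Ar C" "h \<in> Ar C" "Dom C t = Dom C p" "Cod C t = L0 (Dom C h)" "Cod C p = Dom C h"
  shows "dirder t p h \<in> Ar C" "Dom C (dirder t p h) = Dom C p" "Cod C (dirder t p h) = L0 (Cod C h)"
  using assms by (simp_all add: dirder_def)

lemma dirder_comp: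
  assumes "tangent Z X t p" "h \<in> Hom C X Y" "k \<in> Hom C Y W"
  shows "dirder t p (h \<cdot> k) = dirder (dirder t p h) (p \<cdot> h) k"
  using assms CD5[of h X Y k W] by (auto simp: tangent_def dirder_def)

lemma tangent_dirder:
  "tangent Z X t p \<Longrightarrow> h \<in> Hom C X Y \<Longrightarrow> tangent Z Y (dirder t p h) (p \<cdot> h)"
  by (auto simp: tangent_def)

lemma dirder_pairing:
  assumes "tangent Z X t p" "h \<in> Hom C X Y" "k \<in> Hom C X W"
  shows "dirder t p \<langle>h, k\<rangle> = \<langle>dirder t p h, dirder t p k\<rangle>"
  using assms CD4[of h X Y k W] by (auto simp: tangent_def dirder_def)

lemma comp_dirder:
  assumes "tangent Z X t p" "h \<in> Hom C X Y" "q \<in> Hom C W Z"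
  shows "q \<cdot> dirder t p h = dirder (q \<cdot> t) (q \<cdot> p) h"
  using assms by (auto simp: tangent_def dirder_def)

lemma dirder_Pr:
  assumes "tangent Z (X \<boxtimes> Y) t p" "X \<in> Ob C" "Y \<in> Ob C"
  shows "dirder t p (Pr0 C X Y) = t \<cdot> Pr0 C (L0 X) (L0 Y)"
    "dirder t p (Pr1 C X Y) = t \<cdot> Pr1 C (L0 X) (L0 Y)"
  using assms by (auto simp: tangent_def dirder_def CD3_0 CD3_1)

text \<open>The axioms do not list the derivative of an identity. The chain rule for
  \<open>Pr0 C X X \<cdot> Id C X = Pr0 C X X\<close> yields it, since [CD.3] evaluates the
  derivative of the projection at the doubled tangent vector to \<open>t\<close>.\<close>

lemma dirder_Id:
  assumes "tangent Z X t p"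
  shows "dirder t p (Id C X) = t"
proof -
  have ty: "t \<in> Ar C" "p \<in> Ar C" "Dom C t = Z" "Dom C p = Z" "Cod C t = L0 X" "Cod C p = X"
    and X: "X \<in> Ob C"
    using assms by (auto simp: tangent_def)
  have tp: "tangent Z (X \<boxtimes> X) \<langle>t, t\<rangle> \<langle>p, p\<rangle>"
    using ty X by (simp add: tangent_def)
  have "t = dirder \<langle>t, t\<rangle> \<langle>p, p\<rangle> (Pr0 C X X \<cdot> Id C X)"
    using ty X tp by (simp add: dirder_Pr)
  also have "\<dots> = dirder t p (Id C X)"
    using ty X tp by (subst dirder_comp) (auto simp: dirder_Pr)
  finally show ?thesis by simp
qed

lemma dirder_bang:
  assumes "tangent Z X t p"
  shows "dirder t p (bang C X) = bang C Z"
  using assms by (intro Trm_eqI) (auto simp: tangent_def)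

lemma dirder_zero:
  assumes "p \<in> Hom C Z X" "h \<in> Hom C X Y"
  shows "dirder (mnull C (L X) Z) p h = mnull C (L Y) Z"
  using CD2_zero[OF assms(2,1)] by (simp add: dirder_def)

lemma dirder_add:
  assumes "tangent Z X s p" "tangent Z X t p" "h \<in> Hom C X Y"
  shows "dirder (madd C (L X) s t) p h = madd C (L Y) (dirder s p h) (dirder t p h)"
  using assms CD2_plus[of h X Y s Z t p] by (simp add: dirder_def tangent_def)

text \<open>[CD.1] makes addition linear, so this is the chain rule along \<open>mplus\<close>. It
  concerns a sum of maps being differentiated, whereas \<open>dirder_add\<close> concerns a sum of
  directions and rests on [CD.2].\<close>

lemma dirder_madd:
  assumes "tangent Z X t p" "h \<in> Hom C X (L0 Y)" "k \<in> Hom C X (L0 Y)" "Y \<in> Ob C"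
  shows "dirder t p (madd C (L Y) h k) = madd C (L Y) (dirder t p h) (dirder t p k)"
proof -
  have ty: "t \<in> Ar C" "p \<in> Ar C" "Dom C t = Z" "Dom C p = Z" "Cod C t = L0 X" "Cod C p = X"
    "mplus (L Y) \<in> Ar C" "Dom C (mplus (L Y)) = L0 Y \<boxtimes> L0 Y" "Cod C (mplus (L Y)) = L0 Y"
    using assms cmon_typ[OF L_cmon[OF assms(4)]] by (auto simp: tangent_def)
  have "dirder t p (madd C (L Y) h k) = dirder (dirder t p \<langle>h, k\<rangle>) (p \<cdot> \<langle>h, k\<rangle>) (mplus (L Y))"
    unfolding madd_def using assms ty by (intro dirder_comp) auto
  also have "dirder t p \<langle>h, k\<rangle> = \<langle>dirder t p h, dirder t p k\<rangle>"
    using assms(1-3) by (rule dirder_pairing)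
  finally show ?thesis
    using assms ty unfolding dirder_def[of _ _ "mplus (L Y)"] by (simp add: CD1_plus madd_def)
qed

lemma dirder_mnull:
  assumes "tangent Z X t p" "Y \<in> Ob C"
  shows "dirder t p (mnull C (L Y) X) = mnull C (L Y) Z"
proof -
  have ty: "t \<in> Ar C" "p \<in> Ar C" "Dom C t = Z" "Dom C p = Z" "Cod C t = L0 X" "Cod C p = X"
    "mzero (L Y) \<in> Ar C" "Dom C (mzero (L Y)) = Trm C" "Cod C (mzero (L Y)) = L0 Y" "Z \<in> Ob C" "X \<in> Ob C"
    using assms cmon_typ[OF L_cmon[OF assms(2)]] by (auto simp: tangent_def)
  have "dirder t p (mnull C (L Y) X) = dirder (dirder t p (bang C X)) (p \<cdot> bang C X) (mzero (L Y))"
    unfolding mnull_def using assms(1) ty by (intro dirder_comp) auto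
  also have "dirder t p (bang C X) = bang C Z"
    using assms(1) by (rule dirder_bang)
  finally show ?thesis
    using ty assms(2) unfolding dirder_def[of _ _ "mzero (L Y)"] by (simp add: CD1_zero mnull_def)
qed

lemma dirder_msum:
  assumes "tangent Z X t p" "Y \<in> Ob C" "finite I" "\<And>i. i \<in> I \<Longrightarrow> f i \<in> Hom C X (L0 Y)"
  shows "dirder t p (msum C (L Y) X f I) = msum C (L Y) Z (\<lambda>i. dirder t p (f i)) I"
proof -
  have ty: "t \<in> Ar C" "p \<in> Ar C" "Dom C t = Z" "Dom C p = Z" "Cod C t = L0 X" "Cod C p = X"
    "Z \<in> Ob C" "X \<in> Ob C"
    using assms by (auto simp: tangent_def)
  show ?thesis
    using assms(3,4)
  proof (induction I rule: finite_induct)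
    case empty
    then show ?case using assms ty by (simp add: dirder_mnull)
  next
    case (insert i I)
    have "dirder t p (msum C (L Y) X f (insert i I)) = dirder t p (madd C (L Y) (f i) (msum C (L Y) X f I))"
      using insert assms(2) ty by (subst msum_insert) auto
    also have "\<dots> = madd C (L Y) (dirder t p (f i)) (dirder t p (msum C (L Y) X f I))"
      using assms(1,2) insert ty msum_Hom[of "L Y" X I f] by (intro dirder_madd) auto
    also have "\<dots> = msum C (L Y) Z (\<lambda>i. dirder t p (f i)) (insert i I)"
      using insert assms(2) ty by (subst msum_insert) auto
    finally show ?case .
  qed
qed

lemma dirder_tuple:
  assumes "tangent Z P t p" "set zs \<subseteq> Hom C P A" "x \<in> Hom C P X"
  shows "dirder t p (tuple zs x) = tuple (map (dirder t p) zs) (dirder t p x)"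
  using assms(2)
proof (induction zs)
  case (Cons z zs)
  then show ?case
    using tuple_Hom[of zs P A x X "length zs"] assms
    by (simp add: dirder_pairing[of Z P t p z A _ "npow C A (length zs) X"])
qed simp

lemma tangent_tuple:
  assumes "set ts \<subseteq> Hom C Z (L0 A)" "t \<in> Hom C Z (L0 X)" "set zs \<subseteq> Hom C Z A" "x \<in> Hom C Z X"
    "length ts = n" "length zs = n" "A \<in> Ob C"
  shows "tangent Z (npow C A n X) (tuple ts t) (tuple zs x)"
  using tuple_Hom[OF assms(1,2,5)] tuple_Hom[OF assms(3,4,6)] assms(2,4,7) by (auto simp: tangent_def)

lemma dirder_appl:
  assumes "tangent Z P t p" "h \<in> Hom C (npow C A n X) Y" "set zs \<subseteq> Hom C P A" "x \<in> Hom C P X"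
    "length zs = n"
  shows "dirder t p (appl C h zs x)
    = dirder (tuple (map (dirder t p) zs) (dirder t p x)) (tuple (map (\<lambda>z. p \<cdot> z) zs) (p \<cdot> x)) h"
proof -
  have "p \<cdot> tuple zs x = tuple (map (\<lambda>z. p \<cdot> z) zs) (p \<cdot> x)"
    using assms by (subst comp_tuple) (auto simp: tangent_def)
  then show ?thesis
    using dirder_comp[OF assms(1) tuple_Hom[OF assms(3-5)] assms(2)] dirder_tuple[OF assms(1,3,4)]
    by (simp add: appl_tuple)
qed

text \<open>Projections are linear by [CD.3], and so are their composites by the chain rule: the
  derivative forgets the base point and projects the direction.\<close>

lemma dirder_vproj:
  assumes "tangent Z (npow C A n X) t p" "A \<in> Ob C" "X \<in> Ob C" "i \<le> n"
  shows "dirder t p (vproj C A X n i) = t \<cdot> vproj C (L0 A) (L0 X) n i"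
  using assms(1,4)
proof (induction n arbitrary: i t p)
  case 0
  then show ?case using assms(2,3) by (auto simp: dirder_Id tangent_def)
next
  case (Suc n)
  show ?case
  proof (cases i)
    case 0
    then show ?thesis using Suc.prems assms(2,3) by (simp add: dirder_Pr)
  next
    case (Suc j)
    let ?q = "Pr1 C A (npow C A n X)"
    have q: "?q \<in> Hom C (npow C A (Suc n) X) (npow C A n X)" using assms by simp
    have tp: "tangent Z (A \<boxtimes> npow C A n X) t p" using Suc.prems(1) by simp
    have "dirder t p (vproj C A X (Suc n) i) = dirder (dirder t p ?q) (p \<cdot> ?q) (vproj C A X n j)"
      using Suc.prems Suc assms(2,3) q by (simp add: dirder_comp[OF tp])
    also have "\<dots> = dirder t p ?q \<cdot> vproj C (L0 A) (L0 X) n j"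
      using Suc.prems Suc by (intro Suc.IH tangent_dirder[OF _ q]) auto
    also have "\<dots> = t \<cdot> vproj C (L0 A) (L0 X) (Suc n) i"
      using Suc.prems Suc assms(2,3) tp by (simp add: dirder_Pr tangent_def)
    finally show ?thesis .
  qed
qed

lemma mnull_npow:
  assumes "A \<in> Ob C" "X \<in> Ob C" "Z \<in> Ob C"
  shows "mnull C (L (npow C A n X)) Z = tuple (replicate n (mnull C (L A) Z)) (mnull C (L X) Z)"
  using assms by (induction n) (auto simp: mnull_prod_cmon)

lemma madd_npow:
  assumes "A \<in> Ob C" "X \<in> Ob C" "set as \<subseteq> Hom C Z (L0 A)" "set bs \<subseteq> Hom C Z (L0 A)"
    "length as = n" "length bs = n" "x \<in> Hom C Z (L0 X)" "y \<in> Hom C Z (L0 X)"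
  shows "madd C (L (npow C A n X)) (tuple as x) (tuple bs y) = tuple (map2 (madd C (L A)) as bs) (madd C (L X) x y)"
  using assms(3-6)
proof (induction n arbitrary: as bs)
  case (Suc n)
  then obtain a as' b bs' where eq: "as = a # as'" "bs = b # bs'" by (metis length_Suc_conv)
  have "tuple as' x \<in> Hom C Z (npow C (L0 A) n (L0 X))" "tuple bs' y \<in> Hom C Z (npow C (L0 A) n (L0 X))"
    using Suc.prems eq assms by (auto intro!: tuple_Hom simp del: Hom_iff)
  then have "madd C (L (npow C A (Suc n) X)) (tuple as x) (tuple bs y)
    = \<langle>madd C (L A) a b, madd C (L (npow C A n X)) (tuple as' x) (tuple bs' y)\<rangle>"
    using assms(1,2) Suc.prems eq by simp
  then show ?case using Suc.IH[of as' bs'] Suc.prems eq by simp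
qed simp

text \<open>Of the \<open>Suc n\<close> arguments the one with index \<open>n\<close> is new: it
  becomes the direction in the coordinate \<open>X\<close>, with zeros in the \<open>n\<close> old
  coordinates, while index \<open>Suc n\<close> is the point of \<open>X\<close>. Starting from
  \<open>f\<close> itself makes \<open>D f\<close> the first instance of the same recursion.\<close>

primrec higher :: "'m \<Rightarrow> nat \<Rightarrow> 'm" where
  "higher f 0 = f"
| "higher f (Suc n) = (let X = Dom C f; A = L0 X; a = vproj C A X (Suc n) in
     dirder (tuple (replicate n (mnull C (L X) (npow C A (Suc n) X))) (a n))
       (tuple (map a [0..<n]) (a (Suc n))) (higher f n))"

end

section \<open>Symmetry of the higher derivatives\<close>

section \<open>Higher derivatives\<close>

text \<open>For use with symmetric maps: an updated position may be moved to the end, where the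
  axioms act.\<close>

lemma mset_list_update_end:
  assumes "i < length xs"
  shows "mset (xs[i := u]) = mset ((take i xs @ drop (Suc i) xs) @ [u])"
  using assms by (simp add: upd_conv_take_nth_drop)

context generalized_cartesian_differential_structure
begin

text \<open>A symmetric \<open>h\<close> equals its composite with a permutation of its arguments,
  and the chain rule for this composite permutes the directions and the base points by the same
  permutation. Hence the hypothesis on the zipped lists; the symmetry of \<open>h\<close> is only
  required at the generic point.\<close>

lemma dirder_mset:
  assumes h: "h \<in> Hom C (npow C A n X) Y" and A: "A \<in> Ob C" "X \<in> Ob C"
    and sym: "\<And>zs. mset zs = mset (vprojs A X n) \<Longrightarrow> appl C h zs (vproj C A X n n) = h"
    and ty: "set ts \<subseteq> Hom C Z (L0 A)" "t \<in> Hom C Z (L0 X)" "set zs \<subseteq> Hom C Z A" "x \<in> Hom C Z X"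
    and len: "length ts = n" "length zs = n" "length ts' = n" "length zs' = n"
    and mset: "mset (zip ts' zs') = mset (zip ts zs)"
  shows "dirder (tuple ts' t) (tuple zs' x) h = dirder (tuple ts t) (tuple zs x) h"
proof -
  obtain \<sigma> where \<sigma>: "\<sigma> permutes {..<length (zip ts zs)}" "permute_list \<sigma> (zip ts zs) = zip ts' zs'"
    using mset_eq_permutation[OF mset] by blast
  have \<sigma>n: "\<sigma> permutes {..<n}" using \<sigma>(1) len by simp
  have "zip ts' zs' = zip (permute_list \<sigma> ts) (permute_list \<sigma> zs)"
    using \<sigma>(2) \<sigma>n len by (subst (asm) permute_list_zip[of \<sigma> "{..<n}"]) auto
  then have eq: "ts' = permute_list \<sigma> ts" "zs' = permute_list \<sigma> zs"
    using len by (simp_all add: zip_eq_conv)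
  let ?v = "vproj C A X n"
  let ?ps = "permute_list \<sigma> (vprojs A X n)"
  let ?\<tau> = "tuple ts t" and ?\<pi> = "tuple zs x"
  have "mset ?ps = mset (vprojs A X n)" using \<sigma>n by (intro mset_permute_list) auto
  then have hh: "appl C h ?ps (?v n) = h" by (rule sym)
  have tg: "tangent Z (npow C A n X) ?\<tau> ?\<pi>"
    using ty len A by (intro tangent_tuple) auto
  have 1: "map (dirder ?\<tau> ?\<pi>) ?ps = ts'"
  proof -
    have "map (dirder ?\<tau> ?\<pi>) ?ps = permute_list \<sigma> (map (dirder ?\<tau> ?\<pi>) (vprojs A X n))"
      using \<sigma>n by (intro permute_list_map[symmetric]) auto
    also have "map (dirder ?\<tau> ?\<pi>) (vprojs A X n) = ts"
      using tuple_vproj(1)[OF ty(1,2) L0_Ob[OF A(1)] len(1)] A len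
      by (intro nth_equalityI) (auto simp: dirder_vproj[OF tg])
    finally show ?thesis using eq by simp
  qed
  have 2: "map (\<lambda>z. ?\<pi> \<cdot> z) ?ps = zs'"
  proof -
    have "map (\<lambda>z. ?\<pi> \<cdot> z) ?ps = permute_list \<sigma> (map (\<lambda>z. ?\<pi> \<cdot> z) (vprojs A X n))"
      using \<sigma>n by (intro permute_list_map[symmetric]) auto
    also have "map (\<lambda>z. ?\<pi> \<cdot> z) (vprojs A X n) = zs"
      using tuple_vproj(1)[OF ty(3,4) A(1) len(2)] A len
      by (intro nth_equalityI) auto
    finally show ?thesis using eq by simp
  qed
  have 3: "dirder ?\<tau> ?\<pi> (?v n) = t" "?\<pi> \<cdot> ?v n = x"
    using tuple_vproj(2)[OF ty(1,2) L0_Ob[OF A(1)] len(1)] tuple_vproj(2)[OF ty(3,4) A(1) len(2)] A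
    by (simp_all add: dirder_vproj[OF tg])
  have "set ?ps \<subseteq> Hom C (npow C A n X) A"
    using A \<sigma>n by (subst set_permute_list) auto
  then have "dirder ?\<tau> ?\<pi> (appl C h ?ps (?v n)) = dirder (tuple ts' t) (tuple zs' x) h"
    using dirder_appl[OF tg h _ , of ?ps "?v n"] A unfolding 1 2 3 by simp
  then show ?thesis by (simp only: hh)
qed

context
  fixes f X Y
  assumes f: "f \<in> Hom C X Y"
  notes [simp] = Hom_simps[OF f]
begin

lemma higher_Hom: "higher f n \<in> Hom C (npow C (L0 X) n X) (if n = 0 then Y else L0 Y)"
proof (induction n)
  case (Suc n)
  let ?P = "npow C (L0 X) (Suc n) X"
  let ?a = "vproj C (L0 X) X (Suc n)"
  have "tuple (replicate n (mnull C (L X) ?P)) (?a n) \<in> Hom C ?P (npow C (L0 X) n (L0 X))"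
    by (rule tuple_Hom) (auto simp: set_replicate_conv_if simp del: vproj.simps npow.simps)
  moreover have "tuple (map ?a [0..<n]) (?a (Suc n)) \<in> Hom C ?P (npow C (L0 X) n X)"
    by (rule tuple_Hom) (auto simp del: vproj.simps npow.simps)
  ultimately show ?case
    using Suc by (simp add: Let_def del: vproj.simps npow.simps)
qed simp

lemma appl_higher_Hom:
  assumes "set zs \<subseteq> Hom C Z (L0 X)" "x \<in> Hom C Z X" "length zs = n"
  shows "appl C (higher f n) zs x \<in> Hom C Z (if n = 0 then Y else L0 Y)"
  using higher_Hom assms by (rule appl_Hom)

lemma higher_Suc:
  fixes n
  defines "P \<equiv> npow C (L0 X) (Suc n) X" and "a \<equiv> vproj C (L0 X) X (Suc n)"
  shows "higher f (Suc n) = dirder (tuple (replicate n (mnull C (L X) P)) (a n)) (tuple (map a [0..<n]) (a (Suc n)))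
    (higher f n)"
  by (simp add: P_def a_def Let_def del: npow.simps vproj.simps)

text \<open>The recursion for \<open>higher\<close> is stated at the generic point; precomposing it
  with the tuple of arguments gives it everywhere.\<close>

lemma appl_higher_Suc:
  assumes as: "set as \<subseteq> Hom C Z (L0 X)" "length as = n" and w: "w \<in> Hom C Z (L0 X)" and x: "x \<in> Hom C Z X"
  shows "appl C (higher f (Suc n)) (as @ [w]) x
    = dirder (tuple (replicate n (mnull C (L X) Z)) w) (tuple as x) (higher f n)"
proof -
  let ?P = "npow C (L0 X) (Suc n) X" and ?a = "vproj C (L0 X) X (Suc n)"
  let ?z = "mnull C (L X) ?P"
  let ?q = "tuple (as @ [w]) x"
  have asw: "set (as @ [w]) \<subseteq> Hom C Z (L0 X)" "length (as @ [w]) = Suc n" using as w by auto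
  have q: "?q \<in> Hom C Z ?P" using asw x by (intro tuple_Hom)
  have z: "set (replicate n ?z) \<subseteq> Hom C ?P (L0 X)"
    by (rule replicate_Hom) (simp del: npow.simps)
  have a: "?a n \<in> Hom C ?P (L0 X)" "?a (Suc n) \<in> Hom C ?P X" "set (map ?a [0..<n]) \<subseteq> Hom C ?P (L0 X)"
    by (auto simp del: npow.simps vproj.simps)
  have tg: "tangent ?P (npow C (L0 X) n X) (tuple (replicate n ?z) (?a n)) (tuple (map ?a [0..<n]) (?a (Suc n)))"
    using z a by (intro tangent_tuple) (auto simp del: npow.simps vproj.simps)
  have qa: "?q \<cdot> ?a i = (as @ [w]) ! i" if "i < Suc n" for i
    using tuple_vproj(1)[OF asw(1) x L0_Ob asw(2) that] by simp
  have qx: "?q \<cdot> ?a (Suc n) = x"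
    using tuple_vproj(2)[OF asw(1) x L0_Ob asw(2)] by simp
  have m: "map (\<lambda>z. ?q \<cdot> z) (map ?a [0..<n]) = as"
    using qa as(2) by (intro nth_equalityI) (auto simp: nth_append simp del: vproj.simps)
  have qz: "?q \<cdot> ?z = mnull C (L X) Z" using q by (simp del: npow.simps)
  have 1: "?q \<cdot> tuple (replicate n ?z) (?a n) = tuple (replicate n (mnull C (L X) Z)) w"
    using z a q qz qa[of n] as(2) by (subst comp_tuple) (auto simp del: npow.simps vproj.simps simp: nth_append)
  have 2: "?q \<cdot> tuple (map ?a [0..<n]) (?a (Suc n)) = tuple as x"
    using a q qx m by (subst comp_tuple) (auto simp del: npow.simps vproj.simps)
  show ?thesis
    unfolding appl_tuple higher_Suc by (subst comp_dirder[OF tg higher_Hom q]) (simp only: 1 2)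
qed

text \<open>Since \<open>higher f (Suc n)\<close> is \<open>D (higher f n)\<close> after a tuple of
  projections and zeros, the chain rule brings its derivative into the shape of a second derivative
  to which [CD.6] and [CD.7] apply.\<close>

lemma dirder_higher_Suc:
  assumes ts: "set ts \<subseteq> Hom C Z (L0 X)" "length ts = n" and s: "s \<in> Hom C Z (L0 X)" and t: "t \<in> Hom C Z (L0 X)"
    and as: "set as \<subseteq> Hom C Z (L0 X)" "length as = n" and b: "b \<in> Hom C Z (L0 X)" and x: "x \<in> Hom C Z X"
  defines "zs \<equiv> replicate n (mnull C (L X) Z)"
  shows "dirder (tuple (ts @ [s]) t) (tuple (as @ [b]) x) (higher f (Suc n))
     = \<langle>\<langle>tuple zs s, tuple ts t\<rangle>, \<langle>tuple zs b, tuple as x\<rangle>\<rangle> \<cdot> D (D (higher f n))"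
proof -
  let ?P = "npow C (L0 X) (Suc n) X" and ?a = "vproj C (L0 X) X (Suc n)"
  let ?z = "mnull C (L X) ?P"
  let ?\<tau> = "tuple (ts @ [s]) t" and ?\<pi> = "tuple (as @ [b]) x"
  let ?T = "tuple (replicate n ?z) (?a n)" and ?Q = "tuple (map ?a [0..<n]) (?a (Suc n))"
  have asb: "set (as @ [b]) \<subseteq> Hom C Z (L0 X)" "length (as @ [b]) = Suc n" using as b by auto
  have tss: "set (ts @ [s]) \<subseteq> Hom C Z (L0 X)" "length (ts @ [s]) = Suc n" using ts s by auto
  have tg: "tangent Z ?P ?\<tau> ?\<pi>" using asb tss t x by (intro tangent_tuple) auto
  have q: "?\<pi> \<in> Hom C Z ?P" using tg by (simp add: tangent_def)
  have Z: "Z \<in> Ob C" using x by auto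
  have z: "set (replicate n ?z) \<subseteq> Hom C ?P (L0 X)"
    by (rule replicate_Hom) (simp del: npow.simps)
  have a: "?a n \<in> Hom C ?P (L0 X)" "?a (Suc n) \<in> Hom C ?P X" "set (map ?a [0..<n]) \<subseteq> Hom C ?P (L0 X)"
    by (auto simp del: npow.simps vproj.simps)
  have T: "?T \<in> Hom C ?P (npow C (L0 X) n (L0 X))" using z a by (intro tuple_Hom) auto
  have Q: "?Q \<in> Hom C ?P (npow C (L0 X) n X)" using a by (intro tuple_Hom) auto
  have qa: "?\<pi> \<cdot> ?a i = (as @ [b]) ! i" "dirder ?\<tau> ?\<pi> (?a i) = (ts @ [s]) ! i" if "i < Suc n" for i
    using tuple_vproj(1)[OF asb(1) x L0_Ob asb(2) that] tuple_vproj(1)[OF tss(1) t L0_Ob tss(2) that]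
      dirder_vproj[OF tg, of i] that by (simp_all del: vproj.simps)
  have qx: "?\<pi> \<cdot> ?a (Suc n) = x" "dirder ?\<tau> ?\<pi> (?a (Suc n)) = t"
    using tuple_vproj(2)[OF asb(1) x L0_Ob asb(2)] tuple_vproj(2)[OF tss(1) t L0_Ob tss(2)]
      dirder_vproj[OF tg, of "Suc n"] by (simp_all del: vproj.simps)
  have m: "map (\<lambda>z. ?\<pi> \<cdot> z) (map ?a [0..<n]) = as" "map (dirder ?\<tau> ?\<pi>) (map ?a [0..<n]) = ts"
    using qa as(2) ts(2) by (auto intro!: nth_equalityI simp: nth_append simp del: vproj.simps)
  have qz: "?\<pi> \<cdot> ?z = mnull C (L X) Z" "dirder ?\<tau> ?\<pi> ?z = mnull C (L X) Z"
    using q tg by (simp_all add: dirder_mnull del: npow.simps)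
  have 1: "?\<pi> \<cdot> ?T = tuple zs b"
    using z a q qz qa[of n] as(2) by (subst comp_tuple) (auto simp del: npow.simps vproj.simps simp: nth_append zs_def)
  have 2: "?\<pi> \<cdot> ?Q = tuple as x"
    using a q qx m by (subst comp_tuple) (auto simp del: npow.simps vproj.simps)
  have 3: "dirder ?\<tau> ?\<pi> ?T = tuple zs s"
    using dirder_tuple[OF tg z a(1)] qz qa[of n] ts(2) by (simp add: zs_def nth_append del: npow.simps vproj.simps)
  have 4: "dirder ?\<tau> ?\<pi> ?Q = tuple ts t"
    using dirder_tuple[OF tg a(3,2)] qx m by (simp del: npow.simps vproj.simps map_map)
  have TQ: "\<langle>?T, ?Q\<rangle> \<in> Hom C ?P (npow C (L0 X) n (L0 X) \<boxtimes> npow C (L0 X) n X)"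
    using T Q by (rule pairing_Hom)
  have Dh: "D (higher f n) \<in> Hom C (npow C (L0 X) n (L0 X) \<boxtimes> npow C (L0 X) n X) (L0 Y)"
    using higher_Hom[of n] by (cases n) auto
  have "dirder ?\<tau> ?\<pi> (higher f (Suc n)) = dirder (dirder ?\<tau> ?\<pi> \<langle>?T, ?Q\<rangle>) (?\<pi> \<cdot> \<langle>?T, ?Q\<rangle>) (D (higher f n))"
    unfolding higher_Suc unfolding dirder_def[of ?T ?Q] by (rule dirder_comp[OF tg TQ Dh])
  also have "dirder ?\<tau> ?\<pi> \<langle>?T, ?Q\<rangle> = \<langle>tuple zs s, tuple ts t\<rangle>"
    using dirder_pairing[OF tg T Q] 3 4 by simp
  also have "?\<pi> \<cdot> \<langle>?T, ?Q\<rangle> = \<langle>tuple zs b, tuple as x\<rangle>"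
    using T Q q 1 2 by simp
  finally show ?thesis by (simp add: dirder_def)
qed

lemma mnull_tuple:
  "Z \<in> Ob C \<Longrightarrow> tuple (replicate n (mnull C (L X) Z)) (mnull C (L X) Z) = mnull C (L (npow C (L0 X) n X)) Z"
  using mnull_npow[of "L0 X" X Z n] by simp

text \<open>In \<open>dirder_higher_Suc\<close> with vanishing \<open>ts\<close> and
  \<open>s\<close>, the first component of the direction is zero, while \<open>b\<close> and
  \<open>c\<close>, padded with zeros, occupy the two entries that [CD.7] interchanges.\<close>

lemma appl_higher_swap:
  assumes as: "set as \<subseteq> Hom C Z (L0 X)" "length as = n" and b: "b \<in> Hom C Z (L0 X)" and c: "c \<in> Hom C Z (L0 X)"
    and x: "x \<in> Hom C Z X"
  shows "appl C (higher f (Suc (Suc n))) (as @ [b, c]) x = appl C (higher f (Suc (Suc n))) (as @ [c, b]) x"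
proof -
  let ?z = "mnull C (L X) Z"
  have Z: "Z \<in> Ob C" using x by auto
  have z: "set (replicate n ?z) \<subseteq> Hom C Z (L0 X)" "?z \<in> Hom C Z (L0 X)"
    using Z by (auto intro!: replicate_Hom simp del: Hom_iff) (simp_all)
  have rep: "replicate (Suc n) ?z = replicate n ?z @ [?z]"
    by (simp add: replicate_append_same)
  have *: "appl C (higher f (Suc (Suc n))) (as @ [b, c]) x
    = \<langle>\<langle>mnull C (L (npow C (L0 X) n X)) Z, tuple (replicate n ?z) c\<rangle>, \<langle>tuple (replicate n ?z) b, tuple as x\<rangle>\<rangle>
        \<cdot> D (D (higher f n))"
    if "b \<in> Hom C Z (L0 X)" "c \<in> Hom C Z (L0 X)" for b c
    using appl_higher_Suc[of "as @ [b]" Z "Suc n" c x] dirder_higher_Suc[OF z(1) _ z(2) that(2) as that(1) x]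
      as that x mnull_tuple[OF Z, of n]
    by (simp add: rep del: replicate_Suc higher.simps)
  have t: "tuple (replicate n ?z) b \<in> Hom C Z (L0 (npow C (L0 X) n X))"
    "tuple (replicate n ?z) c \<in> Hom C Z (L0 (npow C (L0 X) n X))"
    using tuple_Hom[OF z(1) b length_replicate] tuple_Hom[OF z(1) c length_replicate] by simp_all
  show ?thesis
    unfolding *[OF b c] *[OF c b]
    using CD7[OF higher_Hom t(2,1) tuple_Hom[OF as(1) x as(2)]] by simp
qed

lemma appl_higher_mset:
  assumes "set as \<subseteq> Hom C Z (L0 X)" "length as = n" "x \<in> Hom C Z X" "mset bs = mset as"
  shows "appl C (higher f n) bs x = appl C (higher f n) as x"
  using assms
proof (induction n arbitrary: as bs Z x)
  case 0
  then show ?case by simp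
next
  case (Suc n)
  \<comment> \<open>Permutations fixing the last argument: that argument is the direction, while the
    others form the base point of a derivative of \<open>higher f n\<close>, which is symmetric by
    induction.\<close>
  have perm_init: "appl C (higher f (Suc n)) (us @ [w]) x = appl C (higher f (Suc n)) (vs @ [w]) x"
    if ty: "set vs \<subseteq> Hom C Z (L0 X)" "length vs = n" "w \<in> Hom C Z (L0 X)" and eq: "mset us = mset vs" for us vs w
  proof -
    let ?z = "mnull C (L X) Z"
    have z: "set (replicate n ?z) \<subseteq> Hom C Z (L0 (L0 X))"
      using Suc.prems(3) by (intro replicate_Hom) auto
    have us: "set us \<subseteq> Hom C Z (L0 X)" "length us = n"
      using ty eq mset_eq_setD[OF eq] mset_eq_length[OF eq] by simp_all
    have "mset (zip (replicate n ?z) us) = image_mset (Pair ?z) (mset us)"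
      "mset (zip (replicate n ?z) vs) = image_mset (Pair ?z) (mset vs)"
      using us(2) ty(2) by (simp_all add: zip_replicate1)
    then have meq: "mset (zip (replicate n ?z) us) = mset (zip (replicate n ?z) vs)" using eq by simp
    \<comment> \<open>The induction hypothesis is needed at the generic point, whose domain differs
      from the current \<open>Z\<close>; this is why \<open>Z\<close> is arbitrary in the
      induction.\<close>
    have sym: "appl C (higher f n) zs (vproj C (L0 X) X n n) = higher f n"
      if "mset zs = mset (vprojs (L0 X) X n)" for zs
    proof -
      have "appl C (higher f n) zs (vproj C (L0 X) X n n) = appl C (higher f n) (vprojs (L0 X) X n) (vproj C (L0 X) X n n)"
        using that by (intro Suc.IH[where Z = "npow C (L0 X) n X"]) auto
      then show ?thesis using higher_Hom[of n] appl_vprojs[of "higher f n" "L0 X" n X] by simp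
    qed
    show ?thesis
      unfolding appl_higher_Suc[OF us ty(3) Suc.prems(3)] appl_higher_Suc[OF ty Suc.prems(3)]
      using z ty us Suc.prems(3) meq
      by (intro dirder_mset[OF higher_Hom _ _ sym, where Z = Z]) auto
  qed
  obtain vs w where as: "as = vs @ [w]" using Suc.prems(2) by (metis length_Suc_conv_rev)
  have lbs: "length bs = Suc n" using Suc.prems(2,4) mset_eq_length by metis
  then obtain us u where bs: "bs = us @ [u]" by (metis length_Suc_conv_rev)
  have ty: "set vs \<subseteq> Hom C Z (L0 X)" "length vs = n" "w \<in> Hom C Z (L0 X)" using Suc.prems as by auto
  have "set bs = set as" using Suc.prems(4) by (rule mset_eq_setD)
  then have tyb: "set us \<subseteq> Hom C Z (L0 X)" "length us = n" "u \<in> Hom C Z (L0 X)" using Suc.prems as bs lbs by auto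
  show ?case
  proof (cases "u = w")
    case True
    then have "mset us = mset vs" using Suc.prems(4) as bs by simp
    from perm_init[OF ty this] show ?thesis using True as bs by (simp only:)
  next
    case False
    have meq: "add_mset u (mset us) = add_mset w (mset vs)" using Suc.prems(4) as bs by simp
    \<comment> \<open>If the last entries differ, each list contains the last entry of the other.
      Both can be rearranged to end in these two entries, in opposite orders, and the swap connects
      them.\<close>
    obtain K where K: "mset us = add_mset w K" "mset vs = add_mset u K"
      using meq False by (auto simp: add_eq_conv_ex)
    obtain ks where ks: "mset ks = K" using ex_mset by blast
    have n: "n = Suc (length ks)" using K(2) ty(2) ks by (metis size_add_mset size_mset)
    have "set_mset K \<subseteq> set vs" using K(2) by (metis add_mset_add_single mset_subset_eq_add_left set_mset_mono set_mset_mset)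
    then have kty: "set ks \<subseteq> Hom C Z (L0 X)" using ks ty(1) by (metis set_mset_mset subset_trans)
    have "appl C (higher f (Suc n)) bs x = appl C (higher f (Suc n)) ((ks @ [w]) @ [u]) x"
      unfolding bs using kty n ty tyb K ks by (intro perm_init) auto
    also have "\<dots> = appl C (higher f (Suc n)) (ks @ [u, w]) x"
      using appl_higher_swap[OF kty refl ty(3) tyb(3) Suc.prems(3)] n by simp
    also have "\<dots> = appl C (higher f (Suc n)) ((ks @ [u]) @ [w]) x" by simp
    also have "\<dots> = appl C (higher f (Suc n)) as x"
      unfolding as using kty n ty tyb K ks by (intro perm_init) auto
    finally show ?thesis .
  qed
qed

end

section \<open>Multiadditivity, and the derivative of a higher derivative\<close>

context
  fixes f X Y
  assumes f: "f \<in> Hom C X Y"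
  notes [simp] = Hom_simps[OF f]
begin

lemma tuple_zeros_Hom:
  assumes "Z \<in> Ob C" "w \<in> Hom C Z (L0 X)"
  shows "tuple (replicate n (mnull C (L X) Z)) w \<in> Hom C Z (L0 (npow C (L0 X) n X))"
  using tuple_Hom[of "replicate n (mnull C (L X) Z)" Z "L0 X" w "L0 X" n] assms
  by (simp add: replicate_Hom)

lemma madd_tuple_zeros:
  assumes "a \<in> Hom C Z (L0 X)" "b \<in> Hom C Z (L0 X)"
  shows "madd C (L (npow C (L0 X) n X)) (tuple (replicate n (mnull C (L X) Z)) a) (tuple (replicate n (mnull C (L X) Z)) b)
    = tuple (replicate n (mnull C (L X) Z)) (madd C (L X) a b)"
proof -
  have Z: "Z \<in> Ob C" using assms by auto
  show ?thesis
    using Z assms madd_npow[of "L0 X" X "replicate n (mnull C (L X) Z)" Z "replicate n (mnull C (L X) Z)" n a b]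
    by (simp add: set_replicate_conv_if zip_replicate)
qed

text \<open>The last argument enters as the direction of a derivative, padded with zeros. Adding two
  such directions keeps the padding (\<open>madd_tuple_zeros\<close>), so [CD.2] applies.\<close>

lemma appl_higher_last_add:
  assumes zs: "set zs \<subseteq> Hom C Z (L0 X)" "length zs = n" and a: "a \<in> Hom C Z (L0 X)" and b: "b \<in> Hom C Z (L0 X)"
    and x: "x \<in> Hom C Z X"
  shows "appl C (higher f (Suc n)) (zs @ [madd C (L X) a b]) x
     = madd C (L Y) (appl C (higher f (Suc n)) (zs @ [a]) x) (appl C (higher f (Suc n)) (zs @ [b]) x)"
proof -
  have Z: "Z \<in> Ob C" using x by auto
  have ab: "madd C (L X) a b \<in> Hom C Z (L0 X)" using a b by simp
  have t: "tangent Z (npow C (L0 X) n X) (tuple (replicate n (mnull C (L X) Z)) w) (tuple zs x)" if "w \<in> Hom C Z (L0 X)" for w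
    unfolding tangent_def using tuple_zeros_Hom[OF Z that] tuple_Hom[OF zs(1) x zs(2)] by blast
  show ?thesis
    unfolding appl_higher_Suc[OF f zs a x] appl_higher_Suc[OF f zs b x] appl_higher_Suc[OF f zs ab x]
      madd_tuple_zeros[OF a b, symmetric]
    using dirder_add[OF t[OF a] t[OF b] higher_Hom[OF f]] by simp
qed

lemma appl_higher_last_zero:
  assumes zs: "set zs \<subseteq> Hom C Z (L0 X)" "length zs = n" and x: "x \<in> Hom C Z X"
  shows "appl C (higher f (Suc n)) (zs @ [mnull C (L X) Z]) x = mnull C (L Y) Z"
proof -
  have Z: "Z \<in> Ob C" using x by auto
  have z: "mnull C (L X) Z \<in> Hom C Z (L0 X)" using Z by simp
  show ?thesis
    unfolding appl_higher_Suc[OF f zs z x] mnull_tuple[OF f Z]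
    using dirder_zero[OF tuple_Hom[OF zs(1) x zs(2)] higher_Hom[OF f]] by simp
qed

lemma appl_higher_update:
  assumes "set zs \<subseteq> Hom C Z (L0 X)" "length zs = n" "x \<in> Hom C Z X" "i < n" "u \<in> Hom C Z (L0 X)"
  shows "appl C (higher f n) (zs[i := u]) x = appl C (higher f n) ((take i zs @ drop (Suc i) zs) @ [u]) x"
  using assms mset_list_update_end[of i zs u]
  by (intro appl_higher_mset[OF f]) (auto dest: in_set_takeD in_set_dropD)

lemma appl_higher_multiadditive:
  assumes zs: "set zs \<subseteq> Hom C Z (L0 X)" "length zs = n" and x: "x \<in> Hom C Z X" and i: "i < n"
  shows "a \<in> Hom C Z (L0 X) \<Longrightarrow> b \<in> Hom C Z (L0 X) \<Longrightarrow> appl C (higher f n) (zs[i := madd C (L X) a b]) x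
       = madd C (L Y) (appl C (higher f n) (zs[i := a]) x) (appl C (higher f n) (zs[i := b]) x)"
    "appl C (higher f n) (zs[i := mnull C (L X) Z]) x = mnull C (L Y) Z"
proof -
  obtain m where n: "n = Suc m" using i by (cases n) auto
  let ?us = "take i zs @ drop (Suc i) zs"
  have us: "set ?us \<subseteq> Hom C Z (L0 X)" "length ?us = m"
    using zs i n by (auto dest: in_set_takeD in_set_dropD)
  note up = appl_higher_update[OF zs x i]
  show "appl C (higher f n) (zs[i := madd C (L X) a b]) x
       = madd C (L Y) (appl C (higher f n) (zs[i := a]) x) (appl C (higher f n) (zs[i := b]) x)"
    if a: "a \<in> Hom C Z (L0 X)" and b: "b \<in> Hom C Z (L0 X)"
  proof -
    have "madd C (L X) a b \<in> Hom C Z (L0 X)" using a b by simp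
    from up[OF this] up[OF a] up[OF b] appl_higher_last_add[OF us a b x] show ?thesis
      unfolding n by simp
  qed
  have "mnull C (L X) Z \<in> Hom C Z (L0 X)" using x by auto
  from up[OF this] appl_higher_last_zero[OF us x]
  show "appl C (higher f n) (zs[i := mnull C (L X) Z]) x = mnull C (L Y) Z"
    unfolding n by simp
qed

text \<open>By symmetry position \<open>i\<close> may be taken last. There the argument is the
  direction of a derivative, and [CD.6] says that differentiating along it only puts
  \<open>v\<close> in its place.\<close>

lemma dirder_higher_single:
  assumes zs: "set zs \<subseteq> Hom C Z (L0 X)" "length zs = n" and x: "x \<in> Hom C Z X" and i: "i < n"
    and v: "v \<in> Hom C Z (L0 X)"
  shows "dirder (tuple ((replicate n (mnull C (L X) Z))[i := v]) (mnull C (L X) Z)) (tuple zs x) (higher f n)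
    = appl C (higher f n) (zs[i := v]) x"
proof -
  obtain m where n: "n = Suc m" using i by (cases n) auto
  have Z: "Z \<in> Ob C" using x by auto
  let ?z = "mnull C (L X) Z"
  let ?us = "take i zs @ drop (Suc i) zs"
  have z: "?z \<in> Hom C Z (L0 X)" "set (replicate k ?z) \<subseteq> Hom C Z (L0 X)" for k
    using Z replicate_Hom[of ?z] by auto
  have us: "set ?us \<subseteq> Hom C Z (L0 X)" "length ?us = m"
    using zs i n by (auto dest: in_set_takeD in_set_dropD)
  have zi: "zs ! i \<in> Hom C Z (L0 X)" using zs i nth_mem[of i zs] by blast
  have ty: "set (replicate m ?z @ [v]) \<subseteq> Hom C Z (L0 (L0 X))" "set (?us @ [zs ! i]) \<subseteq> Hom C Z (L0 X)"
    using us v zi Z by (auto simp: set_replicate_conv_if)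
  have m: "mset (zip ((replicate n ?z)[i := v]) zs) = mset (zip (replicate m ?z @ [v]) (?us @ [zs ! i]))"
  proof -
    have "zip ((replicate n ?z)[i := v]) zs = (zip (replicate n ?z) zs)[i := (v, zs ! i)]"
      by (simp add: update_zip)
    also have "zip (replicate n ?z) zs = map (Pair ?z) zs" using zs by (simp add: zip_replicate1)
    also have "mset ((map (Pair ?z) zs)[i := (v, zs ! i)]) = mset (map (Pair ?z) ?us @ [(v, zs ! i)])"
      using mset_list_update_end[of i "map (Pair ?z) zs" "(v, zs ! i)"] zs i by (simp add: take_map drop_map)
    also have "map (Pair ?z) ?us @ [(v, zs ! i)] = zip (replicate m ?z @ [v]) (?us @ [zs ! i])"
      using us(2) zs(2) i n by (subst zip_append) (simp_all add: zip_replicate1)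
    finally show ?thesis .
  qed
  have sym: "appl C (higher f n) ws (vproj C (L0 X) X n n) = higher f n"
    if "mset ws = mset (vprojs (L0 X) X n)" for ws
  proof -
    have "appl C (higher f n) ws (vproj C (L0 X) X n n) = appl C (higher f n) (vprojs (L0 X) X n) (vproj C (L0 X) X n n)"
      using that by (intro appl_higher_mset[OF f, where Z = "npow C (L0 X) n X"]) auto
    then show ?thesis using higher_Hom[OF f, of n] appl_vprojs[of "higher f n" "L0 X" n X] by simp
  qed
  have "dirder (tuple ((replicate n ?z)[i := v]) ?z) (tuple zs x) (higher f n)
    = dirder (tuple (replicate m ?z @ [v]) ?z) (tuple (?us @ [zs ! i]) x) (higher f n)"
    using z(1) ty us(2) zs(2) x n by (intro dirder_mset[OF higher_Hom[OF f] _ _ sym _ _ _ _ _ _ _ _ m, where Z = Z])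
      (auto simp del: replicate_Suc)
  also have "\<dots> = \<langle>\<langle>tuple (replicate m ?z) v, mnull C (L (npow C (L0 X) m X)) Z\<rangle>,
      \<langle>tuple (replicate m ?z) (zs ! i), tuple ?us x\<rangle>\<rangle> \<cdot> D (D (higher f m))"
    using dirder_higher_Suc[OF f z(2) length_replicate v z(1) us zi x] mnull_tuple[OF f Z, of m]
    unfolding n by (simp del: higher.simps)
  also have "\<dots> = \<langle>tuple (replicate m ?z) v, tuple ?us x\<rangle> \<cdot> D (higher f m)"
    using CD6[OF higher_Hom[OF f] tuple_zeros_Hom[OF Z v] tuple_zeros_Hom[OF Z zi] tuple_Hom[OF us(1) x us(2)]] .
  also have "\<dots> = appl C (higher f n) (?us @ [v]) x"
    unfolding n appl_higher_Suc[OF f us v x] by (simp add: dirder_def)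
  finally show ?thesis using appl_higher_update[OF zs x i v] by simp
qed

text \<open>The displayed formula of the overview at generalized elements: the summand with the
  appended \<open>t\<close> is the recursion for \<open>higher\<close>, and each of the others is an
  instance of \<open>dirder_higher_single\<close>.\<close>

lemma dirder_higher:
  assumes ts: "set ts \<subseteq> Hom C Z (L0 X)" "length ts = n" and t: "t \<in> Hom C Z (L0 X)"
    and zs: "set zs \<subseteq> Hom C Z (L0 X)" "length zs = n" and x: "x \<in> Hom C Z X"
  shows "dirder (tuple ts t) (tuple zs x) (higher f n)
    = madd C (L Y) (appl C (higher f (Suc n)) (zs @ [t]) x)
       (msum C (L Y) Z (\<lambda>i. appl C (higher f n) (zs[i := ts ! i]) x) {..<n})"
proof -
  have Z: "Z \<in> Ob C" using x by auto
  let ?z = "mnull C (L X) Z"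
  have z: "?z \<in> Hom C Z (L0 X)" "set (replicate k ?z) \<subseteq> Hom C Z (L0 X)" for k
    using Z replicate_Hom[of ?z] by auto
  let ?h = "\<lambda>i. appl C (higher f n) (zs[i := ts ! i]) x"
  have last: "appl C (higher f (Suc n)) (zs @ [t]) x \<in> Hom C Z (L0 Y)"
    using appl_higher_Hom[OF f, of "zs @ [t]" Z x "Suc n"] zs t x by simp
  have h: "?h i \<in> Hom C Z (L0 Y)" if "i < n" for i
  proof -
    have "ts ! i \<in> Hom C Z (L0 X)" using ts that nth_mem by blast
    then have "set (zs[i := ts ! i]) \<subseteq> Hom C Z (L0 X)" using zs(1) set_update_subset_insert by fast
    then show ?thesis using appl_higher_Hom[OF f, of "zs[i := ts ! i]" Z x n] zs x that by simp
  qed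
  \<comment> \<open>The coordinates of the direction are switched on one at a time. Passing from
    \<open>k\<close> to \<open>Suc k\<close> adds a direction supported at position
    \<open>k\<close>, which [CD.2] splits off.\<close>
  have "dirder (tuple (take k ts @ replicate (n - k) ?z) t) (tuple zs x) (higher f n)
    = madd C (L Y) (appl C (higher f (Suc n)) (zs @ [t]) x) (msum C (L Y) Z ?h {..<k})" if "k \<le> n" for k
    using that
  proof (induction k)
    case 0
    then show ?case
      using appl_higher_Suc[OF f zs t x] last Z by simp
  next
    case (Suc k)
    let ?u = "take k ts @ replicate (n - k) ?z" and ?v = "(replicate n ?z)[k := ts ! k]"
    have tk: "ts ! k \<in> Hom C Z (L0 X)" using nth_Hom[OF ts(1)] ts(2) Suc.prems by simp
    have u: "set ?u \<subseteq> Hom C Z (L0 X)" "length ?u = n"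
      using ts z(2)[of "n - k"] Suc.prems by (auto dest: in_set_takeD)
    have v: "set ?v \<subseteq> Hom C Z (L0 X)" "length ?v = n"
      using z(2)[of n] tk set_update_subset_insert[of "replicate n ?z" k "ts ! k"] by (blast, simp)
    have "take (Suc k) ts @ replicate (n - Suc k) ?z = map2 (madd C (L X)) ?u ?v"
    proof (rule nth_equalityI)
      fix i assume "i < length (take (Suc k) ts @ replicate (n - Suc k) ?z)"
      then have i: "i < n" using ts Suc.prems by simp
      then have "ts ! i \<in> Hom C Z (L0 X)" using nth_Hom[OF ts(1)] ts(2) by simp
      then show "(take (Suc k) ts @ replicate (n - Suc k) ?z) ! i = map2 (madd C (L X)) ?u ?v ! i"
        using i ts Suc.prems Z by (auto simp: nth_append nth_list_update)
    qed (use ts Suc.prems in simp)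
    moreover have "madd C (L X) t ?z = t" using t Z by simp
    ultimately have "tuple (take (Suc k) ts @ replicate (n - Suc k) ?z) t
      = madd C (L (npow C (L0 X) n X)) (tuple ?u t) (tuple ?v ?z)"
      using madd_npow[of "L0 X" X ?u Z ?v n t ?z] u v z(1) t by simp
    moreover have "tangent Z (npow C (L0 X) n X) (tuple ?u t) (tuple zs x)"
      "tangent Z (npow C (L0 X) n X) (tuple ?v ?z) (tuple zs x)"
      using u v t z(1) zs x by (auto intro!: tangent_tuple simp del: Hom_iff)
    ultimately have "dirder (tuple (take (Suc k) ts @ replicate (n - Suc k) ?z) t) (tuple zs x) (higher f n)
      = madd C (L Y) (dirder (tuple ?u t) (tuple zs x) (higher f n)) (dirder (tuple ?v ?z) (tuple zs x) (higher f n))"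
      using dirder_add[OF _ _ higher_Hom[OF f, of n]] by simp
    also have "dirder (tuple ?v ?z) (tuple zs x) (higher f n) = ?h k"
      using Suc.prems tk by (intro dirder_higher_single zs x) auto
    also have "dirder (tuple ?u t) (tuple zs x) (higher f n)
       = madd C (L Y) (appl C (higher f (Suc n)) (zs @ [t]) x) (msum C (L Y) Z ?h {..<k})"
      using Suc by simp
    also have "madd C (L Y) \<dots> (?h k) = madd C (L Y) (appl C (higher f (Suc n)) (zs @ [t]) x) (msum C (L Y) Z ?h {..<Suc k})"
    proof -
      have s: "msum C (L Y) Z ?h {..<k} \<in> Hom C Z (mcar (L Y))"
        using Suc.prems h Z by (intro msum_Hom) auto
      have hk: "?h k \<in> Hom C Z (mcar (L Y))" using Suc.prems h[of k] by simp
      have "msum C (L Y) Z ?h {..<Suc k} = madd C (L Y) (?h k) (msum C (L Y) Z ?h {..<k})"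
        unfolding lessThan_Suc using Suc.prems h Z by (intro msum_insert) auto
      also have "\<dots> = madd C (L Y) (msum C (L Y) Z ?h {..<k}) (?h k)"
        using s hk by (intro madd_laws(4)) auto
      finally show ?thesis using madd_laws(1)[of "L Y" _ Z, OF _ _ s hk] last by simp
    qed
    finally show ?case .
  qed
  from this[of n] show ?thesis using ts by simp
qed

text \<open>The form used in both inductions, where the arguments are themselves maps to be
  differentiated: one summand differentiates the base point, and each of the others a single
  argument.\<close>

lemma dirder_appl_higher:
  assumes tp: "tangent Z P t p" and zs: "set zs \<subseteq> Hom C P (L0 X)" "length zs = n" and x: "x \<in> Hom C P X"
  shows "dirder t p (appl C (higher f n) zs x)
    = madd C (L Y) (appl C (higher f (Suc n)) (map (\<lambda>z. p \<cdot> z) zs @ [dirder t p x]) (p \<cdot> x))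
       (msum C (L Y) Z (\<lambda>i. appl C (higher f n) ((map (\<lambda>z. p \<cdot> z) zs)[i := dirder t p (zs ! i)]) (p \<cdot> x)) {..<n})"
proof -
  have ty: "t \<in> Hom C Z (L0 P)" "p \<in> Hom C Z P" using tp by (auto simp: tangent_def)
  have 1: "set (map (\<lambda>z. p \<cdot> z) zs) \<subseteq> Hom C Z (L0 X)" using zs ty by auto
  have 2: "set (map (dirder t p) zs) \<subseteq> Hom C Z (L0 X)" using zs ty by auto
  have 3: "dirder t p x \<in> Hom C Z (L0 X)" "p \<cdot> x \<in> Hom C Z X" using ty x by auto
  have Z: "Z \<in> Ob C" using ty by auto
  have eq: "msum C (L Y) Z (\<lambda>i. appl C (higher f n) ((map (\<lambda>z. p \<cdot> z) zs)[i := map (dirder t p) zs ! i]) (p \<cdot> x)) {..<n}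
    = msum C (L Y) Z (\<lambda>i. appl C (higher f n) ((map (\<lambda>z. p \<cdot> z) zs)[i := dirder t p (zs ! i)]) (p \<cdot> x)) {..<n}"
  proof (rule msum_cong)
    fix i assume i: "i \<in> {..<n}"
    then have "dirder t p (zs ! i) \<in> Hom C Z (L0 X)" using nth_Hom[OF 2, of i] zs(2) by simp
    then have "set ((map (\<lambda>z. p \<cdot> z) zs)[i := dirder t p (zs ! i)]) \<subseteq> Hom C Z (L0 X)"
      using 1 set_update_subset_insert by fast
    from appl_higher_Hom[OF f this 3(2)] zs(2) i
    show "appl C (higher f n) ((map (\<lambda>z. p \<cdot> z) zs)[i := dirder t p (zs ! i)]) (p \<cdot> x) \<in> Hom C Z (mcar (L Y))"
      by simp
  qed (use zs(2) Z in auto)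
  show ?thesis
    unfolding dirder_appl[OF tp higher_Hom[OF f] zs(1) x zs(2)]
    using dirder_higher[OF 2 _ 3(1) 1 _ 3(2), of n] zs(2) eq by simp
qed

end

end

section \<open>How partitions of n + 1 elements arise from those of n\<close>

section \<open>Partitions as lists of blocks\<close>

text \<open>Lists rather than sets of blocks, as the blocks supply arguments in a definite order;
  the increasing minima select one list for each partition.\<close>

definition block_lists :: "nat \<Rightarrow> nat set list set" where
  "block_lists n = {Bs. partition_on {..<n} (set Bs) \<and> sorted_wrt (\<lambda>A B. Min A < Min B) Bs}"

text \<open>The index \<open>length Bs\<close> stands for a block of its own, so that the choices
  match the summands of \<open>dirder_appl_higher\<close>.\<close>

definition extend_blocks :: "nat \<Rightarrow> nat set list \<times> nat \<Rightarrow> nat set list" where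
  "extend_blocks n = (\<lambda>(Bs, i). if i < length Bs then Bs[i := insert n (Bs ! i)] else Bs @ [{n}])"

lemma distinct_sorted_Min: "sorted_wrt (\<lambda>A B. Min A < Min B) Bs \<Longrightarrow> distinct Bs"
  by (induction Bs) auto

lemma partition_on_lessThanD:
  assumes "partition_on {..<n::nat} P" "B \<in> P"
  shows "finite B" "B \<noteq> {}" "B \<subseteq> {..<n}" "Min B \<in> B"
proof -
  show sub: "B \<subseteq> {..<n}" using partition_onD1[OF assms(1)] assms(2) by auto
  then show fin: "finite B" by (rule finite_subset) simp
  show ne: "B \<noteq> {}" using partition_onD3[OF assms(1)] assms(2) by auto
  show "Min B \<in> B" using fin ne by (rule Min_in)
qed

lemma partition_on_unique:
  "partition_on A P \<Longrightarrow> B \<in> P \<Longrightarrow> B' \<in> P \<Longrightarrow> m \<in> B \<Longrightarrow> m \<in> B' \<Longrightarrow> B = B'"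
  by (meson disjointD disjoint_iff partition_onD2)

lemma THE_block_Min:
  assumes "partition_on {..<n::nat} P" "B \<in> P"
  shows "(THE B'. B' \<in> P \<and> Min B \<in> B') = B"
  using assms(2) partition_on_lessThanD(4)[OF assms] partition_on_unique[OF assms(1)]
  by (intro the_equality) blast+

text \<open>Serves in both directions: to enlarge a block by the new element and to delete that
  element from its block.\<close>

lemma partition_on_replace:
  assumes P: "partition_on A P" and B: "B \<in> P" and B': "A' - B' = A - B" "B' \<subseteq> A'" "B' \<noteq> {}"
  shows "partition_on A' (insert B' (P - {B}))"
proof -
  have dB: "disjnt B (\<Union> (P - {B}))"
    using partition_on_unique[OF P B] by (auto simp: disjnt_def)
  have "partition_on A (insert B (P - {B}))" using P B by (simp add: insert_absorb)
  then have AB: "partition_on (A - B) (P - {B})" using partition_on_insert[OF dB] by simp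
  have "\<Union> (P - {B}) = A' - B'" using partition_onD1[OF AB] B'(1) by simp
  then have "disjnt B' (\<Union> (P - {B}))" by (auto simp: disjnt_def)
  from partition_on_insert[OF this] show ?thesis using AB B' by simp
qed

lemma blocks_props:
  assumes P: "partition_on {..<n} P"
  shows "set (blocks P) = P" "sorted_wrt (\<lambda>A B. Min A < Min B) (blocks P)"
proof -
  have fin: "finite P" using P by (auto intro: finite_elements)
  have THE_eq: "Min (THE B'. B' \<in> P \<and> m \<in> B') = m" if "m \<in> Min ` P" for m
    using that THE_block_Min[OF P] by auto
  have "set (blocks P) = (\<lambda>m. THE B. B \<in> P \<and> m \<in> B) ` Min ` P"
    using fin by (simp add: blocks_def)
  also have "\<dots> = (\<lambda>B. B) ` P"
    unfolding image_image using THE_block_Min[OF P] by (intro image_cong) auto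
  finally show "set (blocks P) = P" by simp
  show "sorted_wrt (\<lambda>A B. Min A < Min B) (blocks P)"
    unfolding blocks_def sorted_wrt_map
    by (rule sorted_wrt_mono_rel[of _ "(<)"]) (use THE_eq fin in auto)
qed

text \<open>A list with strictly increasing minima is determined by its set of blocks, since sorting
  the minima recovers the order and each minimum identifies its block.\<close>

lemma bij_betw_blocks: "bij_betw blocks {P. partition_on {..<n} P} (block_lists n)"
proof (rule bij_betw_byWitness[where f' = set])
  show "\<forall>P\<in>{P. partition_on {..<n} P}. set (blocks P) = P"
    using blocks_props(1) by blast
  show "blocks ` {P. partition_on {..<n} P} \<subseteq> block_lists n"
    using blocks_props by (auto simp: block_lists_def)
  show "set ` block_lists n \<subseteq> {P. partition_on {..<n} P}" by (auto simp: block_lists_def)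
  show "\<forall>Bs\<in>block_lists n. blocks (set Bs) = Bs"
  proof
    fix Bs assume "Bs \<in> block_lists n"
    then have P: "partition_on {..<n} (set Bs)" and s: "sorted_wrt (\<lambda>A B. Min A < Min B) Bs"
      by (auto simp: block_lists_def)
    have "sorted_wrt (<) (map Min Bs)" using s by (simp add: sorted_wrt_map)
    then have "sorted_list_of_set (set (map Min Bs)) = map Min Bs"
      by (intro sorted_list_of_set.idem_if_sorted_distinct) (simp_all only: strict_sorted_iff)
    then show "blocks (set Bs) = Bs"
      using THE_block_Min[OF P] by (simp add: blocks_def o_def map_idI)
  qed
qed

lemma length_blocks: "partition_on {..<n} P \<Longrightarrow> length (blocks P) = card P"
  using distinct_card[OF distinct_sorted_Min, of "blocks P"] blocks_props[of n P] by simp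

lemma finite_block_lists: "finite (block_lists n)"
  using bij_betw_finite[OF bij_betw_blocks] finitely_many_partition_on[of "{..<n}"] by simp

text \<open>The new element exceeds all old ones: it changes no minimum, and as a block of its own
  it belongs at the end.\<close>

lemma extend_blocks_in:
  assumes Bs: "Bs \<in> block_lists n"
  shows "extend_blocks n (Bs, i) \<in> block_lists (Suc n)"
proof -
  have P: "partition_on {..<n} (set Bs)" and s: "sorted_wrt (\<lambda>A B. Min A < Min B) Bs"
    using Bs by (auto simp: block_lists_def)
  note B = partition_on_lessThanD[OF P]
  show ?thesis
  proof (cases "i < length Bs")
    case True
    let ?B = "Bs ! i"
    have i: "?B \<in> set Bs" using True by simp
    have "set (Bs[i := insert n ?B]) = insert (insert n ?B) (set Bs - {?B})"
      using True distinct_sorted_Min[OF s] by (simp add: set_update_distinct)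
    moreover have "partition_on {..<Suc n} (insert (insert n ?B) (set Bs - {?B}))"
      using B[OF i] by (intro partition_on_replace[OF P i]) auto
    moreover have "Min (insert n ?B) = Min ?B"
    proof -
      have "Min ?B < n" using B(3,4)[OF i] by auto
      then show ?thesis using B(1,2)[OF i] by simp
    qed
    then have "Min (Bs[i := insert n ?B] ! j) = Min (Bs ! j)" if "j < length Bs" for j
      using that by (cases "j = i") auto
    then have "sorted_wrt (\<lambda>A B. Min A < Min B) (Bs[i := insert n ?B])"
      using s by (simp add: sorted_wrt_iff_nth_less)
    ultimately show ?thesis using True by (simp add: extend_blocks_def block_lists_def)
  next
    case False
    have "partition_on {..<Suc n} (insert {n} (set Bs))"
      using partition_on_insert[of "{n}" "set Bs" "{..<Suc n}"] P B(3)
      by (fastforce simp: disjnt_def lessThan_Suc Diff_insert_absorb)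
    moreover have "sorted_wrt (\<lambda>A B. Min A < Min B) (Bs @ [{n}])"
    proof -
      have "Min B < n" if "B \<in> set Bs" for B using B(3,4)[OF that] by auto
      then show ?thesis using s by (simp add: sorted_wrt_append)
    qed
    ultimately show ?thesis using False by (simp add: extend_blocks_def block_lists_def)
  qed
qed

text \<open>There is an explicit left inverse: deleting \<open>n\<close> everywhere and dropping an
  emptied block recovers \<open>Bs\<close>, and the number of blocks before the one containing
  \<open>n\<close> recovers \<open>i\<close>.\<close>

lemma inj_on_extend_blocks: "inj_on (extend_blocks n) (SIGMA Bs:block_lists n. {..length Bs})"
proof -
  let ?r = "\<lambda>Bs. filter (\<lambda>B. B \<noteq> {}) (map (\<lambda>B. B - {n}) Bs)"
  let ?k = "\<lambda>Bs :: nat set list. length (takeWhile (\<lambda>B. n \<notin> B) Bs)"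
  have "?r (extend_blocks n (Bs, i)) = Bs \<and> ?k (extend_blocks n (Bs, i)) = i"
    if Bs: "Bs \<in> block_lists n" and i: "i \<le> length Bs" for Bs i
  proof -
    have P: "partition_on {..<n} (set Bs)" using Bs by (auto simp: block_lists_def)
    have n: "n \<notin> B" "B \<noteq> {}" if "B \<in> set Bs" for B using partition_on_lessThanD[OF P that] by auto
    show ?thesis
    proof (cases "i < length Bs")
      case True
      have "map (\<lambda>B. B - {n}) (Bs[i := insert n (Bs ! i)]) = Bs"
        using n True by (intro nth_equalityI) (auto simp: nth_list_update)
      moreover have "filter (\<lambda>B. B \<noteq> {}) Bs = Bs" using n by (simp add: filter_id_conv)
      moreover have "?k (Bs[i := insert n (Bs ! i)]) = i"
        using n True by (subst upd_conv_take_nth_drop, simp, subst takeWhile_append2)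
          (auto dest: in_set_takeD)
      ultimately show ?thesis using True by (simp add: extend_blocks_def del: map_update)
    next
      case False
      have "map (\<lambda>B. B - {n}) Bs = Bs" "filter (\<lambda>B. B \<noteq> {}) Bs = Bs" "takeWhile (\<lambda>B. n \<notin> B) Bs = Bs"
        using n by (auto intro: map_idI simp: filter_id_conv takeWhile_eq_all_conv)
      then show ?thesis using False i n by (simp add: extend_blocks_def takeWhile_append2)
    qed
  qed
  then show ?thesis
    by (intro inj_on_inverseI[where g = "\<lambda>Bs. (?r Bs, ?k Bs)"]) auto
qed

lemma extend_blocks_surj:
  assumes Bs: "Bs \<in> block_lists (Suc n)"
  shows "Bs \<in> extend_blocks n ` (SIGMA Bs:block_lists n. {..length Bs})"
proof -
  have P: "partition_on {..<Suc n} (set Bs)" and s: "sorted_wrt (\<lambda>A B. Min A < Min B) Bs"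
    using Bs by (auto simp: block_lists_def)
  note B = partition_on_lessThanD[OF P]
  have "n \<in> \<Union> (set Bs)" using partition_onD1[OF P] by auto
  then obtain i where i: "i < length Bs" "n \<in> Bs ! i" by (auto simp: in_set_conv_nth)
  let ?B = "Bs ! i"
  have iB: "?B \<in> set Bs" using i by simp
  have nB: "n \<notin> B" if "B \<in> set Bs" "B \<noteq> ?B" for B
    using that partition_on_unique[OF P that(1) iB] i by auto
  have d: "distinct Bs" using s by (rule distinct_sorted_Min)
  show ?thesis
  proof (cases "?B = {n}")
    case True
    \<comment> \<open>A block after \<open>{n}\<close> would have a minimum above \<open>n\<close>,
      which is the largest element.\<close>
    have "i = length Bs - 1"
    proof (rule ccontr)
      assume "i \<noteq> length Bs - 1"
      then have j: "Suc i < length Bs" using i by simp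
      then have "n < Min (Bs ! Suc i)" using s True sorted_wrt_nth_less[OF s, of i "Suc i"] by simp
      then show False using B[of "Bs ! Suc i"] j by fastforce
    qed
    define Cs where "Cs = butlast Bs"
    have Bs_eq: "Bs = Cs @ [{n}]"
      unfolding Cs_def using True \<open>i = length Bs - 1\<close> i by (metis append_butlast_last_id last_conv_nth length_0_conv not_less0)
    have nCs: "{n} \<notin> set Cs" using d Bs_eq by simp
    have "partition_on ({..<Suc n} - {n}) (set Cs)"
      using partition_on_insert[of "{n}" "set Cs" "{..<Suc n}"] P nB True nCs Bs_eq
      by (auto simp: disjnt_def)
    moreover have "{..<Suc n} - {n} = {..<n}" by auto
    ultimately have "Cs \<in> block_lists n" using s Bs_eq by (auto simp: block_lists_def sorted_wrt_append)
    then show ?thesis by (intro image_eqI[where x = "(Cs, length Cs)"]) (auto simp: extend_blocks_def Bs_eq)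
  next
    case False
    define Cs where "Cs = Bs[i := ?B - {n}]"
    have setC: "set Cs = insert (?B - {n}) (set Bs - {?B})"
      unfolding Cs_def using i d by (simp add: set_update_distinct)
    have "partition_on {..<n} (set Cs)"
      unfolding setC
      using B[OF iB] False i by (intro partition_on_replace[OF P iB]) (auto simp: less_Suc_eq)
    \<comment> \<open>The block has a further element, necessarily below \<open>n\<close>, so its
      minimum survives the deletion.\<close>
    moreover have "Min (?B - {n}) = Min ?B"
    proof -
      have "?B = insert n (?B - {n})" using i by auto
      moreover have "Min (insert n (?B - {n})) = Min (?B - {n})"
      proof -
        have fin: "finite (?B - {n})" "?B - {n} \<noteq> {}" using B(1)[OF iB] False i by auto
        then have "Min (?B - {n}) \<in> ?B - {n}" by (rule Min_in)
        then have "Min (?B - {n}) < n" using B(3)[OF iB] by (auto simp: less_Suc_eq)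
        then show ?thesis by (subst Min_insert[OF fin]) simp
      qed
      ultimately show ?thesis by simp
    qed
    then have "Min (Cs ! j) = Min (Bs ! j)" if "j < length Bs" for j
      using that unfolding Cs_def by (cases "j = i") auto
    then have "sorted_wrt (\<lambda>A B. Min A < Min B) Cs"
      using s by (simp add: sorted_wrt_iff_nth_less Cs_def)
    ultimately have "Cs \<in> block_lists n" by (simp add: block_lists_def)
    moreover have "extend_blocks n (Cs, i) = Bs" "i \<le> length Cs"
      using i by (simp_all add: extend_blocks_def Cs_def insert_absorb)
    ultimately show ?thesis by (intro image_eqI[where x = "(Cs, i)"]) auto
  qed
qed

lemma extend_blocks_image:
  "extend_blocks n ` (SIGMA Bs:block_lists n. {..length Bs}) = block_lists (Suc n)"
proof
  show "extend_blocks n ` (SIGMA Bs:block_lists n. {..length Bs}) \<subseteq> block_lists (Suc n)"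
    by (auto simp: extend_blocks_in)
  show "block_lists (Suc n) \<subseteq> extend_blocks n ` (SIGMA Bs:block_lists n. {..length Bs})"
    using extend_blocks_surj by (rule subsetI)
qed

lemma block_lists_0: "block_lists 0 = {[]}"
  by (auto simp: block_lists_def partition_on_empty)

lemma block_lists_1: "block_lists (Suc 0) = {[{0}]}"
proof -
  have "(SIGMA Bs:block_lists 0. {..length Bs}) = {([], 0)}" by (auto simp: block_lists_0)
  then show ?thesis by (simp add: extend_blocks_image[of 0, symmetric] extend_blocks_def)
qed

lemma sorted_list_of_set_insert_max:
  assumes "finite B" "\<And>b. b \<in> B \<Longrightarrow> b < (n::nat)"
  shows "sorted_list_of_set (insert n B) = sorted_list_of_set B @ [n]"
proof -
  have "sorted_list_of_set (set (sorted_list_of_set B @ [n])) = sorted_list_of_set B @ [n]"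
    using assms by (intro sorted_list_of_set.idem_if_sorted_distinct) (auto simp: sorted_append intro: less_imp_le)
  then show ?thesis using assms(1) by simp
qed

section \<open>Higher derivatives of a composite\<close>

section \<open>The Faa di Bruno formula\<close>

lemma atMost_eq_insert_lessThan: "{..k} = insert k {..<k::nat}"
  by auto

context generalized_cartesian_differential_structure
begin

text \<open>The arguments \<open>a\<close> and \<open>x\<close> are kept as parameters, because the
  induction step passes from the projections of one power to those of the next.\<close>

definition faa_block :: "'m \<Rightarrow> (nat \<Rightarrow> 'm) \<Rightarrow> 'm \<Rightarrow> nat set \<Rightarrow> 'm" where
  "faa_block f a x B = appl C (higher f (card B)) (map a (sorted_list_of_set B)) x"

definition faa_term :: "'m \<Rightarrow> 'm \<Rightarrow> (nat \<Rightarrow> 'm) \<Rightarrow> 'm \<Rightarrow> nat set list \<Rightarrow> 'm" where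
  "faa_term f g a x Bs = appl C (higher g (length Bs)) (map (faa_block f a x) Bs) (x \<cdot> f)"

lemma faa_block_Hom:
  assumes f: "f \<in> Hom C X Y" and a: "\<And>i. i \<in> B \<Longrightarrow> a i \<in> Hom C Z (L0 X)" and x: "x \<in> Hom C Z X"
    and B: "finite B" "B \<noteq> {}"
  shows "faa_block f a x B \<in> Hom C Z (L0 Y)"
proof -
  have "set (map a (sorted_list_of_set B)) \<subseteq> Hom C Z (L0 X)"
    using a B by (simp add: image_subset_iff)
  from appl_higher_Hom[OF f this x refl] show ?thesis
    using B by (simp add: faa_block_def del: Hom_iff)
qed

text \<open>The hypotheses describe the tangent vector in the recursion for \<open>higher\<close>:
  the old arguments have zero derivative, and \<open>x\<close> moves in the direction of the new
  argument. By multiadditivity all summands of the chain rule vanish except the one that appends the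
  new argument.\<close>

lemma dirder_faa_block:
  assumes f: "f \<in> Hom C X Y" and tp: "tangent Z P t p"
    and a: "\<And>i. i < n \<Longrightarrow> a i \<in> Hom C P (L0 X)" and x: "x \<in> Hom C P X"
    and ab: "\<And>i. i < n \<Longrightarrow> p \<cdot> a i = b i" "p \<cdot> x = y"
    and d: "\<And>i. i < n \<Longrightarrow> dirder t p (a i) = mnull C (L X) Z" "dirder t p x = b n"
    and B: "B \<subseteq> {..<n}" "B \<noteq> {}"
  shows "dirder t p (faa_block f a x B) = faa_block f b y (insert n B)"
    "p \<cdot> faa_block f a x B = faa_block f b y B"
proof -
  let ?l = "sorted_list_of_set B"
  have fin: "finite B" using B(1) by (rule finite_subset) simp
  have nB: "n \<notin> B" using B by auto
  have l: "i < n" if "i \<in> set ?l" for i using that B fin by auto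
  have zs: "set (map a ?l) \<subseteq> Hom C P (L0 X)" "length (map a ?l) = card B"
    using a l by auto
  have ty: "t \<in> Hom C Z (L0 P)" "p \<in> Hom C Z P" using tp by (auto simp: tangent_def)
  then have Z: "Z \<in> Ob C" by auto
  have X: "X \<in> Ob C" "Y \<in> Ob C" using f by auto
  have m: "map (\<lambda>z. p \<cdot> z) (map a ?l) = map b ?l" using l ab by auto
  have y: "y \<in> Hom C Z X" using ty x ab(2)[symmetric] by simp
  have zs': "set (map b ?l) \<subseteq> Hom C Z (L0 X)" "length (map b ?l) = card B"
    unfolding m[symmetric] using map_comp_Hom[OF zs(1) ty(2)] by simp_all
  show "p \<cdot> faa_block f a x B = faa_block f b y B"
    unfolding faa_block_def
    using comp_appl[OF higher_Hom[OF f] zs(1) x zs(2) ty(2)] unfolding m ab(2) .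
  have "appl C (higher f (card B)) ((map (\<lambda>z. p \<cdot> z) (map a ?l))[i := dirder t p (map a ?l ! i)]) (p \<cdot> x) = mnull C (L Y) Z"
    if i: "i < card B" for i
  proof -
    have "map a ?l ! i = a (?l ! i)" "?l ! i < n" using i l[OF nth_mem[of i ?l]] fin by simp_all
    then have "dirder t p (map a ?l ! i) = mnull C (L X) Z" using d(1) by simp
    then show ?thesis
      unfolding m ab(2) using appl_higher_multiadditive(2)[OF f zs' y i] by simp
  qed
  then have null: "msum C (L Y) Z (\<lambda>i. appl C (higher f (card B))
      ((map (\<lambda>z. p \<cdot> z) (map a ?l))[i := dirder t p (map a ?l ! i)]) (p \<cdot> x)) {..<card B} = mnull C (L Y) Z"
    using Z X by (intro msum_null) auto
  have sl: "sorted_list_of_set (insert n B) = ?l @ [n]"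
    using fin B(1) by (intro sorted_list_of_set_insert_max) auto
  have "b n \<in> Hom C Z (L0 X)" using d(2)[symmetric] ty x by simp
  then have "set (map b (?l @ [n])) \<subseteq> Hom C Z (L0 X)" using zs'(1) by simp
  from appl_higher_Hom[OF f this y refl]
  have ty': "appl C (higher f (Suc (card B))) (map b ?l @ [b n]) y \<in> Hom C Z (L0 Y)"
    using fin by simp
  have rhs: "faa_block f b y (insert n B) = appl C (higher f (Suc (card B))) (map b ?l @ [b n]) y"
    unfolding faa_block_def sl using fin nB by (simp del: higher.simps)
  show "dirder t p (faa_block f a x B) = faa_block f b y (insert n B)"
    unfolding faa_block_def[of f a]
    unfolding dirder_appl_higher[OF f tp zs x] m ab(2) d(2) rhs null[unfolded m ab(2)]
    using ty' X by (simp del: higher.simps)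
qed

lemma faa_term_Hom:
  assumes f: "f \<in> Hom C X Y" and g: "g \<in> Hom C Y W" and a: "\<And>i. i < n \<Longrightarrow> a i \<in> Hom C Z (L0 X)"
    and x: "x \<in> Hom C Z X" and Bs: "Bs \<in> block_lists n" and n: "0 < n"
  shows "faa_term f g a x Bs \<in> Hom C Z (L0 W)"
proof -
  have P: "partition_on {..<n} (set Bs)" using Bs by (simp add: block_lists_def)
  have "Bs \<noteq> []" using partition_onD1[OF P] n by (cases Bs) auto
  have "faa_block f a x B \<in> Hom C Z (L0 Y)" if B: "B \<in> set Bs" for B
    using partition_on_lessThanD(1-3)[OF P B] a by (intro faa_block_Hom[OF f _ x]) auto
  then have "set (map (faa_block f a x) Bs) \<subseteq> Hom C Z (L0 Y)" by auto
  moreover have "x \<cdot> f \<in> Hom C Z Y" using x f by simp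
  ultimately show ?thesis
    using appl_higher_Hom[OF g, of "map (faa_block f a x) Bs" Z "x \<cdot> f" "length Bs"] \<open>Bs \<noteq> []\<close>
    by (simp add: faa_term_def)
qed

text \<open>In the chain rule for the derivative of \<open>g\<close>, differentiating the point
  \<open>x \<cdot> f\<close> produces the block \<open>{n}\<close>, and differentiating the argument
  of a block inserts \<open>n\<close> into it.\<close>

lemma dirder_faa_term:
  assumes f: "f \<in> Hom C X Y" and g: "g \<in> Hom C Y W" and tp: "tangent Z P t p"
    and a: "\<And>i. i < n \<Longrightarrow> a i \<in> Hom C P (L0 X)" and x: "x \<in> Hom C P X"
    and ab: "\<And>i. i < n \<Longrightarrow> p \<cdot> a i = b i" "p \<cdot> x = y"
    and d: "\<And>i. i < n \<Longrightarrow> dirder t p (a i) = mnull C (L X) Z" "dirder t p x = b n"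
    and Bs: "Bs \<in> block_lists n"
  shows "dirder t p (faa_term f g a x Bs)
    = msum C (L W) Z (\<lambda>i. faa_term f g b y (extend_blocks n (Bs, i))) {..length Bs}"
proof -
  have P: "partition_on {..<n} (set Bs)" using Bs by (simp add: block_lists_def)
  note B = partition_on_lessThanD[OF P]
  have ty: "t \<in> Hom C Z (L0 P)" "p \<in> Hom C Z P" using tp by (auto simp: tangent_def)
  have Ob: "Z \<in> Ob C" "X \<in> Ob C" "Y \<in> Ob C" "W \<in> Ob C" using f g ty by auto
  have y: "y \<in> Hom C Z X" using ty x ab(2)[symmetric] by simp
  have bn: "b n \<in> Hom C Z (L0 X)" using d(2)[symmetric] ty x by simp
  have b: "b i \<in> Hom C Z (L0 X)" if "i < Suc n" for i
  proof (cases "i = n")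
    case False
    then have "b i = p \<cdot> a i" using that ab(1)[of i] by simp
    then show ?thesis using that a[of i] ty False by simp
  qed (use bn in simp)
  have blk: "faa_block f a x B \<in> Hom C P (L0 Y)" if "B \<in> set Bs" for B
    using B(1-3)[OF that] a by (intro faa_block_Hom[OF f _ x]) auto
  have zs: "set (map (faa_block f a x) Bs) \<subseteq> Hom C P (L0 Y)" "length (map (faa_block f a x) Bs) = length Bs"
    using blk by auto
  have xf: "x \<cdot> f \<in> Hom C P Y" using x f by simp
  have pxf: "p \<cdot> (x \<cdot> f) = y \<cdot> f" using ty x f ab(2) comp_assoc[of p x f] by (simp del: comp_assoc)
  have dxf: "dirder t p (x \<cdot> f) = faa_block f b y {n}"
  proof -
    have "dirder t p (x \<cdot> f) = dirder (b n) y f"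
      using dirder_comp[OF tp x f] d(2) ab(2) by simp
    then show ?thesis
      using appl_higher_Suc[OF f, of "[]" Z 0 "b n" y] bn y by (simp add: faa_block_def del: higher.simps) simp
  qed
  have db: "dirder t p (faa_block f a x B) = faa_block f b y (insert n B)" "p \<cdot> faa_block f a x B = faa_block f b y B"
    if "B \<in> set Bs" for B
    using B(2,3)[OF that] by (intro dirder_faa_block[where a = a and b = b, OF f tp a x ab d]; simp)+
  have m: "map (\<lambda>z. p \<cdot> z) (map (faa_block f a x) Bs) = map (faa_block f b y) Bs"
    using db(2) by simp
  let ?T = "\<lambda>i. faa_term f g b y (extend_blocks n (Bs, i))"
  have T: "?T i \<in> Hom C Z (mcar (L W))" for i
    unfolding mcar_L using extend_blocks_in[OF Bs] b by (intro faa_term_Hom[OF f g _ y, where n = "Suc n"]) auto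
  have 1: "appl C (higher g (Suc (length Bs))) (map (\<lambda>z. p \<cdot> z) (map (faa_block f a x) Bs) @ [dirder t p (x \<cdot> f)]) (p \<cdot> (x \<cdot> f))
    = ?T (length Bs)"
    unfolding m dxf pxf by (simp add: faa_term_def extend_blocks_def)
  have 2: "msum C (L W) Z (\<lambda>i. appl C (higher g (length Bs)) ((map (\<lambda>z. p \<cdot> z) (map (faa_block f a x) Bs))[i := dirder t p (map (faa_block f a x) Bs ! i)]) (p \<cdot> (x \<cdot> f))) {..<length Bs}
    = msum C (L W) Z ?T {..<length Bs}"
  proof (rule msum_cong)
    fix i assume i: "i \<in> {..<length Bs}"
    then have "dirder t p (map (faa_block f a x) Bs ! i) = faa_block f b y (insert n (Bs ! i))"
      using db(1) by simp
    then show "appl C (higher g (length Bs)) ((map (\<lambda>z. p \<cdot> z) (map (faa_block f a x) Bs))[i := dirder t p (map (faa_block f a x) Bs ! i)]) (p \<cdot> (x \<cdot> f)) = ?T i"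
      unfolding m pxf using i by (simp add: faa_term_def extend_blocks_def map_update)
  qed (use T Ob in auto)
  show ?thesis
    unfolding faa_term_def[of f g a] dirder_appl_higher[OF g tp zs xf] 1 2 atMost_eq_insert_lessThan
    using T Ob by (intro msum_insert[symmetric]) auto
qed

text \<open>The induction starts at 1, where the only partition gives [CD.5]. For
  \<open>n = 0\<close> the values lie in \<open>W\<close>, where no addition is available.\<close>

theorem higher_comp:
  assumes f: "f \<in> Hom C X Y" and g: "g \<in> Hom C Y W" and n: "0 < n"
  shows "higher (f \<cdot> g) n = msum C (L W) (npow C (L0 X) n X)
     (faa_term f g (vproj C (L0 X) X n) (vproj C (L0 X) X n n)) (block_lists n)"
  using n
proof (induction n rule: nat_induct_non_zero)
  case 1
  have ty: "X \<in> Ob C" "Y \<in> Ob C" "W \<in> Ob C" "f \<in> Ar C" "g \<in> Ar C" "Dom C f = X" "Dom C g = Y" "Cod C f = Y" "Cod C g = W"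
    using f g by auto
  have "higher (f \<cdot> g) 1 = \<langle>D f, Pr1 C (L0 X) X \<cdot> f\<rangle> \<cdot> D g"
    using ty CD5[OF f g] by (simp add: dirder_def)
  moreover have eq: "faa_term f g (vproj C (L0 X) X 1) (vproj C (L0 X) X 1 1) [{0}] = \<langle>D f, Pr1 C (L0 X) X \<cdot> f\<rangle> \<cdot> D g"
    using ty by (simp add: faa_term_def faa_block_def dirder_def appl_tuple)
  moreover have "msum C (L W) (npow C (L0 X) 1 X) (faa_term f g (vproj C (L0 X) X 1) (vproj C (L0 X) X 1 1)) {[{0}]}
    = faa_term f g (vproj C (L0 X) X 1) (vproj C (L0 X) X 1 1) [{0}]"
    by (rule msum_singleton) (use eq ty in simp_all)
  ultimately show ?case
    by (simp add: block_lists_1 del: higher.simps vproj.simps npow.simps)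
next
  case (Suc n)
  let ?P = "npow C (L0 X) n X" and ?Q = "npow C (L0 X) (Suc n) X"
  let ?a = "vproj C (L0 X) X n" and ?b = "vproj C (L0 X) X (Suc n)"
  have Ob: "X \<in> Ob C" "Y \<in> Ob C" "W \<in> Ob C" using f g by auto
  have fg: "f \<cdot> g \<in> Hom C X W" using f g by simp
  \<comment> \<open>Direction and base point from the recursion for \<open>higher\<close>. The facts
    \<open>pa\<close>, \<open>px\<close>, \<open>da\<close> and \<open>dx\<close> are the hypotheses
    of \<open>dirder_faa_term\<close> for them.\<close>
  let ?\<tau> = "tuple (replicate n (mnull C (L X) ?Q)) (?b n)" and ?\<pi> = "tuple (map ?b [0..<n]) (?b (Suc n))"
  have z: "set (replicate n (mnull C (L X) ?Q)) \<subseteq> Hom C ?Q (L0 X)"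
    using Ob by (intro replicate_Hom) (simp del: npow.simps)
  have b: "?b n \<in> Hom C ?Q (L0 X)" "?b (Suc n) \<in> Hom C ?Q X" "set (map ?b [0..<n]) \<subseteq> Hom C ?Q (L0 X)"
    using Ob by (auto simp del: npow.simps vproj.simps)
  have tp: "tangent ?Q ?P ?\<tau> ?\<pi>"
    using z b Ob by (intro tangent_tuple) (auto simp del: npow.simps vproj.simps)
  have a: "?a i \<in> Hom C ?P (L0 X)" if "i < n" for i using that Ob by simp
  have x: "?a n \<in> Hom C ?P X" using Ob by simp
  have pa: "?\<pi> \<cdot> ?a i = ?b i" if "i < n" for i
    using tuple_vproj(1)[OF b(3,2) L0_Ob _ that] that Ob by (simp del: vproj.simps)
  have px: "?\<pi> \<cdot> ?a n = ?b (Suc n)"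
    using tuple_vproj(2)[OF b(3,2) L0_Ob] Ob by (simp del: vproj.simps)
  have da: "dirder ?\<tau> ?\<pi> (?a i) = mnull C (L X) ?Q" if "i < n" for i
    using dirder_vproj[OF tp _ _ less_imp_le[OF that]] tuple_vproj(1)[OF z b(1) L0_Ob _ that] that Ob by (simp del: vproj.simps)
  have dx: "dirder ?\<tau> ?\<pi> (?a n) = ?b n"
    using dirder_vproj[OF tp, of n] tuple_vproj(2)[OF z b(1) L0_Ob] Ob by (simp del: vproj.simps)
  let ?T = "faa_term f g ?b (?b (Suc n))"
  have T: "?T Bs \<in> Hom C ?Q (mcar (L W))" if "Bs \<in> block_lists (Suc n)" for Bs
    unfolding mcar_L using that Ob
    by (intro faa_term_Hom[OF f g _ b(2)]) (auto simp del: vproj.simps npow.simps)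
  have Text: "?T (extend_blocks n (Bs, i)) \<in> Hom C ?Q (mcar (L W))" if "Bs \<in> block_lists n" for Bs i
    using extend_blocks_in[OF that] by (rule T)
  have QOb: "?Q \<in> Ob C" using Ob by (simp del: npow.simps)
  have "higher (f \<cdot> g) (Suc n) = dirder ?\<tau> ?\<pi> (higher (f \<cdot> g) n)"
    by (rule higher_Suc[OF fg])
  also have "\<dots> = msum C (L W) ?Q (\<lambda>Bs. dirder ?\<tau> ?\<pi> (faa_term f g ?a (?a n) Bs)) (block_lists n)"
    unfolding Suc.IH
    using faa_term_Hom[OF f g a x _ Suc.hyps] Ob finite_block_lists by (intro dirder_msum[OF tp]) auto
  also have "\<dots> = msum C (L W) ?Q (\<lambda>Bs. msum C (L W) ?Q (\<lambda>i. ?T (extend_blocks n (Bs, i))) {..length Bs}) (block_lists n)"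
    using Ob QOb Text dirder_faa_term[where a = ?a and b = ?b, OF f g tp a x pa px da dx]
    by (intro msum_cong msum_Hom) auto
  also have "\<dots> = msum C (L W) ?Q (\<lambda>p. ?T (extend_blocks n p)) (SIGMA Bs:block_lists n. {..length Bs})"
    using Ob QOb Text finite_block_lists by (intro msum_Sigma[symmetric]) auto
  also have "\<dots> = msum C (L W) ?Q ?T (extend_blocks n ` (SIGMA Bs:block_lists n. {..length Bs}))"
    using Ob QOb Text inj_on_extend_blocks by (intro msum_reindex[symmetric]) auto
  finally show ?case by (simp only: extend_blocks_image)
qed

end

section \<open>How partial injections on r + 1 indices arise from those on r\<close>

section \<open>Partial injections\<close>

definition partial_injections :: "nat \<Rightarrow> nat \<Rightarrow> (nat set \<times> (nat \<Rightarrow> nat)) set" where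
  "partial_injections n r = {(S, \<phi>). S \<subseteq> {..<r} \<and> \<phi> \<in> S \<rightarrow>\<^sub>E {..<n} \<and> inj_on \<phi> S}"

lemma finite_partial_injections: "finite (partial_injections n r)"
proof (rule finite_subset)
  show "partial_injections n r \<subseteq> (SIGMA S:Pow {..<r}. S \<rightarrow>\<^sub>E {..<n})"
    by (auto simp: partial_injections_def)
  show "finite (SIGMA S:Pow {..<r}. S \<rightarrow>\<^sub>E {..<n})"
    by (auto intro!: finite_SigmaI finite_PiE intro: finite_subset)
qed

lemma partial_injections_0: "partial_injections n 0 = {({}, \<lambda>_. undefined)}"
  by (auto simp: partial_injections_def)

definition extend_injection :: "nat \<Rightarrow> (nat set \<times> (nat \<Rightarrow> nat)) \<times> nat \<Rightarrow> nat set \<times> (nat \<Rightarrow> nat)" where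
  "extend_injection r = (\<lambda>((S, \<phi>), i). (insert r S, \<phi>(r := i)))"

abbreviation missed :: "nat \<Rightarrow> nat set \<times> (nat \<Rightarrow> nat) \<Rightarrow> nat set" where
  "missed n \<equiv> \<lambda>(S, \<phi>). {..<n} - \<phi> ` S"

text \<open>Since \<open>r\<close> lies outside \<open>S\<close>, the function \<open>\<phi>\<close>
  is undefined there and hence can be recovered from \<open>\<phi>(r := i)\<close>.\<close>

lemma inj_on_extend_injection:
  "inj_on (extend_injection r) (Sigma (partial_injections n r) (missed n))"
proof (rule inj_onI, clarsimp simp: extend_injection_def partial_injections_def)
  fix S \<phi> i S' \<phi>' i'
  assume S: "S \<subseteq> {..<r}" "S' \<subseteq> {..<r}" and \<phi>: "\<phi> \<in> S \<rightarrow>\<^sub>E {..<n}" "\<phi>' \<in> S' \<rightarrow>\<^sub>E {..<n}"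
    and eq: "insert r S = insert r S'" "\<phi>(r := i) = \<phi>'(r := i')"
  have "r \<notin> S" "r \<notin> S'" using S by auto
  then have "S = S'" using eq(1) by (metis insert_ident)
  moreover have "i = i'" using fun_cong[OF eq(2), of r] by simp
  moreover have "\<phi> j = \<phi>' j" for j
    using fun_cong[OF eq(2), of j] PiE_arb[OF \<phi>(1) \<open>r \<notin> S\<close>] PiE_arb[OF \<phi>(2) \<open>r \<notin> S'\<close>] by (cases "j = r") auto
  ultimately show "S = S' \<and> \<phi> = \<phi>' \<and> i = i'" by auto
qed

lemma partial_injections_Suc:
  "partial_injections n (Suc r)
    = partial_injections n r \<union> extend_injection r ` Sigma (partial_injections n r) (missed n)"
proof (intro equalityI subsetI)
  fix p assume "p \<in> partial_injections n (Suc r)"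
  then obtain S \<phi> where p: "p = (S, \<phi>)" "S \<subseteq> {..<Suc r}" "\<phi> \<in> S \<rightarrow>\<^sub>E {..<n}" "inj_on \<phi> S"
    by (auto simp: partial_injections_def)
  show "p \<in> partial_injections n r \<union> extend_injection r ` Sigma (partial_injections n r) (missed n)"
  proof (cases "r \<in> S")
    case False
    then have "S \<subseteq> {..<r}" using p(2) by (auto simp: less_Suc_eq)
    then show ?thesis using p by (auto simp: partial_injections_def)
  next
    case True
    \<comment> \<open>Forgetting the value at \<open>r\<close> has to make the function undefined
      there, as the extensional function space demands.\<close>
    let ?T = "S - {r}" and ?\<psi> = "restrict \<phi> (S - {r})"
    have "(?T, ?\<psi>) \<in> partial_injections n r"
      using p by (auto simp: partial_injections_def less_Suc_eq intro: inj_on_diff)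
    moreover have "\<phi> r \<in> missed n (?T, ?\<psi>)"
      using p True by (auto simp: inj_on_def)
    moreover have "extend_injection r ((?T, ?\<psi>), \<phi> r) = p"
      using p True by (auto simp: extend_injection_def PiE_def extensional_def)
    ultimately show ?thesis by (intro UnI2 image_eqI[where x = "((?T, ?\<psi>), \<phi> r)"]) auto
  qed
next
  fix p assume "p \<in> partial_injections n r \<union> extend_injection r ` Sigma (partial_injections n r) (missed n)"
  then show "p \<in> partial_injections n (Suc r)"
  proof
    assume "p \<in> partial_injections n r"
    then show ?thesis by (auto simp: partial_injections_def less_Suc_eq)
  next
    assume "p \<in> extend_injection r ` Sigma (partial_injections n r) (missed n)"
    then obtain S \<phi> i where p: "p = (insert r S, \<phi>(r := i))" "S \<subseteq> {..<r}" "\<phi> \<in> S \<rightarrow>\<^sub>E {..<n}" "inj_on \<phi> S"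
        "i < n" "i \<notin> \<phi> ` S"
      by (auto simp: partial_injections_def extend_injection_def)
    have r: "r \<notin> S" using p(2) by auto
    have "\<phi>(r := i) \<in> insert r S \<rightarrow>\<^sub>E {..<n}" using p(3,5) by (auto simp: PiE_def extensional_def)
    moreover have "inj_on (\<phi>(r := i)) (insert r S)" using p(4,6) r by (auto simp: inj_on_def)
    ultimately show ?thesis using p(1,2) by (auto simp: partial_injections_def less_Suc_eq)
  qed
qed

lemma partial_injections_disjoint:
  "partial_injections n r \<inter> extend_injection r ` Sigma (partial_injections n r) (missed n) = {}"
  by (auto simp: partial_injections_def extend_injection_def)

text \<open>The argument list in \<open>delta_comp\<close>, with the projections abstracted so that
  lists for \<open>r\<close> and \<open>Suc r\<close> can be compared.\<close>

definition delta_args :: "nat \<Rightarrow> nat \<Rightarrow> (nat \<Rightarrow> nat \<Rightarrow> 'm) \<Rightarrow> (nat \<Rightarrow> 'm) \<Rightarrow> (nat \<Rightarrow> 'm)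
    \<Rightarrow> nat set \<times> (nat \<Rightarrow> nat) \<Rightarrow> 'm list" where
  "delta_args n r v w a = (\<lambda>(S, \<phi>). map (\<lambda>i. if i \<in> \<phi> ` S then v (the_inv_into S \<phi> i) i else a i) [0..<n]
      @ map w (sorted_list_of_set ({..<r} - S)))"

lemma length_delta_args:
  assumes "p \<in> partial_injections n r"
  shows "length (delta_args n r v w a p) = n + r - card (fst p)"
proof -
  obtain S \<phi> where p: "p = (S, \<phi>)" "S \<subseteq> {..<r}" using assms by (auto simp: partial_injections_def)
  then have "card ({..<r} - S) = r - card S" "card S \<le> r"
    using card_mono[of "{..<r}" S] by (auto simp: card_Diff_subset finite_subset)
  then show ?thesis using p by (simp add: delta_args_def)
qed

lemma map_delta_args:
  assumes "p \<in> partial_injections n r"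
    "\<And>j i. j < r \<Longrightarrow> i < n \<Longrightarrow> h (v j i) = v' j i" "\<And>j. j < r \<Longrightarrow> h (w j) = w' j"
    "\<And>i. i < n \<Longrightarrow> h (a i) = a' i"
  shows "map h (delta_args n r v w a p) = delta_args n r v' w' a' p"
proof -
  obtain S \<phi> where p: "p = (S, \<phi>)" "S \<subseteq> {..<r}" "inj_on \<phi> S" using assms by (auto simp: partial_injections_def)
  have "the_inv_into S \<phi> i < r" if "i \<in> \<phi> ` S" for i
    using the_inv_into_into[OF p(3) that subset_refl] p(2) by auto
  then show ?thesis using p(1) assms(2-) by (auto simp: delta_args_def)
qed

text \<open>The index \<open>r\<close> exceeds all others outside \<open>S\<close>, so its variable
  comes last in the increasing enumeration.\<close>

lemma delta_args_Suc:
  assumes "p \<in> partial_injections n r"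
  shows "delta_args n (Suc r) v w a p = delta_args n r v w a p @ [w r]"
proof -
  obtain S \<phi> where p: "p = (S, \<phi>)" "S \<subseteq> {..<r}" using assms by (auto simp: partial_injections_def)
  have "{..<Suc r} - S = insert r ({..<r} - S)" using p(2) by auto
  then have "sorted_list_of_set ({..<Suc r} - S) = sorted_list_of_set ({..<r} - S) @ [r]"
    by (simp only:) (rule sorted_list_of_set_insert_max, auto)
  then show ?thesis using p(1) by (simp add: delta_args_def)
qed

text \<open>On the old values the inverse of \<open>\<phi>(r := i)\<close> agrees with that of
  \<open>\<phi>\<close>, so the first \<open>n\<close> entries change only at \<open>i\<close>; the
  indices in the tail stay the same, as \<open>r\<close> now belongs to the domain.\<close>

lemma delta_args_extend:
  assumes "p \<in> partial_injections n r" "i \<in> missed n p"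
  shows "delta_args n (Suc r) v w a (extend_injection r (p, i)) = (delta_args n r v w a p)[i := v r i]"
proof -
  obtain S \<phi> where p: "p = (S, \<phi>)" "S \<subseteq> {..<r}" "\<phi> \<in> S \<rightarrow>\<^sub>E {..<n}" "inj_on \<phi> S"
    using assms by (auto simp: partial_injections_def)
  have i: "i < n" "i \<notin> \<phi> ` S" using assms(2) p(1) by auto
  have r: "r \<notin> S" using p(2) by auto
  have inj: "inj_on (\<phi>(r := i)) (insert r S)" using p(4) i r by (auto simp: inj_on_def)
  have img: "(\<phi>(r := i)) ` insert r S = insert i (\<phi> ` S)" using r by auto
  have inv_i: "the_inv_into (insert r S) (\<phi>(r := i)) i = r"
    using the_inv_into_f_eq[OF inj, of r i] by simp
  have inv_S: "the_inv_into (insert r S) (\<phi>(r := i)) k = the_inv_into S \<phi> k" if k: "k \<in> \<phi> ` S" for k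
  proof -
    obtain j where j: "j \<in> S" "k = \<phi> j" using k by auto
    then have "the_inv_into (insert r S) (\<phi>(r := i)) k = j"
      using r by (intro the_inv_into_f_eq[OF inj]) auto
    then show ?thesis using the_inv_into_f_f[OF p(4) j(1)] j(2) by simp
  qed
  have "{..<Suc r} - insert r S = {..<r} - S" by auto
  moreover have "map (\<lambda>k. if k \<in> insert i (\<phi> ` S) then v (the_inv_into (insert r S) (\<phi>(r := i)) k) k else a k) [0..<n]
    = (map (\<lambda>k. if k \<in> \<phi> ` S then v (the_inv_into S \<phi> k) k else a k) [0..<n])[i := v r i]"
    using i inv_i inv_S by (intro nth_equalityI) (auto simp: nth_list_update)
  ultimately show ?thesis
    using i unfolding p(1) delta_args_def extend_injection_def prod.case img by (simp add: list_update_append)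
qed

text \<open>Identifies the positions that contribute nothing in \<open>dirder_delta_term\<close>:
  there the variables \<open>v j i\<close> and \<open>w j\<close> with \<open>j < r\<close> have
  derivative zero.\<close>

lemma nth_delta_args:
  assumes "p \<in> partial_injections n r" "i < n + r - card (fst p)" "i \<notin> missed n p"
  shows "\<exists>j<r. (i < n \<and> delta_args n r v w a p ! i = v j i) \<or> delta_args n r v w a p ! i = w j"
proof -
  obtain S \<phi> where p: "p = (S, \<phi>)" "S \<subseteq> {..<r}" "inj_on \<phi> S"
    using assms by (auto simp: partial_injections_def)
  show ?thesis
  proof (cases "i < n")
    case True
    then have i: "i \<in> \<phi> ` S" using assms(3) p(1) by auto
    then have "the_inv_into S \<phi> i < r" using the_inv_into_into[OF p(3) i subset_refl] p(2) by auto
    then show ?thesis using True i p(1) by (auto simp: delta_args_def nth_append)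
  next
    case False
    let ?l = "sorted_list_of_set ({..<r} - S)"
    have "i - n < length ?l"
      using False assms(2) length_delta_args[OF assms(1), of v w a] p(1) by (auto simp: delta_args_def)
    then have "?l ! (i - n) \<in> set ?l" "delta_args n r v w a p ! i = w (?l ! (i - n))"
      using False p(1) by (simp_all add: delta_args_def nth_append del: set_sorted_list_of_set)
    then show ?thesis by auto
  qed
qed

lemma delta_args_nth_missed:
  "i \<in> missed n p \<Longrightarrow> delta_args n r v w a p ! i = a i"
  by (auto simp: delta_args_def nth_append)

lemma set_delta_args:
  assumes "p \<in> partial_injections n r"
    "\<And>j i. j < r \<Longrightarrow> i < n \<Longrightarrow> v j i \<in> U" "\<And>j. j < r \<Longrightarrow> w j \<in> U" "\<And>i. i < n \<Longrightarrow> a i \<in> U"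
  shows "set (delta_args n r v w a p) \<subseteq> U"
proof -
  obtain S \<phi> where p: "p = (S, \<phi>)" "S \<subseteq> {..<r}" "inj_on \<phi> S" using assms by (auto simp: partial_injections_def)
  have "the_inv_into S \<phi> i < r" if "i \<in> \<phi> ` S" for i
    using the_inv_into_into[OF p(3) that subset_refl] p(2) by auto
  then show ?thesis using p(1) assms(2-) by (auto simp: delta_args_def)
qed

section \<open>The components of the comultiplication as iterated higher derivatives\<close>

section \<open>Higher derivatives of higher derivatives\<close>

lemma card_partial_injection:
  assumes "q \<in> partial_injections n r"
  shows "card (fst q) \<le> r" "i \<in> missed n q \<Longrightarrow> card (fst (extend_injection r (q, i))) = Suc (card (fst q))"
proof -
  obtain S \<phi> where q: "q = (S, \<phi>)" "S \<subseteq> {..<r}" using assms by (auto simp: partial_injections_def)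
  then have "finite S" "r \<notin> S" by (auto intro: finite_subset)
  then show "card (fst q) \<le> r" "i \<in> missed n q \<Longrightarrow> card (fst (extend_injection r (q, i))) = Suc (card (fst q))"
    using q card_mono[of "{..<r}" S] by (auto simp: extend_injection_def)
qed

lemma missed_subset: "missed n q \<subseteq> {..<n}"
  by (cases q) auto

context generalized_cartesian_differential_structure
begin

definition delta_term :: "'m \<Rightarrow> nat \<Rightarrow> nat \<Rightarrow> (nat \<Rightarrow> nat \<Rightarrow> 'm) \<Rightarrow> (nat \<Rightarrow> 'm) \<Rightarrow> (nat \<Rightarrow> 'm) \<Rightarrow> 'm
    \<Rightarrow> nat set \<times> (nat \<Rightarrow> nat) \<Rightarrow> 'm" where
  "delta_term f n r v w a x q = appl C (higher f (n + r - card (fst q))) (delta_args n r v w a q) x"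

lemma delta_term_Hom:
  assumes f: "f \<in> Hom C X Y" and n: "0 < n" and q: "q \<in> partial_injections n r"
    and v: "\<And>j i. j < r \<Longrightarrow> i < n \<Longrightarrow> v j i \<in> Hom C Z (L0 X)" and w: "\<And>j. j < r \<Longrightarrow> w j \<in> Hom C Z (L0 X)"
    and a: "\<And>i. i < n \<Longrightarrow> a i \<in> Hom C Z (L0 X)" and x: "x \<in> Hom C Z X"
  shows "delta_term f n r v w a x q \<in> Hom C Z (L0 Y)"
  using appl_higher_Hom[OF f set_delta_args[OF q v w a] x length_delta_args[OF q]] n card_partial_injection(1)[OF q]
  by (simp add: delta_term_def split: if_splits)

text \<open>Again the hypotheses describe the tangent vector in the recursion for
  \<open>higher\<close>: the variables with \<open>j < r\<close> have zero derivative, while the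
  arguments \<open>a\<close> and the point \<open>x\<close> move in the directions
  \<open>v' r\<close> and \<open>w' r\<close>. The motion of \<open>x\<close> appends
  \<open>w' r\<close>, which leaves \<open>r\<close> outside the domain; the motion of
  \<open>a i\<close> puts \<open>v' r i\<close> at a missed position \<open>i\<close>, which sends
  \<open>r\<close> to \<open>i\<close>.\<close>

lemma dirder_delta_term:
  assumes f: "f \<in> Hom C X Y" and n: "0 < n" and tp: "tangent Z P t p" and q: "q \<in> partial_injections n r"
    and v: "\<And>j i. j < r \<Longrightarrow> i < n \<Longrightarrow> v j i \<in> Hom C P (L0 X)" and w: "\<And>j. j < r \<Longrightarrow> w j \<in> Hom C P (L0 X)"
    and a: "\<And>i. i < n \<Longrightarrow> a i \<in> Hom C P (L0 X)" and x: "x \<in> Hom C P X"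
    and p: "\<And>j i. j < r \<Longrightarrow> i < n \<Longrightarrow> p \<cdot> v j i = v' j i" "\<And>j. j < r \<Longrightarrow> p \<cdot> w j = w' j"
      "\<And>i. i < n \<Longrightarrow> p \<cdot> a i = a' i" "p \<cdot> x = x'"
    and d: "\<And>j i. j < r \<Longrightarrow> i < n \<Longrightarrow> dirder t p (v j i) = mnull C (L X) Z"
      "\<And>j. j < r \<Longrightarrow> dirder t p (w j) = mnull C (L X) Z"
      "\<And>i. i < n \<Longrightarrow> dirder t p (a i) = v' r i" "dirder t p x = w' r"
  shows "dirder t p (delta_term f n r v w a x q)
    = madd C (L Y) (delta_term f n (Suc r) v' w' a' x' q)
       (msum C (L Y) Z (\<lambda>i. delta_term f n (Suc r) v' w' a' x' (extend_injection r (q, i))) (missed n q))"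
proof -
  let ?m = "n + r - card (fst q)"
  let ?zs = "delta_args n r v w a q" and ?zs' = "delta_args n r v' w' a' q"
  have ty: "t \<in> Hom C Z (L0 P)" "p \<in> Hom C Z P" using tp by (auto simp: tangent_def)
  have Ob: "Z \<in> Ob C" "X \<in> Ob C" "Y \<in> Ob C" using f ty by auto
  have x': "x' \<in> Hom C Z X" using ty x p(4)[symmetric] by simp
  have zs: "set ?zs \<subseteq> Hom C P (L0 X)" "length ?zs = ?m"
    using set_delta_args[where v = v and w = w and a = a, OF q v w a] length_delta_args[OF q] by blast+
  have m: "map (\<lambda>z. p \<cdot> z) ?zs = ?zs'"
    by (rule map_delta_args[OF q]; rule p; assumption)
  have zs': "set ?zs' \<subseteq> Hom C Z (L0 X)" "length ?zs' = ?m"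
    using map_comp_Hom[OF zs(1) ty(2)] length_delta_args[OF q] unfolding m by blast+
  have card: "card (fst q) \<le> r" using q by (rule card_partial_injection)
  have 1: "appl C (higher f (Suc ?m)) (?zs' @ [w' r]) x' = delta_term f n (Suc r) v' w' a' x' q"
    using card by (simp add: delta_term_def delta_args_Suc[OF q] Suc_diff_le del: higher.simps)
  have 2: "appl C (higher f ?m) (?zs'[i := dirder t p (?zs ! i)]) x'
     = delta_term f n (Suc r) v' w' a' x' (extend_injection r (q, i))" if i: "i \<in> missed n q" for i
  proof -
    have "i < n" using i missed_subset by blast
    then have "dirder t p (?zs ! i) = v' r i" using delta_args_nth_missed[OF i, of r v w a] d(3) by simp
    then show ?thesis
      using card_partial_injection(2)[OF q i]
      by (simp add: delta_term_def delta_args_extend[OF q i])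
  qed
  have 3: "appl C (higher f ?m) (?zs'[i := dirder t p (?zs ! i)]) x' = mnull C (L Y) Z" if i: "i < ?m" "i \<notin> missed n q" for i
  proof -
    have "dirder t p (?zs ! i) = mnull C (L X) Z"
      using nth_delta_args[OF q i, of v w a] d(1,2) by auto
    then show ?thesis using appl_higher_multiadditive(2)[OF f zs' x' i(1)] by simp
  qed
  have "msum C (L Y) Z (\<lambda>i. appl C (higher f ?m) (?zs'[i := dirder t p (?zs ! i)]) x') {..<?m}
    = msum C (L Y) Z (\<lambda>i. appl C (higher f ?m) (?zs'[i := dirder t p (?zs ! i)]) x') (missed n q)"
  proof (rule msum_mono_neutral)
    show "missed n q \<subseteq> {..<?m}" using missed_subset[of n q] card by auto
    show "appl C (higher f ?m) (?zs'[i := dirder t p (?zs ! i)]) x' \<in> Hom C Z (mcar (L Y))" if i: "i \<in> missed n q" for i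
    proof -
      have "dirder t p (?zs ! i) \<in> Hom C Z (L0 X)"
        using delta_args_nth_missed[OF i, of r v w a] i missed_subset[of n q] a[of i] ty Ob by auto
      then have "set (?zs'[i := dirder t p (?zs ! i)]) \<subseteq> Hom C Z (L0 X)"
        using zs'(1) set_update_subset_insert by fast
      from appl_higher_Hom[OF f this x', of ?m] show ?thesis using zs'(2) n card by (simp split: if_splits)
    qed
  qed (use 3 Ob in auto)
  also have "\<dots> = msum C (L Y) Z (\<lambda>i. delta_term f n (Suc r) v' w' a' x' (extend_injection r (q, i))) (missed n q)"
  proof (rule msum_cong[OF _ _ refl 2])
    show "delta_term f n (Suc r) v' w' a' x' (extend_injection r (q, i)) \<in> Hom C Z (mcar (L Y))" if i: "i \<in> missed n q" for i
      unfolding mcar_L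
    proof (rule delta_term_Hom[OF f n _ _ _ _ x'])
      show "extend_injection r (q, i) \<in> partial_injections n (Suc r)"
        using q i unfolding partial_injections_Suc by (intro UnI2 imageI SigmaI)
      show "v' j k \<in> Hom C Z (L0 X)" if "j < Suc r" "k < n" for j k
        using that ty v[of j k] p(1)[of j k, symmetric] a[of k] d(3)[of k, symmetric] Ob by (cases "j = r") auto
      show "w' j \<in> Hom C Z (L0 X)" if "j < Suc r" for j
        using that ty w[of j] p(2)[of j, symmetric] x d(4)[symmetric] Ob by (cases "j = r") auto
      show "a' k \<in> Hom C Z (L0 X)" if "k < n" for k
        using that ty a[of k] p(3)[of k, symmetric] by auto
    qed
  qed (use Ob in auto)
  finally show ?thesis
    unfolding delta_term_def[of f n r] dirder_appl_higher[OF f tp zs x] m p(4) d(4) 1 by simp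
qed

text \<open>As \<open>0 < n\<close>, the values of \<open>higher f n\<close> already lie in the
  monoid, so the induction can start at \<open>r = 0\<close>: only the empty injection remains, and
  its term is \<open>higher f n\<close> at the generic point.\<close>

theorem higher_higher:
  fixes X n
  defines "V \<equiv> npow C (L0 X) n (L0 X)" and "W \<equiv> npow C (L0 X) n X"
  assumes f: "f \<in> Hom C X Y" and n: "0 < n"
  shows "higher (higher f n) r = msum C (L Y) (npow C V r W)
     (delta_term f n r (\<lambda>j i. vproj C V W r j \<cdot> vproj C (L0 X) (L0 X) n i) (\<lambda>j. vproj C V W r j \<cdot> vproj C (L0 X) (L0 X) n n)
       (\<lambda>i. vproj C V W r r \<cdot> vproj C (L0 X) X n i) (vproj C V W r r \<cdot> vproj C (L0 X) X n n))
     (partial_injections n r)"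
proof (induction r)
  case 0
  have Ob: "X \<in> Ob C" "Y \<in> Ob C" using f by auto
  have h: "higher f n \<in> Hom C W (L0 Y)" using higher_Hom[OF f, of n] n by (simp add: W_def)
  have W: "W \<in> Ob C" using Ob by (simp add: W_def)
  have "delta_term f n 0 v w (\<lambda>i. Id C W \<cdot> vproj C (L0 X) X n i) (Id C W \<cdot> vproj C (L0 X) X n n) ({}, \<lambda>_. undefined) = higher f n" for v w
  proof -
    have eq: "map (\<lambda>i. Id C W \<cdot> vproj C (L0 X) X n i) [0..<n] = vprojs (L0 X) X n" "Id C W \<cdot> vproj C (L0 X) X n n = vproj C (L0 X) X n n"
      using Ob by (simp_all add: W_def)
    have "delta_term f n 0 v w (\<lambda>i. Id C W \<cdot> vproj C (L0 X) X n i) (Id C W \<cdot> vproj C (L0 X) X n n) ({}, \<lambda>_. undefined)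
      = appl C (higher f n) (map (\<lambda>i. Id C W \<cdot> vproj C (L0 X) X n i) [0..<n]) (Id C W \<cdot> vproj C (L0 X) X n n)"
      by (simp add: delta_term_def delta_args_def del: Id_comp)
    also have "\<dots> = higher f n"
      unfolding eq using h Ob by (intro appl_vprojs) (auto simp: W_def)
    finally show ?thesis .
  qed
  then show ?case
    using Ob h W by (simp add: partial_injections_0 msum_singleton)
next
  case (Suc r)
  let ?A = "L0 X"
  let ?P = "npow C V r W" and ?Q = "npow C V (Suc r) W"
  let ?a = "vproj C V W r" and ?b = "vproj C V W (Suc r)"
  let ?k = "vproj C ?A ?A n" and ?l = "vproj C ?A X n"
  have Ob: "X \<in> Ob C" "Y \<in> Ob C" "V \<in> Ob C" "W \<in> Ob C" using f by (auto simp: V_def W_def)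
  \<comment> \<open>A direction in \<open>W\<close> has \<open>n + 1\<close> coordinates in
    \<open>L0 X\<close>, one for each argument and one for the point; hence the variables of index
    \<open>j < r\<close> range over \<open>V\<close>.\<close>
  have L0V: "L0 V = V" "L0 W = V" using Ob by (simp_all add: V_def W_def)
  have h: "higher f n \<in> Hom C W (L0 Y)" using higher_Hom[OF f, of n] n by (simp add: W_def)
  let ?\<tau> = "tuple (replicate r (mnull C (L W) ?Q)) (?b r)" and ?\<pi> = "tuple (map ?b [0..<r]) (?b (Suc r))"
  have QOb: "?Q \<in> Ob C" using Ob by (simp del: npow.simps)
  have z: "set (replicate r (mnull C (L W) ?Q)) \<subseteq> Hom C ?Q V"
    using Ob QOb L0V by (intro replicate_Hom) (simp del: npow.simps)
  have b: "?b r \<in> Hom C ?Q V" "?b (Suc r) \<in> Hom C ?Q W" "set (map ?b [0..<r]) \<subseteq> Hom C ?Q V"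
    using Ob by (auto simp del: npow.simps vproj.simps)
  have tp: "tangent ?Q ?P ?\<tau> ?\<pi>"
    using z b Ob L0V by (intro tangent_tuple) (auto simp del: npow.simps vproj.simps)
  have pa: "?\<pi> \<cdot> ?a j = ?b j" if "j < r" for j
    using tuple_vproj(1)[OF b(3,2) Ob(3) _ that] that by (simp del: vproj.simps)
  have px: "?\<pi> \<cdot> ?a r = ?b (Suc r)"
    using tuple_vproj(2)[OF b(3,2) Ob(3)] by (simp del: vproj.simps)
  have da: "dirder ?\<tau> ?\<pi> (?a j) = mnull C (L W) ?Q" if "j < r" for j
    using dirder_vproj[OF tp Ob(3,4) less_imp_le[OF that]] tuple_vproj(1)[OF z b(1) Ob(3) _ that] that L0V by (simp del: vproj.simps)
  have dx: "dirder ?\<tau> ?\<pi> (?a r) = ?b r"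
    using dirder_vproj[OF tp Ob(3,4), of r] tuple_vproj(2)[OF z b(1) Ob(3)] L0V by (simp del: vproj.simps)
  have k: "?k i \<in> Hom C V ?A" if "i \<le> n" for i using that Ob by (simp add: V_def)
  have l: "?l i \<in> Hom C W ?A" if "i < n" for i using that Ob by (simp add: W_def)
  have ln: "?l n \<in> Hom C W X" using Ob by (simp add: W_def)
  have av: "?a j \<in> Hom C ?P V" if "j < r" for j using that Ob by simp
  have aw: "?a r \<in> Hom C ?P W" using Ob by simp
  have \<pi>: "?\<pi> \<in> Hom C ?Q ?P" using tp by (simp add: tangent_def)
  have pv: "?\<pi> \<cdot> (?a j \<cdot> ?k i) = ?b j \<cdot> ?k i" if "j < r" "i \<le> n" for i j
    using Comp_assoc[OF \<pi> av[OF that(1)] k[OF that(2)]] pa[OF that(1)] by simp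
  have pl: "?\<pi> \<cdot> (?a r \<cdot> ?l i) = ?b (Suc r) \<cdot> ?l i" if "i < n" for i
    using Comp_assoc[OF \<pi> aw l[OF that]] px by simp
  have pln: "?\<pi> \<cdot> (?a r \<cdot> ?l n) = ?b (Suc r) \<cdot> ?l n"
    using Comp_assoc[OF \<pi> aw ln] px by simp
  have dv: "dirder ?\<tau> ?\<pi> (?a j \<cdot> ?k i) = mnull C (L X) ?Q" if "j < r" "i \<le> n" for i j
  proof -
    have bj: "?b j \<in> Hom C ?Q V" using that Ob by (simp del: vproj.simps npow.simps)
    have LV: "L W = L V" using L_L0[OF Ob(4)] L0V by simp
    have "dirder ?\<tau> ?\<pi> (?a j \<cdot> ?k i) = dirder (dirder ?\<tau> ?\<pi> (?a j)) (?\<pi> \<cdot> ?a j) (?k i)"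
      by (rule dirder_comp[OF tp av[OF that(1)] k[OF that(2)]])
    also have "\<dots> = dirder (mnull C (L W) ?Q) (?b j) (?k i)"
      by (simp only: da[OF that(1)] pa[OF that(1)])
    also have "\<dots> = mnull C (L ?A) ?Q"
      unfolding LV by (rule dirder_zero[OF bj k[OF that(2)]])
    finally show ?thesis using Ob by simp
  qed
  \<comment> \<open>The free codomain \<open>S\<close> lets one statement cover the arguments, with
    values in \<open>L0 X\<close>, and the last coordinate, with values in \<open>X\<close>.\<close>
  have dl: "dirder ?\<tau> ?\<pi> (?a r \<cdot> ?l i) = ?b r \<cdot> ?k i" if "i \<le> n" "?l i \<in> Hom C W S" for i S
  proof -
    have "tangent ?Q W (?b r) (?b (Suc r))" using b L0V by (simp add: tangent_def)
    then have "tangent ?Q (npow C ?A n X) (?b r) (?b (Suc r))" by (simp add: W_def)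
    from dirder_vproj[OF this _ Ob(1) that(1)] dirder_comp[OF tp aw that(2)] Ob show ?thesis
      unfolding dx px by simp
  qed
  define v w a x where "v = (\<lambda>j i. ?a j \<cdot> ?k i)" and "w = (\<lambda>j. ?a j \<cdot> ?k n)" and "a = (\<lambda>i. ?a r \<cdot> ?l i)" and "x = ?a r \<cdot> ?l n"
  define v' w' a' x' where "v' = (\<lambda>j i. ?b j \<cdot> ?k i)" and "w' = (\<lambda>j. ?b j \<cdot> ?k n)" and "a' = (\<lambda>i. ?b (Suc r) \<cdot> ?l i)" and "x' = ?b (Suc r) \<cdot> ?l n"
  have ty: "v j i \<in> Hom C ?P ?A" "w j \<in> Hom C ?P ?A" "a i \<in> Hom C ?P ?A" "x \<in> Hom C ?P X" if "j < r" "i < n" for j i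
    unfolding v_def w_def a_def x_def using that av[OF that(1)] aw k[of i] k[of n] l[of i] ln by (auto intro: Comp_Hom simp del: Hom_iff)
  have vty: "v j i \<in> Hom C ?P ?A" "w j \<in> Hom C ?P ?A" if "j < r" "i < n" for j i
    using ty[OF that] by blast+
  have wty: "w j \<in> Hom C ?P ?A" if "j < r" for j using ty(2)[OF that n] .
  have aty: "a i \<in> Hom C ?P ?A" if "i < n" for i unfolding a_def using aw l[OF that] by (rule Comp_Hom)
  have xty: "x \<in> Hom C ?P X" unfolding x_def using aw ln by (rule Comp_Hom)
  have bty: "?b j \<in> Hom C ?Q V" if "j < Suc r" for j using that Ob by (simp del: vproj.simps npow.simps)
  have v'ty: "v' j i \<in> Hom C ?Q ?A" if "j < Suc r" "i < n" for j i
    unfolding v'_def using bty[OF that(1)] k[OF less_imp_le[OF that(2)]] by (rule Comp_Hom)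
  have w'ty: "w' j \<in> Hom C ?Q ?A" if "j < Suc r" for j
    unfolding w'_def using bty[OF that] k[OF order_refl] by (rule Comp_Hom)
  have a'ty: "a' i \<in> Hom C ?Q ?A" if "i < n" for i unfolding a'_def using b(2) l[OF that] by (rule Comp_Hom)
  have x'ty: "x' \<in> Hom C ?Q X" unfolding x'_def using b(2) ln by (rule Comp_Hom)
  let ?T = "delta_term f n (Suc r) v' w' a' x'"
  have T: "?T q \<in> Hom C ?Q (mcar (L Y))" if "q \<in> partial_injections n (Suc r)" for q
    unfolding mcar_L by (rule delta_term_Hom[OF f n that v'ty w'ty a'ty x'ty])
  have dT: "dirder ?\<tau> ?\<pi> (delta_term f n r v w a x q)
     = madd C (L Y) (?T q) (msum C (L Y) ?Q (\<lambda>i. ?T (extend_injection r (q, i))) (missed n q))"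
    if q: "q \<in> partial_injections n r" for q
  proof (rule dirder_delta_term[OF f n tp q vty(1) wty aty xty])
    show "?\<pi> \<cdot> v j i = v' j i" "dirder ?\<tau> ?\<pi> (v j i) = mnull C (L X) ?Q" if "j < r" "i < n" for j i
      unfolding v_def v'_def using pv dv that by simp_all
    show "?\<pi> \<cdot> w j = w' j" "dirder ?\<tau> ?\<pi> (w j) = mnull C (L X) ?Q" if "j < r" for j
      unfolding w_def w'_def using pv dv that by simp_all
    show "?\<pi> \<cdot> a i = a' i" "dirder ?\<tau> ?\<pi> (a i) = v' r i" if "i < n" for i
      unfolding a_def a'_def v'_def using pl dl[OF _ l] that by simp_all
    show "?\<pi> \<cdot> x = x'" "dirder ?\<tau> ?\<pi> x = w' r"
      unfolding x_def x'_def w'_def using pln dl[OF _ ln] by simp_all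
  qed
  have ext: "extend_injection r (q, i) \<in> partial_injections n (Suc r)" if "q \<in> partial_injections n r" "i \<in> missed n q" for q i
    using that unfolding partial_injections_Suc by (intro UnI2 imageI SigmaI)
  have sub: "q \<in> partial_injections n (Suc r)" if "q \<in> partial_injections n r" for q
    using that unfolding partial_injections_Suc by (rule UnI1)
  have finm: "finite (missed n q)" for q using missed_subset[of n q] by (rule finite_subset) simp
  have LY: "commutative_monoid_in C (L Y)" using Ob by simp
  have "higher (higher f n) (Suc r) = dirder ?\<tau> ?\<pi> (higher (higher f n) r)"
    using higher_Suc[OF h, of r] L0V by simp
  also have "\<dots> = msum C (L Y) ?Q (\<lambda>q. dirder ?\<tau> ?\<pi> (delta_term f n r v w a x q)) (partial_injections n r)"
    unfolding Suc.IH v_def[symmetric] w_def[symmetric] a_def[symmetric] x_def[symmetric]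
    by (rule dirder_msum[OF tp Ob(2) finite_partial_injections]) (rule delta_term_Hom[OF f n _ vty(1) wty aty xty])
  also have "\<dots> = msum C (L Y) ?Q (\<lambda>q. madd C (L Y) (?T q) (msum C (L Y) ?Q (\<lambda>i. ?T (extend_injection r (q, i))) (missed n q))) (partial_injections n r)"
  proof (rule msum_cong[OF LY QOb refl dT])
    fix q assume q: "q \<in> partial_injections n r"
    then have "?T q \<in> Hom C ?Q (mcar (L Y))" "msum C (L Y) ?Q (\<lambda>i. ?T (extend_injection r (q, i))) (missed n q) \<in> Hom C ?Q (mcar (L Y))"
      by (rule T[OF sub], intro msum_Hom[OF LY QOb] T ext)
    then show "madd C (L Y) (?T q) (msum C (L Y) ?Q (\<lambda>i. ?T (extend_injection r (q, i))) (missed n q)) \<in> Hom C ?Q (mcar (L Y))"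
      using LY by simp
  qed
  also have "\<dots> = madd C (L Y) (msum C (L Y) ?Q ?T (partial_injections n r))
      (msum C (L Y) ?Q (\<lambda>q. msum C (L Y) ?Q (\<lambda>i. ?T (extend_injection r (q, i))) (missed n q)) (partial_injections n r))"
    by (intro msum_madd[OF LY QOb] T sub msum_Hom[OF LY QOb] ext)
  also have "msum C (L Y) ?Q (\<lambda>q. msum C (L Y) ?Q (\<lambda>i. ?T (extend_injection r (q, i))) (missed n q)) (partial_injections n r)
     = msum C (L Y) ?Q (\<lambda>p. ?T (extend_injection r p)) (Sigma (partial_injections n r) (missed n))"
    by (intro msum_Sigma[OF LY QOb, symmetric] finite_partial_injections finm T ext)
  also have "\<dots> = msum C (L Y) ?Q ?T (extend_injection r ` Sigma (partial_injections n r) (missed n))"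
  proof (rule msum_reindex[OF LY QOb, symmetric, OF inj_on_extend_injection])
    fix p assume "p \<in> Sigma (partial_injections n r) (missed n)"
    then obtain q i where p: "p = (q, i)" "q \<in> partial_injections n r" "i \<in> missed n q" by (rule SigmaE)
    show "?T (extend_injection r p) \<in> Hom C ?Q (mcar (L Y))"
      unfolding p(1) by (rule T[OF ext[OF p(2,3)]])
  qed
  \<comment> \<open>The two sums run over the injections with \<open>r\<close> outside and inside
    their domain.\<close>
  also have "madd C (L Y) (msum C (L Y) ?Q ?T (partial_injections n r)) \<dots> = msum C (L Y) ?Q ?T (partial_injections n (Suc r))"
    unfolding partial_injections_Suc
    by (intro msum_Un_disjoint[OF LY QOb, symmetric] partial_injections_disjoint finite_partial_injections
        finite_imageI finite_SigmaI finm T) (simp only: partial_injections_Suc)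
  finally show ?case
    unfolding v'_def w'_def a'_def x'_def .
qed

end

section \<open>From a differential structure to a coalgebra: functoriality\<close>

section \<open>The coalgebra of a differential structure\<close>

lemma Faa_sel [simp]:
  "Ob (Faa C) = faa_obj C" "Ar (Faa C) = faa_arr C" "Dom (Faa C) = fdom" "Cod (Faa C) = fcod"
  "Id (Faa C) = faa_id C" "Comp (Faa C) = faa_comp C" "Prd (Faa C) = faa_prod C"
  "Pr0 (Faa C) = faa_pr0 C" "Pr1 (Faa C) = faa_pr1 C" "Trm (Faa C) = (unit_cmon C, Trm C)"
  by (simp_all add: Faa_def)

lemma delta_comp_eq:
  fixes C f n r
  defines "A \<equiv> mcar (fst (fdom f))" and "X \<equiv> snd (fdom f)"
  defines "V \<equiv> npow C A n A" and "W \<equiv> npow C A n X"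
  shows "delta_comp C f n r = msum C (fst (fcod f)) (npow C V r W)
    (\<lambda>q. appl C (fseq f (n + r - card (fst q)))
      (delta_args n r (\<lambda>j i. vproj C V W r j \<cdot>\<^bsub>C\<^esub> vproj C A A n i) (\<lambda>j. vproj C V W r j \<cdot>\<^bsub>C\<^esub> vproj C A A n n)
        (\<lambda>i. vproj C V W r r \<cdot>\<^bsub>C\<^esub> vproj C A X n i) q)
      (vproj C V W r r \<cdot>\<^bsub>C\<^esub> vproj C A X n n))
    (partial_injections n r)"
  unfolding delta_comp_def Let_def A_def X_def V_def W_def partial_injections_def delta_args_def
  by (intro arg_cong2[where f = "msum C (fst (fcod f)) _"]) (auto simp: fun_eq_iff)

context generalized_cartesian_differential_structure
begin

lemma higher_1:
  assumes "f \<in> Hom C X Y"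
  shows "higher f (Suc 0) = D f"
  using assms by (auto simp: dirder_def Let_def)

text \<open>The second derivative differentiates \<open>D h\<close> with zero in its direction
  coordinate, which is the only coordinate that \<open>D h\<close> depends on; by [CD.2] the result
  is zero. All later ones are derivatives of a zero map.\<close>

lemma higher_linear:
  assumes h: "h \<in> Hom C X Y" and k: "k \<in> Hom C (L0 X) (L0 Y)" and Dh: "D h = Pr0 C (L0 X) X \<cdot> k"
  shows "higher h (Suc (Suc n)) = mnull C (L Y) (npow C (L0 X) (Suc (Suc n)) X)"
proof (induction n)
  case 0
  let ?A = "L0 X" and ?p = "Pr0 C (L0 X) X"
  let ?Q = "npow C ?A (Suc (Suc 0)) X" and ?b = "vproj C ?A X (Suc (Suc 0))"
  have Ob: "X \<in> Ob C" "Y \<in> Ob C" using h by auto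
  let ?\<tau> = "\<langle>mnull C (L X) ?Q, ?b 1\<rangle>" and ?\<pi> = "\<langle>?b 0, ?b (Suc (Suc 0))\<rangle>"
  have b: "?b i \<in> Hom C ?Q (if i < 2 then ?A else X)" if "i \<le> 2" for i
    using that Ob by (simp add: numeral_2_eq_2 del: npow.simps vproj.simps)
  have Q: "?Q \<in> Ob C" using Ob by simp
  have z: "mnull C (L X) ?Q \<in> Hom C ?Q ?A" using Ob Q by (simp del: npow.simps)
  have tp: "tangent ?Q (?A \<boxtimes> X) ?\<tau> ?\<pi>"
    using b[of 0] b[of 1] b[of 2] z Ob unfolding tangent_def
    by (simp add: numeral_2_eq_2 del: npow.simps vproj.simps)
  have p: "?p \<in> Hom C (?A \<boxtimes> X) ?A" using Ob by simp
  have "higher h (Suc (Suc 0)) = dirder ?\<tau> ?\<pi> (?p \<cdot> k)"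
    unfolding Dh[symmetric] higher_1[OF h, symmetric] higher_Suc[OF h, of "Suc 0"] by simp
  also have "\<dots> = dirder (dirder ?\<tau> ?\<pi> ?p) (?\<pi> \<cdot> ?p) k"
    by (rule dirder_comp[OF tp p k])
  also have "dirder ?\<tau> ?\<pi> ?p = mnull C (L ?A) ?Q"
    using dirder_Pr(1)[OF tp] Ob z b[of 1] by (simp del: npow.simps vproj.simps)
  also have "dirder (mnull C (L ?A) ?Q) (?\<pi> \<cdot> ?p) k = mnull C (L (L0 Y)) ?Q"
    using tp p by (intro dirder_zero[OF _ k]) (simp add: tangent_def del: npow.simps vproj.simps)
  finally show ?case using Ob by (simp del: npow.simps)
next
  case (Suc n)
  let ?m = "Suc (Suc n)"
  let ?Q = "npow C (L0 X) (Suc ?m) X" and ?b = "vproj C (L0 X) X (Suc ?m)"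
  have Ob: "X \<in> Ob C" "Y \<in> Ob C" using h by auto
  have "tangent ?Q (npow C (L0 X) ?m X) (tuple (replicate ?m (mnull C (L X) ?Q)) (?b ?m)) (tuple (map ?b [0..<?m]) (?b (Suc ?m)))"
    using Ob by (intro tangent_tuple replicate_Hom) (auto simp del: npow.simps vproj.simps replicate.simps)
  from dirder_mnull[OF this Ob(2)] show ?case
    unfolding higher_Suc[OF h, of ?m] Suc.IH .
qed

definition coalgebra :: "('o, 'm, ('o, 'm) fobj, ('o, 'm) farr) cfunctor" where
  "coalgebra = CFunctor (\<lambda>X\<in>Ob C. (L X, X))
     (\<lambda>f\<in>Ar C. FArr (L (Dom C f), Dom C f) (L (Cod C f), Cod C f) f (\<lambda>n\<in>{1..}. higher f n))"

lemma fob_coalgebra [simp]: "X \<in> Ob C \<Longrightarrow> fob coalgebra X = (L X, X)"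
  by (simp add: coalgebra_def)

lemma far_coalgebra:
  "f \<in> Hom C X Y \<Longrightarrow> far coalgebra f = FArr (L X, X) (L Y, Y) f (\<lambda>n\<in>{1..}. higher f n)"
  by (auto simp add: coalgebra_def)

text \<open>Identities, projections and the operations of \<open>L X\<close> all have such a
  derivative, so this computes their images under \<open>coalgebra\<close>.\<close>

lemma far_coalgebra_linear:
  assumes h: "h \<in> Hom C X Y" and k: "k \<in> Hom C (L0 X) (L0 Y)" and Dh: "D h = Pr0 C (L0 X) X \<cdot> k"
  shows "far coalgebra h = faa_lin C (L X, X) (L Y, Y) h (Pr0 C (L0 X) X \<cdot> k)"
proof -
  have "higher h n = (if n = 1 then Pr0 C (L0 X) X \<cdot> k else mnull C (L Y) (npow C (L0 X) n X))" if "n \<ge> 1" for n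
  proof (cases "n = 1")
    case True
    then show ?thesis using higher_1[OF h] Dh by simp
  next
    case False
    then obtain m where "n = Suc (Suc m)" using \<open>n \<ge> 1\<close> by (metis One_nat_def not0_implies_Suc not_one_le_zero)
    then show ?thesis using higher_linear[OF assms, of m] False by simp
  qed
  then show ?thesis
    unfolding far_coalgebra[OF h] by (auto simp: faa_lin_def restrict_def)
qed

lemma coalgebra_obj: "X \<in> Ob C \<Longrightarrow> (L X, X) \<in> faa_obj C"
  by (simp add: faa_obj_def)

lemma far_coalgebra_Hom:
  assumes f: "f \<in> Hom C X Y"
  shows "far coalgebra f \<in> Hom (Faa C) (L X, X) (L Y, Y)"
proof -
  have Ob: "X \<in> Ob C" "Y \<in> Ob C" using f by auto
  have "higher f n \<in> Hom C (npow C (L0 X) n X) (L0 Y)" if "1 \<le> n" for n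
    using higher_Hom[OF f, of n] that by simp
  moreover have "symmetric_map C (L0 X) X n (higher f n)" for n
    unfolding symmetric_map_def
    by (intro ballI allI impI appl_higher_mset[OF f]) (auto intro!: mset_permute_list)
  moreover have "multiadditive_map C (L X) X (L Y) n (higher f n)" for n
    unfolding multiadditive_map_def mcar_L
    by (intro ballI allI impI conjI appl_higher_multiadditive[OF f])
  ultimately have "far coalgebra f \<in> faa_arr C"
    unfolding faa_arr_def far_coalgebra[OF f]
    using Ob f coalgebra_obj by (intro CollectI exI conjI refl) auto
  then show ?thesis
    unfolding Hom_def by (simp add: far_coalgebra[OF f])
qed

lemma D_Id:
  assumes "X \<in> Ob C"
  shows "D (Id C X) = Pr0 C (L0 X) X \<cdot> Id C (L0 X)"
  using dirder_Id[of "L0 X \<boxtimes> X" X "Pr0 C (L0 X) X" "Pr1 C (L0 X) X"] assms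
  by (simp add: dirder_def tangent_def)

lemma far_coalgebra_Id: "X \<in> Ob C \<Longrightarrow> far coalgebra (Id C X) = faa_id C (L X, X)"
  using far_coalgebra_linear[OF _ _ D_Id, of X X] by (simp add: faa_id_def)

lemma far_coalgebra_Pr:
  assumes "X \<in> Ob C" "Y \<in> Ob C"
  shows "far coalgebra (Pr0 C X Y) = faa_pr0 C (L X, X) (L Y, Y)"
    "far coalgebra (Pr1 C X Y) = faa_pr1 C (L X, X) (L Y, Y)"
  using far_coalgebra_linear[of "Pr0 C X Y" "X \<boxtimes> Y" X "Pr0 C (L0 X) (L0 Y)"]
    far_coalgebra_linear[of "Pr1 C X Y" "X \<boxtimes> Y" Y "Pr1 C (L0 X) (L0 Y)"] assms
  by (simp_all add: faa_pr0_def faa_pr1_def faa_prod_def Let_def CD3_0 CD3_1)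

lemma far_coalgebra_comp:
  assumes f: "f \<in> Hom C X Y" and g: "g \<in> Hom C Y W"
  shows "far coalgebra (f \<cdot> g) = faa_comp C (far coalgebra f) (far coalgebra g)"
proof -
  have Ob: "X \<in> Ob C" "Y \<in> Ob C" "W \<in> Ob C" using f g by auto
  have fg: "f \<cdot> g \<in> Hom C X W" using f g by simp
  let ?a = "vproj C (L0 X) X"
  have "higher (f \<cdot> g) n = msum C (L W) (npow C (L0 X) n X)
      (\<lambda>P. appl C ((\<lambda>n\<in>{1..}. higher g n) (card P))
             (map (\<lambda>B. appl C ((\<lambda>n\<in>{1..}. higher f n) (card B)) (map (?a n) (sorted_list_of_set B)) (?a n n)) (blocks P))
             (?a n n \<cdot> f))
      {P. partition_on {..<n} P}" if n: "1 \<le> n" for n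
  proof -
    have T: "faa_term f g (?a n) (?a n n) Bs \<in> Hom C (npow C (L0 X) n X) (mcar (L W))" if "Bs \<in> block_lists n" for Bs
      unfolding mcar_L using that n Ob by (intro faa_term_Hom[OF f g _ _ that]) auto
    have "higher (f \<cdot> g) n = msum C (L W) (npow C (L0 X) n X) (faa_term f g (?a n) (?a n n)) (blocks ` {P. partition_on {..<n} P})"
      using higher_comp[OF f g, of n] n bij_betw_imp_surj_on[OF bij_betw_blocks, of n] by simp
    also have "\<dots> = msum C (L W) (npow C (L0 X) n X) (\<lambda>P. faa_term f g (?a n) (?a n n) (blocks P)) {P. partition_on {..<n} P}"
      using Ob T bij_betwE[OF bij_betw_blocks, of n] bij_betw_imp_inj_on[OF bij_betw_blocks, of n]
      by (intro msum_reindex) (auto simp del: Hom_iff)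
    also have "\<dots> = msum C (L W) (npow C (L0 X) n X)
      (\<lambda>P. appl C ((\<lambda>n\<in>{1..}. higher g n) (card P))
             (map (\<lambda>B. appl C ((\<lambda>n\<in>{1..}. higher f n) (card B)) (map (?a n) (sorted_list_of_set B)) (?a n n)) (blocks P))
             (?a n n \<cdot> f))
      {P. partition_on {..<n} P}"
    proof (rule msum_cong[symmetric, OF _ _ refl])
      fix P assume "P \<in> {P. partition_on {..<n} P}"
      then have P: "partition_on {..<n} P" by simp
      \<comment> \<open>Partitions of a nonempty set and their blocks are nonempty, so no sequence
        is evaluated at the index 0, where it is undefined.\<close>
      have "blocks P \<noteq> []" using blocks_props(1)[OF P] partition_onD1[OF P] n by (auto simp: lessThan_empty_iff)
      then have "card P \<ge> 1" using length_blocks[OF P] by (cases "blocks P") auto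
      moreover have "card B \<ge> 1" if "B \<in> set (blocks P)" for B
        using partition_on_lessThanD(1,2)[OF P, of B] that blocks_props(1)[OF P] by (simp add: Suc_le_eq card_gt_0_iff)
      ultimately show "appl C ((\<lambda>n\<in>{1..}. higher g n) (card P))
             (map (\<lambda>B. appl C ((\<lambda>n\<in>{1..}. higher f n) (card B)) (map (?a n) (sorted_list_of_set B)) (?a n n)) (blocks P))
             (?a n n \<cdot> f) = faa_term f g (?a n) (?a n n) (blocks P)"
        by (auto simp: faa_term_def faa_block_def length_blocks[OF P] intro!: arg_cong2[where f = "appl C _"])
      show "faa_term f g (?a n) (?a n n) (blocks P) \<in> Hom C (npow C (L0 X) n X) (mcar (L W))"
        using T bij_betwE[OF bij_betw_blocks, of n] P by blast
    qed (use Ob in auto)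
    finally show ?thesis .
  qed
  then show ?thesis
    unfolding far_coalgebra[OF f] far_coalgebra[OF g] far_coalgebra[OF fg] faa_comp_def Let_def
    by (auto simp: restrict_def)
qed

lemma cart_functor_coalgebra: "cart_functor C (Faa C) coalgebra"
  unfolding cart_functor_def Faa_sel
proof (intro conjI ballI allI)
  show "fob coalgebra \<in> extensional (Ob C)" "far coalgebra \<in> extensional (Ar C)"
    by (simp_all add: coalgebra_def)
  show "far coalgebra f \<in> Hom (Faa C) (fob coalgebra X) (fob coalgebra Y)" if "f \<in> Hom C X Y" for X Y f
    using far_coalgebra_Hom[OF that] that by auto
  show "far coalgebra (f \<cdot> g) = faa_comp C (far coalgebra f) (far coalgebra g)"
    if "f \<in> Hom C X Y" "g \<in> Hom C Y Z" for X Y Z f g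
    using that by (rule far_coalgebra_comp)
qed (simp_all add: coalgebra_obj far_coalgebra_Id far_coalgebra_Pr faa_prod_def)

section \<open>From a differential structure to a coalgebra: the comultiplication law\<close>

lemma npow_Faa: "X \<in> Ob C \<Longrightarrow> Y \<in> Ob C \<Longrightarrow> npow (Faa C) (L X, X) n (L Y, Y) = (L (npow C X n Y), npow C X n Y)"
  by (induction n) (simp_all add: faa_prod_def)

lemma far_coalgebra_faa_arr: "f \<in> Ar C \<Longrightarrow> far coalgebra f \<in> faa_arr C"
  using far_coalgebra_Hom[of f "Dom C f" "Cod C f"] by (simp add: Hom_def)

text \<open>By [CD.1] the operations of \<open>L X\<close> are linear, so that
  \<open>coalgebra\<close> sends them to the sequences ending in zeros that occur in
  \<open>delta_obj\<close>.\<close>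

lemma coalgebra_comult_obj:
  assumes X: "X \<in> Ob C"
  shows "delta_obj C (L X, X) = fob (Faa_functor C coalgebra) (L X, X)"
proof -
  have ty: "mplus (L X) \<in> Hom C (L0 X \<boxtimes> L0 X) (L0 X)" "mzero (L X) \<in> Hom C (Trm C) (L0 X)"
    using cmon_typ[OF L_cmon[OF X]] by simp_all
  have "far coalgebra (mplus (L X)) = faa_lin C (faa_prod C (L X, L0 X) (L X, L0 X)) (L X, L0 X)
     (mplus (L X)) (Pr0 C (L0 X \<boxtimes> L0 X) (L0 X \<boxtimes> L0 X) \<cdot> mplus (L X))"
    using far_coalgebra_linear[OF ty(1), of "mplus (L X)"] ty(1) X CD1_plus[OF X] by (simp add: faa_prod_def)
  moreover have "far coalgebra (mzero (L X)) = faa_lin C (unit_cmon C, Trm C) (L X, L0 X)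
     (mzero (L X)) (Pr0 C (Trm C) (Trm C) \<cdot> mzero (L X))"
    using far_coalgebra_linear[OF ty(2), of "mzero (L X)"] ty(2) X CD1_zero[OF X] by simp
  ultimately show ?thesis
    using X coalgebra_obj[OF X] by (simp add: delta_obj_def Faa_functor_def Let_def)
qed

text \<open>Compared at the indices \<open>n\<close> and \<open>r\<close>, the two sides are
  \<open>delta_comp\<close> and \<open>higher (higher f n) r\<close>, which
  \<open>higher_higher\<close> identifies.\<close>

lemma coalgebra_comult_arr:
  assumes f: "f \<in> Hom C X Y"
  shows "delta_arr C (far coalgebra f) = far (Faa_functor C coalgebra) (far coalgebra f)"
proof -
  have Ob: "X \<in> Ob C" "Y \<in> Ob C" using f by auto
  have "FArr (npow (Faa C) (L X, L0 X) n (L X, X)) (L Y, L0 Y) (higher f n)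
      (\<lambda>r\<in>{1..}. delta_comp C (far coalgebra f) n r) = far coalgebra (higher f n)" if n: "1 \<le> n" for n
  proof -
    let ?W = "npow C (L0 X) n X"
    have h: "higher f n \<in> Hom C ?W (L0 Y)" using higher_Hom[OF f, of n] n by simp
    have "delta_comp C (far coalgebra f) n r = higher (higher f n) r" for r
      unfolding delta_comp_eq far_coalgebra[OF f] farr.sel fst_conv snd_conv mcar_L
    proof -
      let ?V = "npow C (L0 X) n (L0 X)"
      let ?a = "vproj C ?V ?W r"
      let ?v = "\<lambda>j i. ?a j \<cdot> vproj C (L0 X) (L0 X) n i" and ?w = "\<lambda>j. ?a j \<cdot> vproj C (L0 X) (L0 X) n n"
        and ?b = "\<lambda>i. ?a r \<cdot> vproj C (L0 X) X n i" and ?x = "?a r \<cdot> vproj C (L0 X) X n n"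
      have Q: "npow C ?V r ?W \<in> Ob C" using Ob by simp
      have VW: "?V \<in> Ob C" "?W \<in> Ob C" using Ob by simp_all
      have "msum C (L Y) (npow C ?V r ?W) (\<lambda>q. appl C ((\<lambda>n\<in>{1..}. higher f n) (n + r - card (fst q)))
          (delta_args n r ?v ?w ?b q) ?x) (partial_injections n r)
        = msum C (L Y) (npow C ?V r ?W) (delta_term f n r ?v ?w ?b ?x) (partial_injections n r)"
      proof (rule msum_cong[OF _ Q refl])
        fix q assume q: "q \<in> partial_injections n r"
        have "1 \<le> n + r - card (fst q)" using card_partial_injection(1)[OF q] n by simp
        then show "appl C ((\<lambda>n\<in>{1..}. higher f n) (n + r - card (fst q))) (delta_args n r ?v ?w ?b q) ?x
           = delta_term f n r ?v ?w ?b ?x q"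
          by (simp add: delta_term_def)
        show "delta_term f n r ?v ?w ?b ?x q \<in> Hom C (npow C ?V r ?W) (mcar (L Y))"
          unfolding mcar_L using Ob VW n by (intro delta_term_Hom[OF f _ q]) auto
      qed (use Ob in auto)
      then show "msum C (L Y) (npow C ?V r ?W) (\<lambda>q. appl C ((\<lambda>n\<in>{1..}. higher f n) (n + r - card (fst q)))
          (delta_args n r ?v ?w ?b q) ?x) (partial_injections n r) = higher (higher f n) r"
        using higher_higher[OF f, of n r] n by simp
    qed
    then show ?thesis
      unfolding far_coalgebra[OF h] using npow_Faa[of "L0 X" X n] Ob by simp
  qed
  moreover have "far coalgebra f \<in> faa_arr C" using far_coalgebra_Hom[OF f] by (simp add: Hom_def)
  ultimately show ?thesis
    using coalgebra_comult_obj Ob coalgebra_obj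
    by (simp add: delta_arr_def Faa_functor_def Let_def far_coalgebra[OF f] restrict_def fun_eq_iff)
qed

theorem Faa_coalgebra_coalgebra: "Faa_coalgebra C coalgebra"
proof -
  have "comp_functor C coalgebra (Faa_counit C) = id_functor C"
    unfolding comp_functor_def Faa_counit_def id_functor_def
    using far_coalgebra_faa_arr
    by (auto simp: fun_eq_iff restrict_def coalgebra_obj far_coalgebra[OF Hom_iff[THEN iffD2]])
  moreover have "comp_functor C coalgebra (Faa_comult C) = comp_functor C coalgebra (Faa_functor C coalgebra)"
    unfolding comp_functor_def Faa_comult_def
    using coalgebra_comult_arr coalgebra_comult_obj far_coalgebra_faa_arr
    by (auto simp: fun_eq_iff restrict_def coalgebra_obj)
  ultimately show ?thesis
    using cart_functor_coalgebra by (simp add: Faa_coalgebra_def)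
qed

lemma differential_structure_of_coalgebra: "differential_structure_of C coalgebra = (L, D)"
proof -
  have "fseq (far coalgebra f) 1 = D f" if "f \<in> Ar C" for f
    using that far_coalgebra[of f "Dom C f" "Cod C f"] higher_1[of f "Dom C f" "Cod C f"] by simp
  then show ?thesis
    using L_extensional D_extensional
    by (auto simp: differential_structure_of_def extensional_def restrict_def fun_eq_iff)
qed

end

section \<open>From a coalgebra to a differential structure: the data, [CD.1] and [CD.3]\<close>

section \<open>The differential structure of a coalgebra\<close>

locale faa_coalgebra = cartesian_category C for C :: "('o, 'm) ccat" (structure) +
  fixes \<D> :: "('o, 'm, ('o, 'm) fobj, ('o, 'm) farr) cfunctor"
  assumes coalgebra: "Faa_coalgebra C \<D>"
begin

definition LL :: "'o \<Rightarrow> ('o, 'm) cmon" where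
  "LL = (\<lambda>X\<in>Ob C. fst (fob \<D> X))"

definition DD :: "'m \<Rightarrow> 'm" where
  "DD = (\<lambda>f\<in>Ar C. fseq (far \<D> f) 1)"

abbreviation A0 :: "'o \<Rightarrow> 'o" where
  "A0 X \<equiv> mcar (LL X)"

abbreviation F :: "'m \<Rightarrow> nat \<Rightarrow> 'm" where
  "F f n \<equiv> fseq (far \<D> f) n"

lemma cart_functor_D: "cart_functor C (Faa C) \<D>"
  and counit_D: "comp_functor C \<D> (Faa_counit C) = id_functor C"
  and comult_D: "comp_functor C \<D> (Faa_comult C) = comp_functor C \<D> (Faa_functor C \<D>)"
  using coalgebra by (simp_all add: Faa_coalgebra_def)

lemma fob_D_faa_obj: "X \<in> Ob C \<Longrightarrow> fob \<D> X \<in> faa_obj C"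
  using cart_functor_D by (simp add: cart_functor_def)

lemma far_D_Hom: "f \<in> Hom C X Y \<Longrightarrow> far \<D> f \<in> Hom (Faa C) (fob \<D> X) (fob \<D> Y)"
  using cart_functor_D unfolding cart_functor_def by blast

lemma far_D_faa_arr: "f \<in> Ar C \<Longrightarrow> far \<D> f \<in> faa_arr C"
  using far_D_Hom[of f "Dom C f" "Cod C f"] by (simp add: Hom_def)

lemma fob_D:
  assumes X: "X \<in> Ob C"
  shows "fob \<D> X = (LL X, X)"
proof -
  have "fob (comp_functor C \<D> (Faa_counit C)) X = X"
    using X by (simp add: counit_D id_functor_def)
  then show ?thesis
    using X fob_D_faa_obj[OF X] by (simp add: comp_functor_def Faa_counit_def LL_def prod_eq_iff)
qed

lemma fstar_D:
  assumes f: "f \<in> Ar C"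
  shows "fstar (far \<D> f) = f"
proof -
  have "far (comp_functor C \<D> (Faa_counit C)) f = f"
    using f by (simp add: counit_D id_functor_def)
  then show ?thesis
    using f far_D_faa_arr[OF f] by (simp add: comp_functor_def Faa_counit_def)
qed

lemma LL_cmon [simp]: "X \<in> Ob C \<Longrightarrow> commutative_monoid_in C (LL X)"
  using fob_D_faa_obj[of X] by (simp add: fob_D faa_obj_def)

lemma fdom_fcod_D:
  assumes "f \<in> Hom C X Y"
  shows "fdom (far \<D> f) = (LL X, X)" "fcod (far \<D> f) = (LL Y, Y)"
  using far_D_Hom[OF assms] assms by (auto simp: Hom_def fob_D)

lemma F_props:
  assumes f: "f \<in> Hom C X Y" and n: "1 \<le> n"
  shows "F f n \<in> Hom C (npow C (A0 X) n X) (A0 Y)" "symmetric_map C (A0 X) X n (F f n)"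
    "multiadditive_map C (LL X) X (LL Y) n (F f n)"
proof -
  have "far \<D> f \<in> faa_arr C" using far_D_faa_arr f by simp
  then obtain M X' N Y' fs fn where eq: "far \<D> f = FArr (M, X') (N, Y') fs fn"
    and *: "\<forall>n\<ge>1. fn n \<in> Hom C (npow C (mcar M) n X') (mcar N)
          \<and> symmetric_map C (mcar M) X' n (fn n) \<and> multiadditive_map C M X' N n (fn n)"
    unfolding faa_arr_def by blast
  have "M = LL X" "X' = X" "N = LL Y" "Y' = Y" using fdom_fcod_D[OF f] eq by auto
  then show "F f n \<in> Hom C (npow C (A0 X) n X) (A0 Y)" "symmetric_map C (A0 X) X n (F f n)"
    "multiadditive_map C (LL X) X (LL Y) n (F f n)"
    using * n eq by auto
qed

lemma fseq_D_extensional: "f \<in> Ar C \<Longrightarrow> fseq (far \<D> f) \<in> extensional {1..}"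
  using far_D_faa_arr[of f] by (auto simp: faa_arr_def)

lemma DD_eq: "f \<in> Ar C \<Longrightarrow> DD f = F f 1"
  by (simp add: DD_def)

lemma DD_Hom: "f \<in> Hom C X Y \<Longrightarrow> DD f \<in> Hom C (A0 X \<boxtimes> X) (A0 Y)"
  using F_props(1)[of f X Y 1] by (simp add: DD_eq)

lemma DD_typ [simp]:
  assumes "f \<in> Ar C"
  shows "DD f \<in> Ar C" "Dom C (DD f) = A0 (Dom C f) \<boxtimes> Dom C f" "Cod C (DD f) = A0 (Cod C f)"
  using DD_Hom[of f "Dom C f" "Cod C f"] assms by simp_all

text \<open>The comultiplication law on objects. Its carrier gives \<open>L (L0 X) = L X\<close>,
  and the first components of its two operations give [CD.1].\<close>

lemma comult_obj:
  assumes X: "X \<in> Ob C"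
  shows "delta_obj C (LL X, X) = (CMon (fob \<D> (A0 X)) (far \<D> (mplus (LL X))) (far \<D> (mzero (LL X))), fob \<D> X)"
proof -
  have "fob (comp_functor C \<D> (Faa_comult C)) X = fob (comp_functor C \<D> (Faa_functor C \<D>)) X"
    by (simp only: comult_D)
  then show ?thesis
    using X fob_D_faa_obj[OF X] by (simp add: comp_functor_def Faa_comult_def Faa_functor_def Let_def fob_D)
qed

lemma comult_arr:
  assumes f: "f \<in> Hom C X Y" and n: "1 \<le> n"
  shows "FArr (npow (Faa C) (LL X, A0 X) n (LL X, X)) (LL Y, A0 Y) (F f n) (\<lambda>r\<in>{1..}. delta_comp C (far \<D> f) n r)
    = far \<D> (F f n)"
proof -
  have fA: "f \<in> Ar C" using f by simp
  have "far (comp_functor C \<D> (Faa_comult C)) f = far (comp_functor C \<D> (Faa_functor C \<D>)) f"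
    by (simp only: comult_D)
  then have "fseq (delta_arr C (far \<D> f)) n = far \<D> (F f n)"
    using fA far_D_faa_arr[OF fA] n by (simp add: comp_functor_def Faa_comult_def Faa_functor_def Let_def)
  then show ?thesis
    using n by (simp add: delta_arr_def Let_def fdom_fcod_D[OF f])
qed

lemma LL_A0 [simp]:
  assumes X: "X \<in> Ob C"
  shows "LL (A0 X) = LL X"
proof -
  have "fob \<D> (A0 X) = (LL X, A0 X)"
    using comult_obj[OF X] by (simp add: delta_obj_def Let_def)
  then show ?thesis using X by (simp add: fob_D)
qed

lemma LL_Prd [simp]:
  assumes "X \<in> Ob C" "Y \<in> Ob C"
  shows "LL (X \<boxtimes> Y) = prod_cmon C (LL X) (LL Y)"
proof -
  have "fob \<D> (X \<boxtimes> Y) = faa_prod C (fob \<D> X) (fob \<D> Y)"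
    using cart_functor_D assms unfolding cart_functor_def by simp
  then show ?thesis using assms by (simp add: fob_D faa_prod_def)
qed

lemma LL_Trm [simp]: "LL (Trm C) = unit_cmon C"
proof -
  have "fob \<D> (Trm C) = (unit_cmon C, Trm C)"
    using cart_functor_D unfolding cart_functor_def by simp
  then show ?thesis by (simp add: fob_D)
qed

lemma DD_plus:
  assumes X: "X \<in> Ob C"
  shows "DD (mplus (LL X)) = Pr0 C (A0 X \<boxtimes> A0 X) (A0 X \<boxtimes> A0 X) \<cdot> mplus (LL X)"
    "DD (mzero (LL X)) = Pr0 C (Trm C) (Trm C) \<cdot> mzero (LL X)"
  using comult_obj[OF X] X by (auto simp: DD_eq delta_obj_def Let_def faa_lin_def dest!: sym[of "FArr _ _ _ _"])

lemma DD_Pr: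
  assumes "X \<in> Ob C" "Y \<in> Ob C"
  shows "DD (Pr0 C X Y) = Pr0 C (A0 X \<boxtimes> A0 Y) (X \<boxtimes> Y) \<cdot> Pr0 C (A0 X) (A0 Y)"
    "DD (Pr1 C X Y) = Pr0 C (A0 X \<boxtimes> A0 Y) (X \<boxtimes> Y) \<cdot> Pr1 C (A0 X) (A0 Y)"
proof -
  have "far \<D> (Pr0 C X Y) = faa_pr0 C (fob \<D> X) (fob \<D> Y)" "far \<D> (Pr1 C X Y) = faa_pr1 C (fob \<D> X) (fob \<D> Y)"
    using cart_functor_D assms unfolding cart_functor_def by simp_all
  then show "DD (Pr0 C X Y) = Pr0 C (A0 X \<boxtimes> A0 Y) (X \<boxtimes> Y) \<cdot> Pr0 C (A0 X) (A0 Y)"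
    "DD (Pr1 C X Y) = Pr0 C (A0 X \<boxtimes> A0 Y) (X \<boxtimes> Y) \<cdot> Pr1 C (A0 X) (A0 Y)"
    using assms by (simp_all add: DD_eq fob_D faa_pr0_def faa_pr1_def faa_lin_def Let_def)
qed

section \<open>[CD.5] and [CD.4] from functoriality\<close>

lemma partition_on_1: "{P. partition_on {..<Suc 0} P} = {{{0}}}"
proof (intro equalityI subsetI)
  fix P assume "P \<in> {P. partition_on {..<Suc 0} P}"
  then have P: "partition_on {..<Suc 0} P" by simp
  then have "blocks P \<in> block_lists (Suc 0)" using bij_betwE[OF bij_betw_blocks] by blast
  then have "blocks P = [{0}]" by (simp add: block_lists_1)
  then show "P \<in> {{{0}}}" using blocks_props(1)[OF P] by simp
next
  fix P :: "nat set set" assume "P \<in> {{{0}}}"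
  then show "P \<in> {P. partition_on {..<Suc 0} P}" using partition_on_space[of "{0::nat}"] by (simp add: lessThan_Suc)
qed

text \<open>First components of the functor law for composites: a one-element set has a single
  partition, so the sum has one term, which is that of [CD.5].\<close>

lemma DD_comp:
  assumes f: "f \<in> Hom C X Y" and g: "g \<in> Hom C Y Z"
  shows "DD (f \<cdot> g) = \<langle>DD f, Pr1 C (A0 X) X \<cdot> f\<rangle> \<cdot> DD g"
proof -
  have Ob: "X \<in> Ob C" "Y \<in> Ob C" "Z \<in> Ob C" using f g by auto
  have "far \<D> (f \<cdot> g) = faa_comp C (far \<D> f) (far \<D> g)"
    using cart_functor_D f g unfolding cart_functor_def Faa_sel by blast
  then have "F (f \<cdot> g) 1 = fseq (faa_comp C (far \<D> f) (far \<D> g)) 1" by simp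
  also have "\<dots> = msum C (LL Z) (A0 X \<boxtimes> X)
     (\<lambda>P. appl C (F g (card P)) (map (\<lambda>B. appl C (F f (card B)) (map (vproj C (A0 X) X 1) (sorted_list_of_set B)) (vproj C (A0 X) X 1 1)) (blocks P))
        (vproj C (A0 X) X 1 1 \<cdot> f)) {{{0}}}"
    using f partition_on_1 by (simp add: faa_comp_def Let_def fdom_fcod_D[OF f] fdom_fcod_D[OF g] fstar_D)
  also have "\<dots> = \<langle>DD f, Pr1 C (A0 X) X \<cdot> f\<rangle> \<cdot> DD g"
  proof -
    have "blocks {{0}} = [{0}]"
    proof -
      have P: "partition_on {..<Suc 0} {{0}}" using partition_on_1 by blast
      then have "blocks {{0}} \<in> block_lists (Suc 0)" using bij_betwE[OF bij_betw_blocks] by blast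
      then show ?thesis by (simp add: block_lists_1)
    qed
    then have "appl C (F g (card {{0::nat}})) (map (\<lambda>B. appl C (F f (card B)) (map (vproj C (A0 X) X 1) (sorted_list_of_set B)) (vproj C (A0 X) X 1 1)) (blocks {{0}}))
        (vproj C (A0 X) X 1 1 \<cdot> f) = \<langle>DD f, Pr1 C (A0 X) X \<cdot> f\<rangle> \<cdot> DD g"
      using f g Ob DD_eq[of f] DD_eq[of g] DD_Hom[OF f] DD_Hom[OF g] by (simp add: appl_tuple)
    then show ?thesis
      using f g Ob by (subst msum_singleton) auto
  qed
  finally show ?thesis using f g by (simp add: DD_eq)
qed

text \<open>A consequence of [CD.3] and [CD.5]: applying them to the composites of the pairing with
  the projections determines both components of its derivative.\<close>

lemma DD_pairing:
  assumes f: "f \<in> Hom C X Y" and g: "g \<in> Hom C X Z"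
  shows "DD \<langle>f, g\<rangle> = \<langle>DD f, DD g\<rangle>"
proof -
  have Ob: "X \<in> Ob C" "Y \<in> Ob C" "Z \<in> Ob C" using f g by auto
  have fg: "\<langle>f, g\<rangle> \<in> Hom C X (Y \<boxtimes> Z)" using f g by simp
  have D: "DD \<langle>f, g\<rangle> \<in> Hom C (A0 X \<boxtimes> X) (A0 Y \<boxtimes> A0 Z)" using DD_Hom[OF fg] Ob by simp
  have "DD f = DD (\<langle>f, g\<rangle> \<cdot> Pr0 C Y Z)" "DD g = DD (\<langle>f, g\<rangle> \<cdot> Pr1 C Y Z)" using f g by simp_all
  moreover have "DD (\<langle>f, g\<rangle> \<cdot> Pr0 C Y Z) = DD \<langle>f, g\<rangle> \<cdot> Pr0 C (A0 Y) (A0 Z)"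
    "DD (\<langle>f, g\<rangle> \<cdot> Pr1 C Y Z) = DD \<langle>f, g\<rangle> \<cdot> Pr1 C (A0 Y) (A0 Z)"
    using DD_comp[OF fg, of "Pr0 C Y Z" Y] DD_comp[OF fg, of "Pr1 C Y Z" Z] D fg Ob f g
    by (simp_all add: DD_Pr)
  ultimately show ?thesis
    using pairing_eta[of "DD \<langle>f, g\<rangle>" "A0 Y" "A0 Z"] D Ob by simp
qed

text \<open>The comultiplication law at \<open>r = 1\<close>. A partial injection on one index is
  empty, which gives the appended \<open>t\<close>, or sends the index to some \<open>i < n\<close>,
  which replaces the argument at \<open>i\<close>.\<close>

lemma DD_F:
  assumes f: "f \<in> Hom C X Y" and n: "1 \<le> n"
    and ts: "set ts \<subseteq> Hom C Z (A0 X)" "length ts = n" and t: "t \<in> Hom C Z (A0 X)"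
    and zs: "set zs \<subseteq> Hom C Z (A0 X)" "length zs = n" and x: "x \<in> Hom C Z X"
  shows "\<langle>tuple ts t, tuple zs x\<rangle> \<cdot> DD (F f n)
    = madd C (LL Y) (appl C (F f (Suc n)) (zs @ [t]) x) (msum C (LL Y) Z (\<lambda>i. appl C (F f n) (zs[i := ts ! i]) x) {..<n})"
proof -
  have Ob: "X \<in> Ob C" "Y \<in> Ob C" "Z \<in> Ob C" using f x by auto
  let ?A = "A0 X"
  let ?V = "npow C ?A n ?A" and ?W = "npow C ?A n X"
  let ?k = "vproj C ?A ?A n" and ?l = "vproj C ?A X n"
  let ?p = "Pr0 C ?V ?W" and ?q = "Pr1 C ?V ?W"
  define v where "v = (\<lambda>j i. vproj C ?V ?W (Suc 0) j \<cdot> ?k i)"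
  define w where "w = (\<lambda>j. vproj C ?V ?W (Suc 0) j \<cdot> ?k n)"
  define a where "a = (\<lambda>i. ?q \<cdot> ?l i)"
  define y where "y = ?q \<cdot> ?l n"
  let ?e = "({}, \<lambda>_. undefined) :: nat set \<times> (nat \<Rightarrow> nat)"
  let ?T = "\<lambda>q. appl C (F f (n + Suc 0 - card (fst q))) (delta_args n (Suc 0) v w a q) y"
  let ?Q = "?V \<boxtimes> ?W"
  have VW: "?V \<in> Ob C" "?W \<in> Ob C" "?Q \<in> Ob C" using Ob by simp_all
  have LY: "commutative_monoid_in C (LL Y)" using Ob by simp
  have e: "?e \<in> partial_injections n 0" by (simp add: partial_injections_0)
  have vw: "v 0 i = ?p \<cdot> ?k i" "w 0 = ?p \<cdot> ?k n" for i by (simp_all add: v_def w_def)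
  let ?as = "map a [0..<n]"
  have a: "set ?as \<subseteq> Hom C ?Q ?A" "length ?as = n" using Ob VW by (auto simp: a_def)
  have y: "y \<in> Hom C ?Q X" using Ob VW by (simp add: y_def)
  have w0: "w 0 \<in> Hom C ?Q ?A" using Ob VW by (simp add: vw)
  have v0: "v 0 i \<in> Hom C ?Q ?A" if "i < n" for i using Ob VW that by (simp add: vw)
  have args0: "delta_args n 0 v w a ?e = ?as" by (simp add: delta_args_def)
  have Te: "?T ?e = appl C (F f (Suc n)) (?as @ [w 0]) y"
    using delta_args_Suc[OF e, of v w a] by (simp add: args0)
  have Ti: "?T (extend_injection 0 (?e, i)) = appl C (F f n) (?as[i := v 0 i]) y" if "i < n" for i
    using delta_args_extend[OF e, of i v w a] card_partial_injection(2)[OF e, of i] that by (simp add: args0)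
  have tye: "appl C (F f (Suc n)) (?as @ [w 0]) y \<in> Hom C ?Q (A0 Y)"
    using a w0 by (intro appl_Hom[OF F_props(1)[OF f] _ y]) auto
  have asv: "set (?as[i := v 0 i]) \<subseteq> Hom C ?Q ?A" if "i < n" for i
    using a(1) v0[OF that] set_update_subset_insert by fast
  have tyi: "appl C (F f n) (?as[i := v 0 i]) y \<in> Hom C ?Q (A0 Y)" if "i < n" for i
    using asv[OF that] by (intro appl_Hom[OF F_props(1)[OF f n] _ y]) auto
  have inj: "inj_on (\<lambda>i. extend_injection 0 (?e, i)) {..<n}"
    by (auto simp: inj_on_def extend_injection_def fun_eq_iff split: if_splits)
  have Pi: "partial_injections n (Suc 0) = insert ?e ((\<lambda>i. extend_injection 0 (?e, i)) ` {..<n})"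
    unfolding partial_injections_Suc partial_injections_0 by auto
  have "DD (F f n) = delta_comp C (far \<D> f) n 1"
    using comult_arr[OF f n] F_props(1)[OF f n] by (simp add: DD_eq) (metis One_nat_def atLeast_iff farr.sel(4) order_refl restrict_apply)
  also have "\<dots> = msum C (LL Y) ?Q ?T (partial_injections n (Suc 0))"
    unfolding delta_comp_eq fdom_fcod_D[OF f] fst_conv snd_conv One_nat_def v_def w_def a_def y_def using VW Ob by simp
  also have "\<dots> = madd C (LL Y) (?T ?e) (msum C (LL Y) ?Q ?T ((\<lambda>i. extend_injection 0 (?e, i)) ` {..<n}))"
    unfolding Pi
  proof (rule msum_insert[OF LY VW(3)])
    show "?e \<notin> (\<lambda>i. extend_injection 0 (?e, i)) ` {..<n}" by (auto simp: extend_injection_def)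
    show "?T q \<in> Hom C ?Q (A0 Y)" if "q \<in> insert ?e ((\<lambda>i. extend_injection 0 (?e, i)) ` {..<n})" for q
      using that tye tyi Te Ti by (auto simp del: Hom_iff)
  qed simp
  also have "msum C (LL Y) ?Q ?T ((\<lambda>i. extend_injection 0 (?e, i)) ` {..<n})
     = msum C (LL Y) ?Q (\<lambda>i. ?T (extend_injection 0 (?e, i))) {..<n}"
    using tyi Ti by (intro msum_reindex[OF LY VW(3) inj]) (auto simp del: Hom_iff)
  also have "\<dots> = msum C (LL Y) ?Q (\<lambda>i. appl C (F f n) (?as[i := v 0 i]) y) {..<n}"
    using tyi Ti by (intro msum_cong[OF LY VW(3)]) (auto simp del: Hom_iff)
  finally have DF: "DD (F f n) = madd C (LL Y) (appl C (F f (Suc n)) (?as @ [w 0]) y)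
      (msum C (LL Y) ?Q (\<lambda>i. appl C (F f n) (?as[i := v 0 i]) y) {..<n})"
    unfolding Te .
  \<comment> \<open>So far the formula holds at the generic point; precomposition with
    \<open>?h\<close> carries it to the given arguments.\<close>
  let ?h = "\<langle>tuple ts t, tuple zs x\<rangle>"
  have tt: "tuple ts t \<in> Hom C Z ?V" "tuple zs x \<in> Hom C Z ?W"
    using tuple_Hom[OF ts(1) t ts(2)] tuple_Hom[OF zs(1) x zs(2)] .
  have h: "?h \<in> Hom C Z ?Q" using tt by simp
  have hp: "?h \<cdot> (?p \<cdot> s) = tuple ts t \<cdot> s" if "s \<in> Ar C" "Dom C s = ?V" for s
    using tt that by simp
  have hq: "?h \<cdot> (?q \<cdot> s) = tuple zs x \<cdot> s" if "s \<in> Ar C" "Dom C s = ?W" for s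
    using tt that by simp
  have hv: "?h \<cdot> v 0 i = ts ! i" if "i < n" for i
    unfolding vw using hp[of "?k i"] tuple_vproj(1)[OF ts(1) t _ ts(2) that] that Ob by simp
  have hw: "?h \<cdot> w 0 = t"
    unfolding vw using hp[of "?k n"] tuple_vproj(2)[OF ts(1) t _ ts(2)] Ob by simp
  have ha: "?h \<cdot> a i = zs ! i" if "i < n" for i
    unfolding a_def using hq[of "?l i"] tuple_vproj(1)[OF zs(1) x _ zs(2) that] that Ob by simp
  have hy: "?h \<cdot> y = x"
    unfolding y_def using hq[of "?l n"] tuple_vproj(2)[OF zs(1) x _ zs(2)] Ob by simp
  have has: "map (\<lambda>z. ?h \<cdot> z) ?as = zs"
    using ha zs(2) by (intro nth_equalityI) auto
  have 1: "?h \<cdot> appl C (F f (Suc n)) (?as @ [w 0]) y = appl C (F f (Suc n)) (zs @ [t]) x"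
    using comp_appl[OF F_props(1)[OF f] _ y _ h, of "Suc n" "?as @ [w 0]"] a w0 has hw hy by simp
  have 2: "?h \<cdot> appl C (F f n) (?as[i := v 0 i]) y = appl C (F f n) (zs[i := ts ! i]) x" if "i < n" for i
    using comp_appl[OF F_props(1)[OF f n] asv[OF that] y _ h] has hv[OF that] hy by (simp add: map_update)
  have ty2: "appl C (F f n) (zs[i := ts ! i]) x \<in> Hom C Z (A0 Y)" if "i < n" for i
    unfolding 2[OF that, symmetric] using h tyi[OF that] by (rule Comp_Hom)
  have s: "msum C (LL Y) ?Q (\<lambda>i. appl C (F f n) (?as[i := v 0 i]) y) {..<n} \<in> Hom C ?Q (A0 Y)"
    using tyi by (intro msum_Hom[OF LY VW(3)]) (simp del: Hom_iff)
  have "?h \<cdot> DD (F f n) = madd C (LL Y) (?h \<cdot> appl C (F f (Suc n)) (?as @ [w 0]) y)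
     (?h \<cdot> msum C (LL Y) ?Q (\<lambda>i. appl C (F f n) (?as[i := v 0 i]) y) {..<n})"
    unfolding DF using LY tye s h by (intro comp_madd) auto
  also have "?h \<cdot> msum C (LL Y) ?Q (\<lambda>i. appl C (F f n) (?as[i := v 0 i]) y) {..<n}
     = msum C (LL Y) Z (\<lambda>i. ?h \<cdot> appl C (F f n) (?as[i := v 0 i]) y) {..<n}"
    using tyi by (intro comp_msum[OF LY h]) (simp del: Hom_iff)
  also have "\<dots> = msum C (LL Y) Z (\<lambda>i. appl C (F f n) (zs[i := ts ! i]) x) {..<n}"
    using 2 ty2 by (intro msum_cong[OF LY Ob(3)]) (auto simp del: Hom_iff)
  finally show ?thesis unfolding 1 .
qed

lemma F_multiadditive:
  assumes f: "f \<in> Hom C X Y" and zs: "set zs \<subseteq> Hom C Z (A0 X)" "length zs = n" and x: "x \<in> Hom C Z X" and i: "i < n"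
  shows "a \<in> Hom C Z (A0 X) \<Longrightarrow> b \<in> Hom C Z (A0 X) \<Longrightarrow> appl C (F f n) (zs[i := madd C (LL X) a b]) x
       = madd C (LL Y) (appl C (F f n) (zs[i := a]) x) (appl C (F f n) (zs[i := b]) x)"
    "appl C (F f n) (zs[i := mnull C (LL X) Z]) x = mnull C (LL Y) Z"
proof -
  have Z: "Z \<in> Ob C" using x by auto
  have m: "multiadditive_map C (LL X) X (LL Y) n (F f n)" using i by (intro F_props(3)[OF f]) simp
  note * = m[unfolded multiadditive_map_def, rule_format, OF Z i zs(2,1) x]
  show "a \<in> Hom C Z (A0 X) \<Longrightarrow> b \<in> Hom C Z (A0 X) \<Longrightarrow> appl C (F f n) (zs[i := madd C (LL X) a b]) x
       = madd C (LL Y) (appl C (F f n) (zs[i := a]) x) (appl C (F f n) (zs[i := b]) x)"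
    using conjunct1[OF *] by blast
  show "appl C (F f n) (zs[i := mnull C (LL X) Z]) x = mnull C (LL Y) Z"
    using conjunct2[OF *] .
qed

text \<open>With zeros for \<open>ts\<close>, multiadditivity removes every summand of
  \<open>DD_F\<close> but the first. What remains is the recursion that defines
  \<open>higher\<close>.\<close>

lemma F_Suc:
  assumes f: "f \<in> Hom C X Y" and n: "1 \<le> n"
    and t: "t \<in> Hom C Z (A0 X)" and zs: "set zs \<subseteq> Hom C Z (A0 X)" "length zs = n" and x: "x \<in> Hom C Z X"
  shows "\<langle>tuple (replicate n (mnull C (LL X) Z)) t, tuple zs x\<rangle> \<cdot> DD (F f n) = appl C (F f (Suc n)) (zs @ [t]) x"
proof -
  let ?z = "mnull C (LL X) Z"
  have Ob: "X \<in> Ob C" "Y \<in> Ob C" "Z \<in> Ob C" using f x by auto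
  have z: "set (replicate n ?z) \<subseteq> Hom C Z (A0 X)" using Ob by (auto simp: set_replicate_conv_if)
  have "msum C (LL Y) Z (\<lambda>i. appl C (F f n) (zs[i := replicate n ?z ! i]) x) {..<n} = mnull C (LL Y) Z"
    using F_multiadditive(2)[OF f zs x] Ob by (intro msum_null) auto
  moreover have "appl C (F f (Suc n)) (zs @ [t]) x \<in> Hom C Z (A0 Y)"
    using zs t by (intro appl_Hom[OF F_props(1)[OF f] _ x]) auto
  ultimately show ?thesis
    using DD_F[OF f n z length_replicate t zs x] Ob by simp
qed

text \<open>The case \<open>n = 1\<close> of \<open>DD_F\<close>. For \<open>b = 0\<close> the first
  summand vanishes, which is [CD.6]; for \<open>a = 0\<close> the second does, and the symmetry of
  \<open>F f 2\<close> becomes [CD.7].\<close>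

lemma DD_DD:
  assumes f: "f \<in> Hom C X Y" and a: "a \<in> Hom C Z (A0 X)" "b \<in> Hom C Z (A0 X)" "c \<in> Hom C Z (A0 X)" and d: "d \<in> Hom C Z X"
  shows "\<langle>\<langle>a, b\<rangle>, \<langle>c, d\<rangle>\<rangle> \<cdot> DD (DD f) = madd C (LL Y) (appl C (F f 2) [c, b] d) (\<langle>a, d\<rangle> \<cdot> DD f)"
proof -
  have Ob: "X \<in> Ob C" "Y \<in> Ob C" "Z \<in> Ob C" using f d by auto
  have "msum C (LL Y) Z (\<lambda>i. appl C (F f 1) ([c][i := [a] ! i]) d) {..<1} = \<langle>a, d\<rangle> \<cdot> DD f"
  proof -
    have "\<langle>a, d\<rangle> \<cdot> DD f \<in> Hom C Z (A0 Y)" using f a d Ob by simp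
    moreover have "appl C (F f 1) [a] d = \<langle>a, d\<rangle> \<cdot> DD f" using f by (simp add: DD_eq appl_tuple)
    ultimately show ?thesis using Ob by (simp add: lessThan_Suc msum_singleton)
  qed
  then show ?thesis
    using DD_F[OF f order_refl, of "[a]" Z b "[c]" d] a d f by (simp add: DD_eq numeral_2_eq_2)
qed

lemma appl_F2_swap:
  assumes f: "f \<in> Hom C X Y" and a: "a \<in> Hom C Z (A0 X)" "b \<in> Hom C Z (A0 X)" and d: "d \<in> Hom C Z X"
  shows "appl C (F f 2) [a, b] d = appl C (F f 2) [b, a] d"
proof -
  have Z: "Z \<in> Ob C" using d by auto
  let ?\<sigma> = "Transposition.transpose 0 (1::nat)"
  have \<sigma>: "?\<sigma> permutes {..<2}" by (rule permutes_swap_id) auto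
  have "permute_list ?\<sigma> [a, b] = [b, a]" by (simp add: permute_list_def upt_rec)
  moreover have "appl C (F f 2) (permute_list ?\<sigma> [a, b]) d = appl C (F f 2) [a, b] d"
    using F_props(2)[OF f, of 2, unfolded symmetric_map_def] Z a d \<sigma> by simp
  ultimately show ?thesis by simp
qed

lemma differential_structure: "generalized_cartesian_differential_structure C LL DD"
proof unfold_locales
  show "LL \<in> extensional (Ob C)" "DD \<in> extensional (Ar C)" by (simp_all add: LL_def DD_def)
  fix f X Y Z a b c d
  assume f: "f \<in> Hom C X Y"
  have Ob: "X \<in> Ob C" "Y \<in> Ob C" using f by auto
  show "DD f \<in> Hom C (A0 X \<boxtimes> X) (A0 Y)" using f by (rule DD_Hom)
  show "\<langle>madd C (LL X) a b, c\<rangle> \<cdot> DD f = madd C (LL Y) (\<langle>a, c\<rangle> \<cdot> DD f) (\<langle>b, c\<rangle> \<cdot> DD f)"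
    if "a \<in> Hom C Z (A0 X)" "b \<in> Hom C Z (A0 X)" "c \<in> Hom C Z X"
    using F_multiadditive(1)[OF f, of "[a]" Z 1 c 0 a b] that f by (simp add: DD_eq appl_tuple)
  show "\<langle>mnull C (LL X) Z, a\<rangle> \<cdot> DD f = mnull C (LL Y) Z" if "a \<in> Hom C Z X"
    using F_multiadditive(2)[OF f, of "[mnull C (LL X) Z]" Z 1 a 0] that f Ob by (auto simp: DD_eq appl_tuple)
  show "DD \<langle>f, g\<rangle> = \<langle>DD f, DD g\<rangle>" if "g \<in> Hom C X Z" for g
    using f that by (rule DD_pairing)
  show "DD (f \<cdot> g) = \<langle>DD f, Pr1 C (A0 X) X \<cdot> f\<rangle> \<cdot> DD g" if "g \<in> Hom C Y Z" for g
    using f that by (rule DD_comp)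
  show "\<langle>\<langle>a, mnull C (LL X) Z\<rangle>, \<langle>c, d\<rangle>\<rangle> \<cdot> DD (DD f) = \<langle>a, d\<rangle> \<cdot> DD f"
    if t: "a \<in> Hom C Z (A0 X)" "c \<in> Hom C Z (A0 X)" "d \<in> Hom C Z X"
  proof -
    have Z: "Z \<in> Ob C" using t by auto
    have z: "mnull C (LL X) Z \<in> Hom C Z (A0 X)" using Z Ob by simp
    have "appl C (F f 2) [c, mnull C (LL X) Z] d = mnull C (LL Y) Z"
      using F_multiadditive(2)[OF f, of "[c, mnull C (LL X) Z]" Z 2 d 1] t z by simp
    then show ?thesis using DD_DD[OF f t(1) z t(2,3)] t f Ob by simp
  qed
  show "\<langle>\<langle>mnull C (LL X) Z, b\<rangle>, \<langle>c, d\<rangle>\<rangle> \<cdot> DD (DD f) = \<langle>\<langle>mnull C (LL X) Z, c\<rangle>, \<langle>b, d\<rangle>\<rangle> \<cdot> DD (DD f)"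
    if t: "b \<in> Hom C Z (A0 X)" "c \<in> Hom C Z (A0 X)" "d \<in> Hom C Z X"
  proof -
    have Z: "Z \<in> Ob C" using t by auto
    have z: "mnull C (LL X) Z \<in> Hom C Z (A0 X)" using Z Ob by simp
    show ?thesis
      using DD_DD[OF f z t] DD_DD[OF f z t(2,1,3)] appl_F2_swap[OF f t(2,1,3)] by simp
  qed
qed (simp_all add: DD_plus DD_Pr)

section \<open>Recovering the coalgebra from its first components\<close>

abbreviation "derived_higher \<equiv> generalized_cartesian_differential_structure.higher C LL DD"
abbreviation "derived_coalgebra \<equiv> generalized_cartesian_differential_structure.coalgebra C LL DD"

text \<open>Both sequences start with \<open>DD f\<close> and, by \<open>F_Suc\<close> at the
  generic point, obey the same recursion.\<close>

lemma higher_eq_F: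
  assumes f: "f \<in> Hom C X Y" and n: "1 \<le> n"
  shows "derived_higher f n = F f n"
  using n
proof (induction n rule: dec_induct)
  case base
  then show ?case using generalized_cartesian_differential_structure.higher_1[OF differential_structure f] f by (simp add: DD_eq)
next
  case (step n)
  let ?Q = "npow C (A0 X) (Suc n) X" and ?b = "vproj C (A0 X) X (Suc n)"
  have Ob: "X \<in> Ob C" "Y \<in> Ob C" using f by auto
  have b: "?b n \<in> Hom C ?Q (A0 X)" "?b (Suc n) \<in> Hom C ?Q X" "set (map ?b [0..<n]) \<subseteq> Hom C ?Q (A0 X)"
    using Ob by (auto simp del: npow.simps vproj.simps)
  have "derived_higher f (Suc n) = appl C (F f (Suc n)) (map ?b [0..<n] @ [?b n]) (?b (Suc n))"
    unfolding generalized_cartesian_differential_structure.higher_Suc[OF differential_structure f] step.IH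
      generalized_cartesian_differential_structure.dirder_def[OF differential_structure]
    by (rule F_Suc[OF f step.hyps(1) b(1,3) _ b(2)]) simp
  also have "map ?b [0..<n] @ [?b n] = vprojs (A0 X) X (Suc n)" by simp
  also have "appl C (F f (Suc n)) \<dots> (?b (Suc n)) = F f (Suc n)"
    using F_props(1)[OF f, of "Suc n"] Ob by (intro appl_vprojs) auto
  finally show ?case .
qed

text \<open>Equality of HOL functions also requires agreement off the objects and arrows and at the
  index 0 of the sequences; there both sides are undefined.\<close>

lemma coalgebra_eq: "derived_coalgebra = \<D>"
proof -
  have "fob derived_coalgebra X = fob \<D> X" for X
    using cart_functor_D fob_D[of X]
    by (cases "X \<in> Ob C") (auto simp: generalized_cartesian_differential_structure.coalgebra_def[OF differential_structure] cart_functor_def extensional_def)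
  moreover have "far derived_coalgebra f = far \<D> f" for f
  proof (cases "f \<in> Ar C")
    case True
    then have f: "f \<in> Hom C (Dom C f) (Cod C f)" by simp
    have "(\<lambda>n\<in>{1..}. derived_higher f n) = fseq (far \<D> f)"
      using higher_eq_F[OF f] fseq_D_extensional[OF True] by (auto simp: fun_eq_iff extensional_def)
    then show ?thesis
      unfolding generalized_cartesian_differential_structure.far_coalgebra[OF differential_structure f] using fdom_fcod_D[OF f] fstar_D[OF True] by (cases "far \<D> f") auto
  next
    case False
    then show ?thesis using cart_functor_D by (simp add: generalized_cartesian_differential_structure.coalgebra_def[OF differential_structure] cart_functor_def extensional_def)
  qed
  ultimately show ?thesis by (intro cfunctor.expand) (auto simp: fun_eq_iff)
qed

end

theorem theorem2p12:
  fixes C :: "('o, 'm) ccat"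
  assumes "cartesian_category C"
  shows "bij_betw (differential_structure_of C)
           {\<D>. Faa_coalgebra C \<D>}
           {(L, D). generalized_cartesian_differential_structure C L D}"
proof (rule bij_betw_byWitness[where f' = "\<lambda>(L, D). generalized_cartesian_differential_structure.coalgebra C L D"])
  have loc: "faa_coalgebra C \<D>" if "Faa_coalgebra C \<D>" for \<D>
    using assms that by (simp add: faa_coalgebra_def faa_coalgebra_axioms_def)
  have eq: "differential_structure_of C \<D> = (faa_coalgebra.LL C \<D>, faa_coalgebra.DD C \<D>)"
    if "Faa_coalgebra C \<D>" for \<D>
    using loc[OF that]
    by (simp add: differential_structure_of_def faa_coalgebra.LL_def faa_coalgebra.DD_def)
  \<comment> \<open>This half gives injectivity: a coalgebra is rebuilt from its derivative by
    iterating the recursion for \<open>higher\<close>.\<close>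
  show "\<forall>\<D>\<in>{\<D>. Faa_coalgebra C \<D>}. (case differential_structure_of C \<D> of (L, D) \<Rightarrow>
      generalized_cartesian_differential_structure.coalgebra C L D) = \<D>"
    using loc by (auto simp: eq faa_coalgebra.coalgebra_eq)
  show "\<forall>p\<in>{(L, D). generalized_cartesian_differential_structure C L D}.
      differential_structure_of C (case p of (L, D) \<Rightarrow> generalized_cartesian_differential_structure.coalgebra C L D) = p"
    by (auto simp: generalized_cartesian_differential_structure.differential_structure_of_coalgebra)
  show "differential_structure_of C ` {\<D>. Faa_coalgebra C \<D>}
      \<subseteq> {(L, D). generalized_cartesian_differential_structure C L D}"
    using loc by (auto simp: eq faa_coalgebra.differential_structure)
  show "(\<lambda>(L, D). generalized_cartesian_differential_structure.coalgebra C L D) `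
      {(L, D). generalized_cartesian_differential_structure C L D} \<subseteq> {\<D>. Faa_coalgebra C \<D>}"
    by (auto simp: generalized_cartesian_differential_structure.Faa_coalgebra_coalgebra)
qed

end
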